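(* Let $SMI(\mathcal P)$ be the symmetric bimonoidal intermuting category freely generated by an infinite set $\mathcal P$ of letters, and let $A$ and $B$ be objects of $SMI(\mathcal P)$. If either both $A$ and $B$ are pure and diversified, or no letter occurs in $A$ and in $B$, then there is at most one arrow $f:A\to B$ in $SMI(\mathcal P)$.
   Context: An SMI (symmetric bimonoidal intermuting) category is a category with two symmetric monoidal structures $(\vee,\bot,\check\alpha,\check\sigma,\check\rho,\check\lambda)$ and $(\wedge,\top,\hat\alpha,\hat\sigma,\hat\rho,\hat\lambda)$, where $\check\alpha^{\to}_{A,B,C}:A\vee(B\vee C)\to(A\vee B)\vee C$, $\check\sigma_{A,B}:A\vee B\to B\vee A$, $\check\rho^{\to}_A:A\vee\bot\to A$, $\check\lambda^{\to}_A:\bot\vee A\to A$ are the structural natural isomorphisms (with inverses $\check\alpha^{\leftarrow},\check\rho^{\leftarrow},\check\lambda^{\leftarrow}$), and analogously for $\wedge,\top$ with hats; together with a natural transformation $\iota_{A,B,C,D}:(A\wedge B)\vee(C\wedge D)\to(A\vee C)\wedge(B\vee D)$, isomorphisms $\beta^{\leftarrow}:\bot\to\bot\wedge\bot$ (inverse $\beta^{\to}$) and $\tau^{\to}:\top\vee\top\to\top$ (inverse $\tau^{\leftarrow}$), and an arrow $\kappa:\bot\to\top$, such that for all objects: (1) $\iota_{A\vee B,D\vee E,C,F}\circ(\iota_{A,D,B,E}\vee \mathbf 1)\circ\check\alpha^{\to}_{A\wedge D,B\wedge E,C\wedge F}=(\check\alpha^{\to}_{A,B,C}\wedge\check\alpha^{\to}_{D,E,F})\circ\iota_{A,D,B\vee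 C,E\vee F}\circ(\mathbf 1\vee\iota_{B,E,C,F})$; (2) $\iota_{B,D,A,C}\circ\check\sigma_{A\wedge C,B\wedge D}=(\check\sigma_{A,B}\wedge\check\sigma_{C,D})\circ\iota_{A,C,B,D}$; (3) $(\check\rho^{\to}_A\wedge\check\rho^{\to}_B)\circ\iota_{A,B,\bot,\bot}\circ(\mathbf 1\vee\beta^{\leftarrow})=\check\rho^{\to}_{A\wedge B}$; (4) $\tau^{\to}\circ(\tau^{\to}\vee\mathbf 1)\circ\check\alpha^{\to}_{\top,\top,\top}=\tau^{\to}\circ(\mathbf 1\vee\tau^{\to})$; (5) $\tau^{\to}\circ\check\sigma_{\top,\top}=\tau^{\to}$; (6) $\tau^{\to}\circ(\mathbf 1_\top\vee\kappa)=\check\rho^{\to}_\top$; (7) $\hat\alpha^{\to}_{A\vee D,B\vee E,C\vee F}\circ(\mathbf 1\wedge\iota_{B,C,E,F})\circ\iota_{A,B\wedge C,D,E\wedge F}=(\iota_{A,B,D,E}\wedge\mathbf 1)\circ\iota_{A\wedge B,C,D\wedge E,F}\circ(\hat\alpha^{\to}_{A,B,C}\vee\hat\alpha^{\to}_{D,E,F})$; (8) $\hat\alpha^{\to}_{\bot,\bot,\bot}\circ(\mathbf 1\wedge\beta^{\leftarrow})\circ\beta^{\leftarrow}=(\beta^{\leftarrow}\wedge\mathbf 1)\circ\beta^{\leftarrow}$; (9) $\hat\sigma_{A\vee C,B\vee D}\circ\iota_{A,B,C,D}=\iota_{B,A,D,C}\circ(\hat\sigma_{A,B}\vee\hat\sigma_{C,D})$;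 (10) $\hat\sigma_{\bot,\bot}\circ\beta^{\leftarrow}=\beta^{\leftarrow}$; (11) $\hat\rho^{\to}_{A\vee B}\circ(\mathbf 1\wedge\tau^{\to})\circ\iota_{A,\top,B,\top}=\hat\rho^{\to}_A\vee\hat\rho^{\to}_B$; (12) $\hat\rho^{\to}_\bot\circ(\mathbf 1_\bot\wedge\kappa)\circ\beta^{\leftarrow}=\mathbf 1_\bot$. $SMI(\mathcal P)$: objects are the formulae built from letters in the infinite set $\mathcal P$ and the constants $\bot,\top$ with the binary connectives $\vee,\wedge$. Arrow terms are generated from primitive arrow terms (identities $\mathbf 1_A$ and all $\check\alpha^{\to},\check\alpha^{\leftarrow},\check\sigma,\check\rho^{\to},\check\rho^{\leftarrow},\check\lambda^{\to},\check\lambda^{\leftarrow}$, their hatted versions, $\iota$, $\beta^{\to},\beta^{\leftarrow},\tau^{\to},\tau^{\leftarrow},\kappa$, indexed by formulae) by (typed) composition $\circ$ and by $\vee,\wedge$. Arrows are equivalence classes of arrow terms under the smallest equivalence relation, congruent with respect to $\circ,\vee,\wedge$, that makes this an SMI category. For a formula $A$, $\nu(A)$ is the unique normal form of $A$ under replacing subformulae $B\vee\bot,\ \bot\vee B,\ B\wedge\top,\ \top\wedge B$ by $B$, $\bot\wedge\bot$ by $\bot$, and $\top\vee\top$ by $\top$. $A$ is $\bot$-pure if $\bot$ does not occur in $\nu(A)$, $\top$-pure if $\top$ does not occur in $\nu(A)$, and pure if it is both. $A$ is diversified if every letter occurs in it at most once. *)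

theory Defs
  imports Main
begin

section \<open>Formulae\<close>

datatype (letters: 'p) form =
    Letter 'p
  | Bot  ("\<bottom>\<^sub>f")
  | Top  ("\<top>\<^sub>f")
  | Disj "'p form" "'p form"  (infixr "\<or>\<^sub>f" 70)
  | Conj "'p form" "'p form"  (infixr "\<and>\<^sub>f" 75)

fun subformulae :: "'p form \<Rightarrow> 'p form set" where
  "subformulae (A \<or>\<^sub>f B) = insert (A \<or>\<^sub>f B) (subformulae A \<union> subformulae B)"
| "subformulae (A \<and>\<^sub>f B) = insert (A \<and>\<^sub>f B) (subformulae A \<union> subformulae B)"
| "subformulae A = {A}"

fun occurrences :: "'p \<Rightarrow> 'p form \<Rightarrow> nat" where
  "occurrences p (Letter q) = (if p = q then 1 else 0)"
| "occurrences p \<bottom>\<^sub>f = 0"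
| "occurrences p \<top>\<^sub>f = 0"
| "occurrences p (A \<or>\<^sub>f B) = occurrences p A + occurrences p B"
| "occurrences p (A \<and>\<^sub>f B) = occurrences p A + occurrences p B"

definition diversified :: "'p form \<Rightarrow> bool" where
  "diversified A \<longleftrightarrow> (\<forall>p. occurrences p A \<le> 1)"

inductive reduces :: "'p form \<Rightarrow> 'p form \<Rightarrow> bool" where
  disj_bot: "reduces (B \<or>\<^sub>f \<bottom>\<^sub>f) B"
| bot_disj: "reduces (\<bottom>\<^sub>f \<or>\<^sub>f B) B"
| conj_top: "reduces (B \<and>\<^sub>f \<top>\<^sub>f) B"
| top_conj: "reduces (\<top>\<^sub>f \<and>\<^sub>f B) B"
| bot_conj_bot: "reduces (\<bottom>\<^sub>f \<and>\<^sub>f \<bottom>\<^sub>f) \<bottom>\<^sub>f"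
| top_disj_top: "reduces (\<top>\<^sub>f \<or>\<^sub>f \<top>\<^sub>f) \<top>\<^sub>f"
| disj_left: "reduces A A' \<Longrightarrow> reduces (A \<or>\<^sub>f B) (A' \<or>\<^sub>f B)"
| disj_right: "reduces B B' \<Longrightarrow> reduces (A \<or>\<^sub>f B) (A \<or>\<^sub>f B')"
| conj_left: "reduces A A' \<Longrightarrow> reduces (A \<and>\<^sub>f B) (A' \<and>\<^sub>f B)"
| conj_right: "reduces B B' \<Longrightarrow> reduces (A \<and>\<^sub>f B) (A \<and>\<^sub>f B')"

definition normal_form_of :: "'p form \<Rightarrow> 'p form \<Rightarrow> bool" where
  "normal_form_of A N \<longleftrightarrow> reduces\<^sup>*\<^sup>* A N \<and> (\<nexists>M. reduces N M)"

text \<open>The definite description is justified by \<open>ex1_normal_form\<close> below.\<close>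

definition nu :: "'p form \<Rightarrow> 'p form" where
  "nu A = (THE N. normal_form_of A N)"

definition bot_pure :: "'p form \<Rightarrow> bool" where
  "bot_pure A \<longleftrightarrow> \<bottom>\<^sub>f \<notin> subformulae (nu A)"

definition top_pure :: "'p form \<Rightarrow> bool" where
  "top_pure A \<longleftrightarrow> \<top>\<^sub>f \<notin> subformulae (nu A)"

definition pure :: "'p form \<Rightarrow> bool" where
  "pure A \<longleftrightarrow> bot_pure A \<and> top_pure A"

subsection \<open>Normal forms exist and are unique\<close>

fun ndisj :: "'p form \<Rightarrow> 'p form \<Rightarrow> 'p form" where
  "ndisj A B = (if B = \<bottom>\<^sub>f then A else if A = \<bottom>\<^sub>f then B
                else if A = \<top>\<^sub>f \<and> B = \<top>\<^sub>f then \<top>\<^sub>f else A \<or>\<^sub>f B)"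

fun nconj :: "'p form \<Rightarrow> 'p form \<Rightarrow> 'p form" where
  "nconj A B = (if B = \<top>\<^sub>f then A else if A = \<top>\<^sub>f then B
                else if A = \<bottom>\<^sub>f \<and> B = \<bottom>\<^sub>f then \<bottom>\<^sub>f else A \<and>\<^sub>f B)"

fun norm_form :: "'p form \<Rightarrow> 'p form" where
  "norm_form (A \<or>\<^sub>f B) = ndisj (norm_form A) (norm_form B)"
| "norm_form (A \<and>\<^sub>f B) = nconj (norm_form A) (norm_form B)"
| "norm_form A = A"

lemma reduces_norm_form: "reduces A B \<Longrightarrow> norm_form A = norm_form B"
  by (induction rule: reduces.induct) auto

lemma rtranclp_reduces_norm_form: "reduces\<^sup>*\<^sup>* A B \<Longrightarrow> norm_form A = norm_form B"
  by (induction rule: rtranclp_induct) (auto dest: reduces_norm_form)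

lemma irreducible_norm_form: "\<nexists>M. reduces N M \<Longrightarrow> norm_form N = N"
proof (induction N)
  case (Disj A B)
  then have "norm_form A = A" "norm_form B = B"
    by (meson reduces.intros)+
  moreover have "A \<noteq> \<bottom>\<^sub>f" "B \<noteq> \<bottom>\<^sub>f" "\<not> (A = \<top>\<^sub>f \<and> B = \<top>\<^sub>f)"
    using Disj.prems by (metis reduces.intros)+
  ultimately show ?case by auto
next
  case (Conj A B)
  then have "norm_form A = A" "norm_form B = B"
    by (meson reduces.intros)+
  moreover have "A \<noteq> \<top>\<^sub>f" "B \<noteq> \<top>\<^sub>f" "\<not> (A = \<bottom>\<^sub>f \<and> B = \<bottom>\<^sub>f)"
    using Conj.prems by (metis reduces.intros)+
  ultimately show ?case by auto
qed auto

lemma reduces_size: "reduces A B \<Longrightarrow> size B < size A"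
  by (induction rule: reduces.induct) auto

lemma ex_normal_form: "\<exists>N. normal_form_of A N"
proof (induction A rule: measure_induct_rule[of size])
  case (less A)
  show ?case
  proof (cases "\<exists>M. reduces A M")
    case True
    then obtain M where M: "reduces A M" by blast
    then obtain N where "normal_form_of M N" using less reduces_size by blast
    with M show ?thesis
      unfolding normal_form_of_def by (meson converse_rtranclp_into_rtranclp)
  qed (auto simp: normal_form_of_def)
qed

lemma normal_form_of_unique: "normal_form_of A N \<Longrightarrow> N = norm_form A"
  unfolding normal_form_of_def
  by (metis irreducible_norm_form rtranclp_reduces_norm_form)

lemma ex1_normal_form: "\<exists>!N. normal_form_of A N"
  using ex_normal_form normal_form_of_unique by blast

lemma nu_eq_norm_form: "nu A = norm_form A"
  unfolding nu_def using ex1_normal_form[of A] normal_form_of_unique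
  by (metis theI')


section \<open>Arrow terms\<close>

text \<open>The suffixes Or and And stand for the check and the hat accent, and the suffixes
  R and L for the superscript arrows to the right and to the left. Composition is written
  in applicative order: in \<open>g \<circ>\<^sub>a f\<close>, f is applied first.\<close>

datatype 'p arrow_term =
    Ident "'p form"
  | AlphaOrR "'p form" "'p form" "'p form"
  | AlphaOrL "'p form" "'p form" "'p form"
  | SigmaOr "'p form" "'p form"
  | RhoOrR "'p form"
  | RhoOrL "'p form"
  | LambdaOrR "'p form"
  | LambdaOrL "'p form"
  | AlphaAndR "'p form" "'p form" "'p form"
  | AlphaAndL "'p form" "'p form" "'p form"
  | SigmaAnd "'p form" "'p form"
  | RhoAndR "'p form"
  | RhoAndL "'p form"
  | LambdaAndR "'p form"
  | LambdaAndL "'p form"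
  | Iota "'p form" "'p form" "'p form" "'p form"
  | BetaR
  | BetaL
  | TauR
  | TauL
  | Kappa
  | Comp "'p arrow_term" "'p arrow_term"  (infixr "\<circ>\<^sub>a" 65)
  | DisjA "'p arrow_term" "'p arrow_term"  (infixr "\<or>\<^sub>a" 70)
  | ConjA "'p arrow_term" "'p arrow_term"  (infixr "\<and>\<^sub>a" 75)

inductive has_type :: "'p arrow_term \<Rightarrow> 'p form \<Rightarrow> 'p form \<Rightarrow> bool"
  ("(_ \<turnstile> _ \<rightarrow> _)" [60, 61, 61] 60) where
  ty_id: "Ident A \<turnstile> A \<rightarrow> A"
| ty_alpha_or_R: "AlphaOrR A B C \<turnstile> A \<or>\<^sub>f (B \<or>\<^sub>f C) \<rightarrow> (A \<or>\<^sub>f B) \<or>\<^sub>f C"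
| ty_alpha_or_L: "AlphaOrL A B C \<turnstile> (A \<or>\<^sub>f B) \<or>\<^sub>f C \<rightarrow> A \<or>\<^sub>f (B \<or>\<^sub>f C)"
| ty_sigma_or: "SigmaOr A B \<turnstile> A \<or>\<^sub>f B \<rightarrow> B \<or>\<^sub>f A"
| ty_rho_or_R: "RhoOrR A \<turnstile> A \<or>\<^sub>f \<bottom>\<^sub>f \<rightarrow> A"
| ty_rho_or_L: "RhoOrL A \<turnstile> A \<rightarrow> A \<or>\<^sub>f \<bottom>\<^sub>f"
| ty_lambda_or_R: "LambdaOrR A \<turnstile> \<bottom>\<^sub>f \<or>\<^sub>f A \<rightarrow> A"
| ty_lambda_or_L: "LambdaOrL A \<turnstile> A \<rightarrow> \<bottom>\<^sub>f \<or>\<^sub>f A"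
| ty_alpha_and_R: "AlphaAndR A B C \<turnstile> A \<and>\<^sub>f (B \<and>\<^sub>f C) \<rightarrow> (A \<and>\<^sub>f B) \<and>\<^sub>f C"
| ty_alpha_and_L: "AlphaAndL A B C \<turnstile> (A \<and>\<^sub>f B) \<and>\<^sub>f C \<rightarrow> A \<and>\<^sub>f (B \<and>\<^sub>f C)"
| ty_sigma_and: "SigmaAnd A B \<turnstile> A \<and>\<^sub>f B \<rightarrow> B \<and>\<^sub>f A"
| ty_rho_and_R: "RhoAndR A \<turnstile> A \<and>\<^sub>f \<top>\<^sub>f \<rightarrow> A"
| ty_rho_and_L: "RhoAndL A \<turnstile> A \<rightarrow> A \<and>\<^sub>f \<top>\<^sub>f"
| ty_lambda_and_R: "LambdaAndR A \<turnstile> \<top>\<^sub>f \<and>\<^sub>f A \<rightarrow> A"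
| ty_lambda_and_L: "LambdaAndL A \<turnstile> A \<rightarrow> \<top>\<^sub>f \<and>\<^sub>f A"
| ty_iota: "Iota A B C D \<turnstile> (A \<and>\<^sub>f B) \<or>\<^sub>f (C \<and>\<^sub>f D) \<rightarrow> (A \<or>\<^sub>f C) \<and>\<^sub>f (B \<or>\<^sub>f D)"
| ty_beta_R: "BetaR \<turnstile> \<bottom>\<^sub>f \<and>\<^sub>f \<bottom>\<^sub>f \<rightarrow> \<bottom>\<^sub>f"
| ty_beta_L: "BetaL \<turnstile> \<bottom>\<^sub>f \<rightarrow> \<bottom>\<^sub>f \<and>\<^sub>f \<bottom>\<^sub>f"
| ty_tau_R: "TauR \<turnstile> \<top>\<^sub>f \<or>\<^sub>f \<top>\<^sub>f \<rightarrow> \<top>\<^sub>f"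
| ty_tau_L: "TauL \<turnstile> \<top>\<^sub>f \<rightarrow> \<top>\<^sub>f \<or>\<^sub>f \<top>\<^sub>f"
| ty_kappa: "Kappa \<turnstile> \<bottom>\<^sub>f \<rightarrow> \<top>\<^sub>f"
| ty_comp: "f \<turnstile> A \<rightarrow> B \<Longrightarrow> g \<turnstile> B \<rightarrow> C \<Longrightarrow> g \<circ>\<^sub>a f \<turnstile> A \<rightarrow> C"
| ty_disj: "f \<turnstile> A \<rightarrow> B \<Longrightarrow> g \<turnstile> C \<rightarrow> D \<Longrightarrow> f \<or>\<^sub>a g \<turnstile> A \<or>\<^sub>f C \<rightarrow> B \<or>\<^sub>f D"
| ty_conj: "f \<turnstile> A \<rightarrow> B \<Longrightarrow> g \<turnstile> C \<rightarrow> D \<Longrightarrow> f \<and>\<^sub>a g \<turnstile> A \<and>\<^sub>f C \<rightarrow> B \<and>\<^sub>f D"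


section \<open>Equality of arrows\<close>

text \<open>The least congruence on typed arrow terms that contains every equation required of an
  SMI category. The symmetric monoidal axioms are Mac Lane's (pentagon, triangle, hexagon,
  symmetry, and lambda as rho after sigma), written for associators that point to the left-nested
  formula. The rules smi1 to smi12 are the equations relating the two monoidal structures through
  iota, beta, tau and kappa; the remaining rules for these arrows are naturality of iota and
  invertibility of beta and tau. Only terms of the same type are related (\<open>arrow_eq_typed\<close>).
  Naturality of the inverse structural families follows from invertibility.\<close>

inductive arrow_eq :: "'p arrow_term \<Rightarrow> 'p arrow_term \<Rightarrow> bool"  (infix "\<approx>" 50) where
  refl: "f \<turnstile> A \<rightarrow> B \<Longrightarrow> f \<approx> f"
| sym: "f \<approx> g \<Longrightarrow> g \<approx> f"
| trans: "f \<approx> g \<Longrightarrow> g \<approx> h \<Longrightarrow> f \<approx> h"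
| comp_cong: "f \<turnstile> A \<rightarrow> B \<Longrightarrow> g \<turnstile> B \<rightarrow> C \<Longrightarrow> f \<approx> f' \<Longrightarrow> g \<approx> g' \<Longrightarrow> g \<circ>\<^sub>a f \<approx> g' \<circ>\<^sub>a f'"
| disj_cong: "f \<approx> f' \<Longrightarrow> g \<approx> g' \<Longrightarrow> f \<or>\<^sub>a g \<approx> f' \<or>\<^sub>a g'"
| conj_cong: "f \<approx> f' \<Longrightarrow> g \<approx> g' \<Longrightarrow> f \<and>\<^sub>a g \<approx> f' \<and>\<^sub>a g'"

| comp_id: "f \<turnstile> A \<rightarrow> B \<Longrightarrow> f \<circ>\<^sub>a Ident A \<approx> f"
| id_comp: "f \<turnstile> A \<rightarrow> B \<Longrightarrow> Ident B \<circ>\<^sub>a f \<approx> f"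
| comp_assoc: "f \<turnstile> A \<rightarrow> B \<Longrightarrow> g \<turnstile> B \<rightarrow> C \<Longrightarrow> h \<turnstile> C \<rightarrow> D \<Longrightarrow> h \<circ>\<^sub>a (g \<circ>\<^sub>a f) \<approx> (h \<circ>\<^sub>a g) \<circ>\<^sub>a f"

| disj_id: "Ident A \<or>\<^sub>a Ident B \<approx> Ident (A \<or>\<^sub>f B)"
| disj_comp: "f \<turnstile> A \<rightarrow> B \<Longrightarrow> g \<turnstile> B \<rightarrow> C \<Longrightarrow> h \<turnstile> D \<rightarrow> E \<Longrightarrow> k \<turnstile> E \<rightarrow> F \<Longrightarrow>
    (g \<circ>\<^sub>a f) \<or>\<^sub>a (k \<circ>\<^sub>a h) \<approx> (g \<or>\<^sub>a k) \<circ>\<^sub>a (f \<or>\<^sub>a h)"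
| conj_id: "Ident A \<and>\<^sub>a Ident B \<approx> Ident (A \<and>\<^sub>f B)"
| conj_comp: "f \<turnstile> A \<rightarrow> B \<Longrightarrow> g \<turnstile> B \<rightarrow> C \<Longrightarrow> h \<turnstile> D \<rightarrow> E \<Longrightarrow> k \<turnstile> E \<rightarrow> F \<Longrightarrow>
    (g \<circ>\<^sub>a f) \<and>\<^sub>a (k \<circ>\<^sub>a h) \<approx> (g \<and>\<^sub>a k) \<circ>\<^sub>a (f \<and>\<^sub>a h)"

| alpha_or_nat: "f \<turnstile> A \<rightarrow> A' \<Longrightarrow> g \<turnstile> B \<rightarrow> B' \<Longrightarrow> h \<turnstile> C \<rightarrow> C' \<Longrightarrow>
    AlphaOrR A' B' C' \<circ>\<^sub>a (f \<or>\<^sub>a (g \<or>\<^sub>a h)) \<approx> ((f \<or>\<^sub>a g) \<or>\<^sub>a h) \<circ>\<^sub>a AlphaOrR A B C"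
| sigma_or_nat: "f \<turnstile> A \<rightarrow> A' \<Longrightarrow> g \<turnstile> B \<rightarrow> B' \<Longrightarrow>
    SigmaOr A' B' \<circ>\<^sub>a (f \<or>\<^sub>a g) \<approx> (g \<or>\<^sub>a f) \<circ>\<^sub>a SigmaOr A B"
| rho_or_nat: "f \<turnstile> A \<rightarrow> A' \<Longrightarrow> RhoOrR A' \<circ>\<^sub>a (f \<or>\<^sub>a Ident \<bottom>\<^sub>f) \<approx> f \<circ>\<^sub>a RhoOrR A"
| lambda_or_nat: "f \<turnstile> A \<rightarrow> A' \<Longrightarrow> LambdaOrR A' \<circ>\<^sub>a (Ident \<bottom>\<^sub>f \<or>\<^sub>a f) \<approx> f \<circ>\<^sub>a LambdaOrR A"
| alpha_or_LR: "AlphaOrL A B C \<circ>\<^sub>a AlphaOrR A B C \<approx> Ident (A \<or>\<^sub>f (B \<or>\<^sub>f C))"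
| alpha_or_RL: "AlphaOrR A B C \<circ>\<^sub>a AlphaOrL A B C \<approx> Ident ((A \<or>\<^sub>f B) \<or>\<^sub>f C)"
| sigma_or_inv: "SigmaOr B A \<circ>\<^sub>a SigmaOr A B \<approx> Ident (A \<or>\<^sub>f B)"
| rho_or_LR: "RhoOrL A \<circ>\<^sub>a RhoOrR A \<approx> Ident (A \<or>\<^sub>f \<bottom>\<^sub>f)"
| rho_or_RL: "RhoOrR A \<circ>\<^sub>a RhoOrL A \<approx> Ident A"
| lambda_or_LR: "LambdaOrL A \<circ>\<^sub>a LambdaOrR A \<approx> Ident (\<bottom>\<^sub>f \<or>\<^sub>f A)"
| lambda_or_RL: "LambdaOrR A \<circ>\<^sub>a LambdaOrL A \<approx> Ident A"
| pentagon_or: "AlphaOrR (A \<or>\<^sub>f B) C D \<circ>\<^sub>a AlphaOrR A B (C \<or>\<^sub>f D) \<approx>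
    (AlphaOrR A B C \<or>\<^sub>a Ident D) \<circ>\<^sub>a AlphaOrR A (B \<or>\<^sub>f C) D \<circ>\<^sub>a (Ident A \<or>\<^sub>a AlphaOrR B C D)"
| triangle_or: "(RhoOrR A \<or>\<^sub>a Ident B) \<circ>\<^sub>a AlphaOrR A \<bottom>\<^sub>f B \<approx> Ident A \<or>\<^sub>a LambdaOrR B"
| hexagon_or: "AlphaOrR C A B \<circ>\<^sub>a SigmaOr (A \<or>\<^sub>f B) C \<circ>\<^sub>a AlphaOrR A B C \<approx>
    (SigmaOr A C \<or>\<^sub>a Ident B) \<circ>\<^sub>a AlphaOrR A C B \<circ>\<^sub>a (Ident A \<or>\<^sub>a SigmaOr B C)"
| unit_sigma_or: "RhoOrR A \<circ>\<^sub>a SigmaOr \<bottom>\<^sub>f A \<approx> LambdaOrR A"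

| alpha_and_nat: "f \<turnstile> A \<rightarrow> A' \<Longrightarrow> g \<turnstile> B \<rightarrow> B' \<Longrightarrow> h \<turnstile> C \<rightarrow> C' \<Longrightarrow>
    AlphaAndR A' B' C' \<circ>\<^sub>a (f \<and>\<^sub>a (g \<and>\<^sub>a h)) \<approx> ((f \<and>\<^sub>a g) \<and>\<^sub>a h) \<circ>\<^sub>a AlphaAndR A B C"
| sigma_and_nat: "f \<turnstile> A \<rightarrow> A' \<Longrightarrow> g \<turnstile> B \<rightarrow> B' \<Longrightarrow>
    SigmaAnd A' B' \<circ>\<^sub>a (f \<and>\<^sub>a g) \<approx> (g \<and>\<^sub>a f) \<circ>\<^sub>a SigmaAnd A B"
| rho_and_nat: "f \<turnstile> A \<rightarrow> A' \<Longrightarrow> RhoAndR A' \<circ>\<^sub>a (f \<and>\<^sub>a Ident \<top>\<^sub>f) \<approx> f \<circ>\<^sub>a RhoAndR A"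
| lambda_and_nat: "f \<turnstile> A \<rightarrow> A' \<Longrightarrow> LambdaAndR A' \<circ>\<^sub>a (Ident \<top>\<^sub>f \<and>\<^sub>a f) \<approx> f \<circ>\<^sub>a LambdaAndR A"
| alpha_and_LR: "AlphaAndL A B C \<circ>\<^sub>a AlphaAndR A B C \<approx> Ident (A \<and>\<^sub>f (B \<and>\<^sub>f C))"
| alpha_and_RL: "AlphaAndR A B C \<circ>\<^sub>a AlphaAndL A B C \<approx> Ident ((A \<and>\<^sub>f B) \<and>\<^sub>f C)"
| sigma_and_inv: "SigmaAnd B A \<circ>\<^sub>a SigmaAnd A B \<approx> Ident (A \<and>\<^sub>f B)"
| rho_and_LR: "RhoAndL A \<circ>\<^sub>a RhoAndR A \<approx> Ident (A \<and>\<^sub>f \<top>\<^sub>f)"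
| rho_and_RL: "RhoAndR A \<circ>\<^sub>a RhoAndL A \<approx> Ident A"
| lambda_and_LR: "LambdaAndL A \<circ>\<^sub>a LambdaAndR A \<approx> Ident (\<top>\<^sub>f \<and>\<^sub>f A)"
| lambda_and_RL: "LambdaAndR A \<circ>\<^sub>a LambdaAndL A \<approx> Ident A"
| pentagon_and: "AlphaAndR (A \<and>\<^sub>f B) C D \<circ>\<^sub>a AlphaAndR A B (C \<and>\<^sub>f D) \<approx>
    (AlphaAndR A B C \<and>\<^sub>a Ident D) \<circ>\<^sub>a AlphaAndR A (B \<and>\<^sub>f C) D \<circ>\<^sub>a (Ident A \<and>\<^sub>a AlphaAndR B C D)"
| triangle_and: "(RhoAndR A \<and>\<^sub>a Ident B) \<circ>\<^sub>a AlphaAndR A \<top>\<^sub>f B \<approx> Ident A \<and>\<^sub>a LambdaAndR B"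
| hexagon_and: "AlphaAndR C A B \<circ>\<^sub>a SigmaAnd (A \<and>\<^sub>f B) C \<circ>\<^sub>a AlphaAndR A B C \<approx>
    (SigmaAnd A C \<and>\<^sub>a Ident B) \<circ>\<^sub>a AlphaAndR A C B \<circ>\<^sub>a (Ident A \<and>\<^sub>a SigmaAnd B C)"
| unit_sigma_and: "RhoAndR A \<circ>\<^sub>a SigmaAnd \<top>\<^sub>f A \<approx> LambdaAndR A"

| iota_nat: "f \<turnstile> A \<rightarrow> A' \<Longrightarrow> g \<turnstile> B \<rightarrow> B' \<Longrightarrow> h \<turnstile> C \<rightarrow> C' \<Longrightarrow> k \<turnstile> D \<rightarrow> D' \<Longrightarrow>
    Iota A' B' C' D' \<circ>\<^sub>a ((f \<and>\<^sub>a g) \<or>\<^sub>a (h \<and>\<^sub>a k)) \<approx> ((f \<or>\<^sub>a h) \<and>\<^sub>a (g \<or>\<^sub>a k)) \<circ>\<^sub>a Iota A B C D"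
| beta_LR: "BetaL \<circ>\<^sub>a BetaR \<approx> Ident (\<bottom>\<^sub>f \<and>\<^sub>f \<bottom>\<^sub>f)"
| beta_RL: "BetaR \<circ>\<^sub>a BetaL \<approx> Ident \<bottom>\<^sub>f"
| tau_LR: "TauL \<circ>\<^sub>a TauR \<approx> Ident (\<top>\<^sub>f \<or>\<^sub>f \<top>\<^sub>f)"
| tau_RL: "TauR \<circ>\<^sub>a TauL \<approx> Ident \<top>\<^sub>f"
| smi1: "Iota (A \<or>\<^sub>f B) (D \<or>\<^sub>f E) C F \<circ>\<^sub>a (Iota A D B E \<or>\<^sub>a Ident (C \<and>\<^sub>f F))
      \<circ>\<^sub>a AlphaOrR (A \<and>\<^sub>f D) (B \<and>\<^sub>f E) (C \<and>\<^sub>f F) \<approx>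
    (AlphaOrR A B C \<and>\<^sub>a AlphaOrR D E F) \<circ>\<^sub>a Iota A D (B \<or>\<^sub>f C) (E \<or>\<^sub>f F)
      \<circ>\<^sub>a (Ident (A \<and>\<^sub>f D) \<or>\<^sub>a Iota B E C F)"
| smi2: "Iota B D A C \<circ>\<^sub>a SigmaOr (A \<and>\<^sub>f C) (B \<and>\<^sub>f D) \<approx>
    (SigmaOr A B \<and>\<^sub>a SigmaOr C D) \<circ>\<^sub>a Iota A C B D"
| smi3: "(RhoOrR A \<and>\<^sub>a RhoOrR B) \<circ>\<^sub>a Iota A B \<bottom>\<^sub>f \<bottom>\<^sub>f \<circ>\<^sub>a (Ident (A \<and>\<^sub>f B) \<or>\<^sub>a BetaL) \<approx>
    RhoOrR (A \<and>\<^sub>f B)"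
| smi4: "TauR \<circ>\<^sub>a (TauR \<or>\<^sub>a Ident \<top>\<^sub>f) \<circ>\<^sub>a AlphaOrR \<top>\<^sub>f \<top>\<^sub>f \<top>\<^sub>f \<approx> TauR \<circ>\<^sub>a (Ident \<top>\<^sub>f \<or>\<^sub>a TauR)"
| smi5: "TauR \<circ>\<^sub>a SigmaOr \<top>\<^sub>f \<top>\<^sub>f \<approx> TauR"
| smi6: "TauR \<circ>\<^sub>a (Ident \<top>\<^sub>f \<or>\<^sub>a Kappa) \<approx> RhoOrR \<top>\<^sub>f"
| smi7: "AlphaAndR (A \<or>\<^sub>f D) (B \<or>\<^sub>f E) (C \<or>\<^sub>f F) \<circ>\<^sub>a (Ident (A \<or>\<^sub>f D) \<and>\<^sub>a Iota B C E F)
      \<circ>\<^sub>a Iota A (B \<and>\<^sub>f C) D (E \<and>\<^sub>f F) \<approx>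
    (Iota A B D E \<and>\<^sub>a Ident (C \<or>\<^sub>f F)) \<circ>\<^sub>a Iota (A \<and>\<^sub>f B) C (D \<and>\<^sub>f E) F
      \<circ>\<^sub>a (AlphaAndR A B C \<or>\<^sub>a AlphaAndR D E F)"
| smi8: "AlphaAndR \<bottom>\<^sub>f \<bottom>\<^sub>f \<bottom>\<^sub>f \<circ>\<^sub>a (Ident \<bottom>\<^sub>f \<and>\<^sub>a BetaL) \<circ>\<^sub>a BetaL \<approx> (BetaL \<and>\<^sub>a Ident \<bottom>\<^sub>f) \<circ>\<^sub>a BetaL"
| smi9: "SigmaAnd (A \<or>\<^sub>f C) (B \<or>\<^sub>f D) \<circ>\<^sub>a Iota A B C D \<approx>
    Iota B A D C \<circ>\<^sub>a (SigmaAnd A B \<or>\<^sub>a SigmaAnd C D)"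
| smi10: "SigmaAnd \<bottom>\<^sub>f \<bottom>\<^sub>f \<circ>\<^sub>a BetaL \<approx> BetaL"
| smi11: "RhoAndR (A \<or>\<^sub>f B) \<circ>\<^sub>a (Ident (A \<or>\<^sub>f B) \<and>\<^sub>a TauR) \<circ>\<^sub>a Iota A \<top>\<^sub>f B \<top>\<^sub>f \<approx>
    RhoAndR A \<or>\<^sub>a RhoAndR B"
| smi12: "RhoAndR \<bottom>\<^sub>f \<circ>\<^sub>a (Ident \<bottom>\<^sub>f \<and>\<^sub>a Kappa) \<circ>\<^sub>a BetaL \<approx> Ident \<bottom>\<^sub>f"

inductive_simps has_type_simps:
  "Ident X \<turnstile> A \<rightarrow> B"
  "AlphaOrR X Y Z \<turnstile> A \<rightarrow> B"
  "AlphaOrL X Y Z \<turnstile> A \<rightarrow> B"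
  "SigmaOr X Y \<turnstile> A \<rightarrow> B"
  "RhoOrR X \<turnstile> A \<rightarrow> B"
  "RhoOrL X \<turnstile> A \<rightarrow> B"
  "LambdaOrR X \<turnstile> A \<rightarrow> B"
  "LambdaOrL X \<turnstile> A \<rightarrow> B"
  "AlphaAndR X Y Z \<turnstile> A \<rightarrow> B"
  "AlphaAndL X Y Z \<turnstile> A \<rightarrow> B"
  "SigmaAnd X Y \<turnstile> A \<rightarrow> B"
  "RhoAndR X \<turnstile> A \<rightarrow> B"
  "RhoAndL X \<turnstile> A \<rightarrow> B"
  "LambdaAndR X \<turnstile> A \<rightarrow> B"
  "LambdaAndL X \<turnstile> A \<rightarrow> B"
  "Iota X Y Z W \<turnstile> A \<rightarrow> B"
  "BetaR \<turnstile> A \<rightarrow> B"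
  "BetaL \<turnstile> A \<rightarrow> B"
  "TauR \<turnstile> A \<rightarrow> B"
  "TauL \<turnstile> A \<rightarrow> B"
  "Kappa \<turnstile> A \<rightarrow> B"
  "g \<circ>\<^sub>a f \<turnstile> A \<rightarrow> B"
  "f \<or>\<^sub>a g \<turnstile> A \<rightarrow> B"
  "f \<and>\<^sub>a g \<turnstile> A \<rightarrow> B"

lemma has_type_unique: "f \<turnstile> A \<rightarrow> B \<Longrightarrow> f \<turnstile> A' \<rightarrow> B' \<Longrightarrow> A' = A \<and> B' = B"
proof (induction arbitrary: A' B' rule: has_type.induct)
  case (ty_comp f A B g C)
  from ty_comp.prems obtain D where "f \<turnstile> A' \<rightarrow> D" "g \<turnstile> D \<rightarrow> B'"
    unfolding has_type_simps by (elim exE conjE)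
  then show ?case using ty_comp.IH by metis
next
  case (ty_disj f A B g C D)
  from ty_disj.prems obtain X Y Z W where "A' = X \<or>\<^sub>f Z" "B' = Y \<or>\<^sub>f W" "f \<turnstile> X \<rightarrow> Y" "g \<turnstile> Z \<rightarrow> W"
    unfolding has_type_simps by (elim exE conjE)
  then show ?case using ty_disj.IH by metis
next
  case (ty_conj f A B g C D)
  from ty_conj.prems obtain X Y Z W where "A' = X \<and>\<^sub>f Z" "B' = Y \<and>\<^sub>f W" "f \<turnstile> X \<rightarrow> Y" "g \<turnstile> Z \<rightarrow> W"
    unfolding has_type_simps by (elim exE conjE)
  then show ?case using ty_conj.IH by metis
qed (simp_all add: has_type_simps)

lemma arrow_eq_typed: "f \<approx> g \<Longrightarrow> \<exists>A B. f \<turnstile> A \<rightarrow> B \<and> g \<turnstile> A \<rightarrow> B"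
proof (induction rule: arrow_eq.induct)
  case (trans f g h)
  then show ?case by (metis has_type_unique)
next
  case (comp_cong f A B g C f' g')
  then have "f' \<turnstile> A \<rightarrow> B" "g' \<turnstile> B \<rightarrow> C" by (metis has_type_unique)+
  with comp_cong.hyps have "g \<circ>\<^sub>a f \<turnstile> A \<rightarrow> C" "g' \<circ>\<^sub>a f' \<turnstile> A \<rightarrow> C"
    by (simp_all only: ty_comp)
  then show ?case by blast
qed (((elim exE conjE)?, rule exI, rule exI, rule conjI, (assumption | rule has_type.intros)+)[1])+

definition arrows :: "'p form \<Rightarrow> 'p form \<Rightarrow> 'p arrow_term set set" where
  "arrows A B = {f. f \<turnstile> A \<rightarrow> B} // {(f, g). f \<turnstile> A \<rightarrow> B \<and> g \<turnstile> A \<rightarrow> B \<and> f \<approx> g}"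

lemma equiv_arrow_eq:
  "equiv {f. f \<turnstile> A \<rightarrow> B} {(f, g). f \<turnstile> A \<rightarrow> B \<and> g \<turnstile> A \<rightarrow> B \<and> f \<approx> g}"
  by (intro equivI refl_onI symI transI) (auto dest: arrow_eq.sym arrow_eq.trans simp: arrow_eq.refl)

end

theory Submission
  imports Defs
begin

text \<open>For a set \<open>S\<close> of letters let \<open>restrict S A\<close> be \<open>A\<close> with the letters outside \<open>S\<close> replaced by
  \<open>\<top>\<close>. There is a canonical arrow \<open>split S A\<close> from \<open>A\<close> to
  \<open>restrict S A \<and> restrict (- S) A\<close>, built by recursion on \<open>A\<close>: a letter or \<open>\<top>\<close> is sent through a
  unit isomorphism, \<open>\<bottom>\<close> through \<open>\<beta>\<close>, a disjunction is handled by \<open>\<iota>\<close> and a conjunction by the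
  middle-four interchange of \<open>\<and>\<close>. The equations \<open>smi1\<close> to \<open>smi3\<close> and \<open>smi7\<close> to \<open>smi12\<close> make
  conjunction a lax functor for the whole structure, and so \<open>split S\<close> is natural with respect to every arrow
  (\<open>split_natural_typed\<close>). If \<open>B \<and> C\<close> contains no constants, \<open>S\<close> contains the letters of \<open>B\<close> and none
  of \<open>C\<close>, then \<open>split S (B \<and> C)\<close> has a left inverse, because a constant-free formula whose letters
  have all become \<open>\<top>\<close> is isomorphic to \<open>\<top>\<close> (\<open>split_conj_retract\<close>). Naturality then recovers an arrow
  \<open>A \<rightarrow> B \<and> C\<close> from its restrictions \<open>restrict S A \<rightarrow> B\<close> and \<open>restrict (- S) A \<rightarrow> C\<close>, which have fewer
  letters (\<open>thin_conj\<close>).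

  This drives an induction on the number of letters of the target, for pure and diversified formulae,
  which may be taken in normal form. A target that is a conjunction is decomposed as above. The category
  is isomorphic to its opposite with the two monoidal structures exchanged (\<open>dual_arrow_eq\<close>), so a
  source that is a disjunction is decomposed in the same way. There is no arrow from a conjunction to a
  disjunction: two letters joined by a conjunction in the source are joined by one in the target, which
  makes the target connected (\<open>no_arrow_conj_disj\<close>). To apply the induction hypothesis to
  \<open>restrict S A\<close> this formula has to be pure again; arrows preserve the absence of \<open>\<bottom>\<close> in the forward
  direction and the absence of \<open>\<top>\<close> in the backward direction, by an interpretation in a four-element
  ordered algebra (\<open>purity_mono\<close>).

  What remains are formulae whose normal form is a single letter or constant; every letterless formula
  is of this kind. Up to the isomorphisms with the normal forms, each arrow between two of them is an
  identity or \<open>\<kappa>\<close> (\<open>atomic_natural_typed\<close>). The induction on arrow terms that shows it survives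
  composition because the object in the middle is again of this kind (\<open>atomic_between\<close>), by the same
  preservation of purity.

  Equations between arrows are treated as equalities in a quotient type in which composition is total.
  Untyped terms are identified there as soon as they have the same formal source and target, so that
  associativity, functoriality and naturality hold without typing conditions.\<close>

section \<open>Symmetric monoidal categories\<close>

text \<open>A category in which composition is total. Sources and targets are formal: those of \<open>g \<cdot> f\<close> are
  read off \<open>f\<close> and \<open>g\<close> even if the two do not match. The only equations that carry a side condition are
  then the unit laws.\<close>

locale formal_category =
  fixes src tgt :: "'a \<Rightarrow> 'o"
    and ident :: "'o \<Rightarrow> 'a" ("\<one>")
    and comp :: "'a \<Rightarrow> 'a \<Rightarrow> 'a" (infixr "\<cdot>" 65)
  assumes src_ident [simp]: "src (\<one> A) = A"
    and tgt_ident [simp]: "tgt (\<one> A) = A"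
    and src_comp [simp]: "src (g \<cdot> f) = src f"
    and tgt_comp [simp]: "tgt (g \<cdot> f) = tgt g"
    and comp_assoc: "(h \<cdot> g) \<cdot> f = h \<cdot> (g \<cdot> f)"
    and comp_ident [simp]: "src f = A \<Longrightarrow> f \<cdot> \<one> A = f"
    and ident_comp [simp]: "tgt f = A \<Longrightarrow> \<one> A \<cdot> f = f"
begin

text \<open>Composites are kept nested to the right; this turns an equation for a composite into a rewriting
  step at the head of a longer composite.\<close>

lemma comp_extend: "f = g \<Longrightarrow> f \<cdot> x = g \<cdot> x"
  by simp

definition inverse :: "'a \<Rightarrow> 'a \<Rightarrow> bool" where
  "inverse f f' \<longleftrightarrow> src f' = tgt f \<and> tgt f' = src f \<and> f' \<cdot> f = \<one> (src f) \<and> f \<cdot> f' = \<one> (tgt f)"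

lemma inverse_sym: "inverse f f' \<Longrightarrow> inverse f' f"
  by (auto simp: inverse_def)

lemma inverse_ident [simp, intro]: "inverse (\<one> A) (\<one> A)"
  by (auto simp: inverse_def)

lemma inverse_simps:
  assumes "inverse f f'"
  shows "f' \<cdot> f = \<one> (src f)" "f \<cdot> f' = \<one> (tgt f)"
    "tgt x = src f \<Longrightarrow> f' \<cdot> f \<cdot> x = x" "tgt x = tgt f \<Longrightarrow> f \<cdot> f' \<cdot> x = x"
  using assms by (auto simp: inverse_def comp_assoc[symmetric])

lemma inverse_comp:
  assumes "inverse f f'" "inverse g g'" "tgt f = src g"
  shows "inverse (g \<cdot> f) (f' \<cdot> g')"
  using assms inverse_simps(3)[OF assms(2), of f] inverse_simps(4)[OF assms(1), of g']
  by (simp add: inverse_def comp_assoc)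

lemma inverse_unique:
  assumes "inverse f f'" "inverse f f''"
  shows "f' = f''"
proof -
  have "f' = f' \<cdot> (f \<cdot> f'')" using assms by (simp add: inverse_def)
  also have "\<dots> = (f' \<cdot> f) \<cdot> f''" by (simp only: comp_assoc)
  also have "\<dots> = f''" using assms by (simp add: inverse_def)
  finally show ?thesis .
qed

lemma inverse_cong: "f = g \<Longrightarrow> inverse f f' \<Longrightarrow> inverse g g' \<Longrightarrow> f' = g'"
  using inverse_unique by blast

text \<open>A commuting square with two invertible sides can be traversed the other way round. Equations for
  inverse structural arrows are obtained from the axioms in this way.\<close>

lemma inverse_transpose:
  assumes "u \<cdot> x = y \<cdot> v" "inverse u u'" "inverse v v'" "tgt x = src u" "src y = tgt v"
  shows "x \<cdot> v' = u' \<cdot> y"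
proof -
  have "x \<cdot> v' = (u' \<cdot> u) \<cdot> x \<cdot> v'" using assms by (simp add: inverse_def)
  also have "\<dots> = u' \<cdot> (u \<cdot> x) \<cdot> v'" by (simp only: comp_assoc)
  also have "\<dots> = u' \<cdot> y \<cdot> (v \<cdot> v')" by (simp only: assms(1) comp_assoc)
  also have "\<dots> = u' \<cdot> y" using assms by (simp add: inverse_def)
  finally show ?thesis .
qed

lemma inverse_cancel_left:
  assumes "inverse u u'" "u \<cdot> x = u \<cdot> y" "tgt x = src u" "tgt y = src u"
  shows "x = y"
  using assms by (metis comp_assoc ident_comp inverse_def)

lemma inverse_cancel_right:
  assumes "inverse u u'" "x \<cdot> u = y \<cdot> u" "src x = tgt u" "src y = tgt u"
  shows "x = y"
  using assms by (metis comp_assoc comp_ident inverse_def)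

end

text \<open>The associator \<open>a\<close> points to the left-nested object; a prime marks the inverse of a structural
  arrow. The equations are unconditional, with sources and targets of the variable arrows inserted where
  naturality needs them.\<close>

locale symmetric_monoidal = formal_category src tgt ident comp
  for src tgt :: "'a \<Rightarrow> 'o" and ident ("\<one>") and comp (infixr "\<cdot>" 65) +
  fixes tobj :: "'o \<Rightarrow> 'o \<Rightarrow> 'o" (infixr "\<odot>" 75)
    and unit :: "'o" ("\<I>")
    and tarr :: "'a \<Rightarrow> 'a \<Rightarrow> 'a" (infixr "\<otimes>" 75)
    and a a' :: "'o \<Rightarrow> 'o \<Rightarrow> 'o \<Rightarrow> 'a"
    and s :: "'o \<Rightarrow> 'o \<Rightarrow> 'a"
    and r r' l l' :: "'o \<Rightarrow> 'a"
  assumes tensor_types [simp]: "src (f \<otimes> g) = src f \<odot> src g" "tgt (f \<otimes> g) = tgt f \<odot> tgt g"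
    and structural_types [simp]:
      "src (a A B C) = A \<odot> (B \<odot> C)" "tgt (a A B C) = (A \<odot> B) \<odot> C"
      "src (a' A B C) = (A \<odot> B) \<odot> C" "tgt (a' A B C) = A \<odot> (B \<odot> C)"
      "src (s A B) = A \<odot> B" "tgt (s A B) = B \<odot> A"
      "src (r A) = A \<odot> \<I>" "tgt (r A) = A" "src (r' A) = A" "tgt (r' A) = A \<odot> \<I>"
      "src (l A) = \<I> \<odot> A" "tgt (l A) = A" "src (l' A) = A" "tgt (l' A) = \<I> \<odot> A"
    and tensor_ident [simp]: "\<one> A \<otimes> \<one> B = \<one> (A \<odot> B)"
    and interchange: "(g \<cdot> f) \<otimes> (k \<cdot> h) = (g \<otimes> k) \<cdot> (f \<otimes> h)"
    and a_nat: "a (tgt f) (tgt g) (tgt h) \<cdot> (f \<otimes> (g \<otimes> h))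
      = ((f \<otimes> g) \<otimes> h) \<cdot> a (src f) (src g) (src h)"
    and s_nat: "s (tgt f) (tgt g) \<cdot> (f \<otimes> g) = (g \<otimes> f) \<cdot> s (src f) (src g)"
    and r_nat: "r (tgt f) \<cdot> (f \<otimes> \<one> \<I>) = f \<cdot> r (src f)"
    and l_nat: "l (tgt f) \<cdot> (\<one> \<I> \<otimes> f) = f \<cdot> l (src f)"
    and a_inv [simp]: "a' A B C \<cdot> a A B C = \<one> (A \<odot> (B \<odot> C))"
      "a A B C \<cdot> a' A B C = \<one> ((A \<odot> B) \<odot> C)"
    and s_inv [simp]: "s B A \<cdot> s A B = \<one> (A \<odot> B)"
    and r_inv [simp]: "r' A \<cdot> r A = \<one> (A \<odot> \<I>)" "r A \<cdot> r' A = \<one> A"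
    and l_inv [simp]: "l' A \<cdot> l A = \<one> (\<I> \<odot> A)" "l A \<cdot> l' A = \<one> A"
    and pentagon: "a (A \<odot> B) C D \<cdot> a A B (C \<odot> D)
      = (a A B C \<otimes> \<one> D) \<cdot> a A (B \<odot> C) D \<cdot> (\<one> A \<otimes> a B C D)"
    and triangle: "(r A \<otimes> \<one> B) \<cdot> a A \<I> B = \<one> A \<otimes> l B"
    and hexagon: "a C A B \<cdot> s (A \<odot> B) C \<cdot> a A B C
      = (s A C \<otimes> \<one> B) \<cdot> a A C B \<cdot> (\<one> A \<otimes> s B C)"
    and unit_s: "r A \<cdot> s \<I> A = l A"
begin

lemma inverse_structural [simp, intro]:
  "inverse (a A B C) (a' A B C)" "inverse (a' A B C) (a A B C)" "inverse (s A B) (s B A)"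
  "inverse (r A) (r' A)" "inverse (r' A) (r A)" "inverse (l A) (l' A)" "inverse (l' A) (l A)"
  by (simp_all add: inverse_def)

lemma inverse_tensor:
  "inverse f f' \<Longrightarrow> inverse g g' \<Longrightarrow> inverse (f \<otimes> g) (f' \<otimes> g')"
  by (simp add: inverse_def interchange[symmetric])

lemmas structural_inv_extend [simp] =
  inverse_structural(1)[THEN inverse_simps(3)] inverse_structural(1)[THEN inverse_simps(4)]
  inverse_structural(3)[THEN inverse_simps(3)]
  inverse_structural(4)[THEN inverse_simps(3)] inverse_structural(4)[THEN inverse_simps(4)]
  inverse_structural(6)[THEN inverse_simps(3)] inverse_structural(6)[THEN inverse_simps(4)]

lemma whisker_left: "\<one> A \<otimes> (g \<cdot> f) = (\<one> A \<otimes> g) \<cdot> (\<one> A \<otimes> f)"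
  using interchange[of "\<one> A" "\<one> A"] by simp

lemma whisker_right: "(g \<cdot> f) \<otimes> \<one> A = (g \<otimes> \<one> A) \<cdot> (f \<otimes> \<one> A)"
  using interchange[of _ _ "\<one> A" "\<one> A"] by simp

lemma tensor_split: "f \<otimes> g = (f \<otimes> \<one> (tgt g)) \<cdot> (\<one> (src f) \<otimes> g)"
  by (simp add: interchange[symmetric])

lemma tensor_split': "f \<otimes> g = (\<one> (tgt f) \<otimes> g) \<cdot> (f \<otimes> \<one> (src g))"
  by (simp add: interchange[symmetric])

lemma a'_nat: "a' (tgt f) (tgt g) (tgt h) \<cdot> ((f \<otimes> g) \<otimes> h)
    = (f \<otimes> (g \<otimes> h)) \<cdot> a' (src f) (src g) (src h)"
  by (rule HOL.sym, rule inverse_transpose[OF a_nat]) simp_all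

lemma r'_nat: "r' (tgt f) \<cdot> f = (f \<otimes> \<one> \<I>) \<cdot> r' (src f)"
  by (rule HOL.sym, rule inverse_transpose[OF r_nat]) simp_all

lemma l'_nat: "l' (tgt f) \<cdot> f = (\<one> \<I> \<otimes> f) \<cdot> l' (src f)"
  by (rule HOL.sym, rule inverse_transpose[OF l_nat]) simp_all

lemma pentagon': "a' A B (C \<odot> D) \<cdot> a' (A \<odot> B) C D
    = (\<one> A \<otimes> a' B C D) \<cdot> a' A (B \<odot> C) D \<cdot> (a' A B C \<otimes> \<one> D)"
  unfolding comp_assoc[symmetric]
  by (rule inverse_cong[OF pentagon]) (auto intro!: inverse_comp inverse_tensor)

lemma triangle': "a' A \<I> B \<cdot> (r' A \<otimes> \<one> B) = \<one> A \<otimes> l' B"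
  by (rule inverse_cong[OF triangle]) (auto intro!: inverse_comp inverse_tensor)

lemma hexagon': "a' A B C \<cdot> s C (A \<odot> B) \<cdot> a' C A B
    = (\<one> A \<otimes> s C B) \<cdot> a' A C B \<cdot> (s C A \<otimes> \<one> B)"
  unfolding comp_assoc[symmetric]
  by (rule inverse_cong[OF hexagon]) (auto intro!: inverse_comp inverse_tensor)

lemma unit_s': "s A \<I> \<cdot> r' A = l' A"
  by (rule inverse_cong[OF unit_s]) (auto intro!: inverse_comp inverse_tensor)


lemma unit_left_faithful:
  assumes "\<one> \<I> \<otimes> f = \<one> \<I> \<otimes> g" "tgt f = tgt g" "src f = src g"
  shows "f = g"
  using l_nat[of f] l_nat[of g] assms by - (rule inverse_cancel_right[of "l (src f)" "l' (src f)"], auto)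

lemma unit_right_faithful:
  assumes "f \<otimes> \<one> \<I> = g \<otimes> \<one> \<I>" "tgt f = tgt g" "src f = src g"
  shows "f = g"
  using r_nat[of f] r_nat[of g] assms by - (rule inverse_cancel_right[of "r (src f)" "r' (src f)"], auto)

text \<open>Kelly's argument: tensoring with the unit is faithful, and the tensored equation can be read off the
  pentagon whose second object is the unit, with two uses of the triangle.\<close>

lemma unit_l_tensor: "l (A \<odot> B) = (l A \<otimes> \<one> B) \<cdot> a \<I> A B"
proof (rule unit_left_faithful)
  have "a \<I> A B \<cdot> (\<one> \<I> \<otimes> l (A \<odot> B)) = a \<I> A B \<cdot> (r \<I> \<otimes> \<one> (A \<odot> B)) \<cdot> a \<I> \<I> (A \<odot> B)"
    by (simp only: triangle)
  also have "\<dots> = ((r \<I> \<otimes> \<one> A) \<otimes> \<one> B) \<cdot> a (\<I> \<odot> \<I>) A B \<cdot> a \<I> \<I> (A \<odot> B)"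
    using a_nat[of "r \<I>" "\<one> A" "\<one> B", THEN comp_extend] by (simp add: comp_assoc)
  also have "\<dots> = (((r \<I> \<otimes> \<one> A) \<cdot> a \<I> \<I> A) \<otimes> \<one> B) \<cdot> a \<I> (\<I> \<odot> A) B \<cdot> (\<one> \<I> \<otimes> a \<I> A B)"
    by (simp only: pentagon whisker_right comp_assoc)
  also have "\<dots> = ((\<one> \<I> \<otimes> l A) \<otimes> \<one> B) \<cdot> a \<I> (\<I> \<odot> A) B \<cdot> (\<one> \<I> \<otimes> a \<I> A B)"
    by (simp only: triangle)
  also have "\<dots> = a \<I> A B \<cdot> (\<one> \<I> \<otimes> (l A \<otimes> \<one> B)) \<cdot> (\<one> \<I> \<otimes> a \<I> A B)"
    using a_nat[of "\<one> \<I>" "l A" "\<one> B", THEN comp_extend] by (simp add: comp_assoc)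
  finally have "a \<I> A B \<cdot> (\<one> \<I> \<otimes> l (A \<odot> B)) = a \<I> A B \<cdot> (\<one> \<I> \<otimes> ((l A \<otimes> \<one> B) \<cdot> a \<I> A B))"
    by (simp only: whisker_left)
  then show "\<one> \<I> \<otimes> l (A \<odot> B) = \<one> \<I> \<otimes> ((l A \<otimes> \<one> B) \<cdot> a \<I> A B)"
    by (rule inverse_cancel_left[rotated]) auto
qed simp_all

text \<open>The same argument with the unit as third object of the pentagon.\<close>

lemma unit_r_tensor: "r (A \<odot> B) \<cdot> a A B \<I> = \<one> A \<otimes> r B"
proof (rule unit_right_faithful)
  let ?Z = "a A (B \<odot> \<I>) \<I> \<cdot> (\<one> A \<otimes> a B \<I> \<I>)"
  have "((r (A \<odot> B) \<cdot> a A B \<I>) \<otimes> \<one> \<I>) \<cdot> ?Z = (r (A \<odot> B) \<otimes> \<one> \<I>) \<cdot> a (A \<odot> B) \<I> \<I> \<cdot> a A B (\<I> \<odot> \<I>)"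
    by (simp only: pentagon whisker_right comp_assoc)
  also have "\<dots> = ((\<one> A \<otimes> \<one> B) \<otimes> l \<I>) \<cdot> a A B (\<I> \<odot> \<I>)"
    using triangle[of "A \<odot> B" \<I>, THEN comp_extend] by (simp add: comp_assoc)
  also have "\<dots> = a A B \<I> \<cdot> (\<one> A \<otimes> (\<one> B \<otimes> l \<I>))"
    using a_nat[of "\<one> A" "\<one> B" "l \<I>"] by simp
  also have "\<dots> = a A B \<I> \<cdot> (\<one> A \<otimes> (r B \<otimes> \<one> \<I>)) \<cdot> (\<one> A \<otimes> a B \<I> \<I>)"
    by (simp only: triangle[symmetric] whisker_left)
  also have "\<dots> = ((\<one> A \<otimes> r B) \<otimes> \<one> \<I>) \<cdot> ?Z"
    using a_nat[of "\<one> A" "r B" "\<one> \<I>", THEN comp_extend] by (simp add: comp_assoc)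
  moreover have "inverse ?Z ((\<one> A \<otimes> a' B \<I> \<I>) \<cdot> a' A (B \<odot> \<I>) \<I>)"
    by (auto intro!: inverse_comp inverse_tensor)
  ultimately show "(r (A \<odot> B) \<cdot> a A B \<I>) \<otimes> \<one> \<I> = (\<one> A \<otimes> r B) \<otimes> \<one> \<I>"
    by - (rule inverse_cancel_right, auto)
qed simp_all

lemma unit_l_eq_r: "l \<I> = r \<I>"
proof -
  have "l (\<I> \<odot> \<I>) = \<one> \<I> \<otimes> l \<I>"
    using l_nat[of "l \<I>"] by - (rule inverse_cancel_left[of "l \<I>" "l' \<I>"], auto)
  then have "(l \<I> \<otimes> \<one> \<I>) \<cdot> a \<I> \<I> \<I> = (r \<I> \<otimes> \<one> \<I>) \<cdot> a \<I> \<I> \<I>"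
    by (simp only: unit_l_tensor[symmetric] triangle)
  then have "l \<I> \<otimes> \<one> \<I> = r \<I> \<otimes> \<one> \<I>"
    by (rule inverse_cancel_right[rotated]) auto
  then show ?thesis by (rule unit_right_faithful) simp_all
qed

lemma s_unit: "s \<I> \<I> = \<one> (\<I> \<odot> \<I>)"
  using unit_s[of \<I>] by - (rule inverse_cancel_left[of "r \<I>" "r' \<I>"], auto simp: unit_l_eq_r)

lemma unit_s_mirror: "l A \<cdot> s A \<I> = r A"
  using unit_s[of A, THEN comp_extend, of "s A \<I>"] by (simp add: comp_assoc)

text \<open>The exchange of the first two factors of a right-nested product with an arbitrary tail. In the
  presence of a tail the hexagon says that moving past a product is moving past its factors in turn,
  and composites of exchanges can be compared as if the tensor were strict.\<close>

definition swap :: "'o \<Rightarrow> 'o \<Rightarrow> 'o \<Rightarrow> 'a" where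
  "swap A B X = a' B A X \<cdot> (s A B \<otimes> \<one> X) \<cdot> a A B X"

lemma swap_types [simp]:
  "src (swap A B X) = A \<odot> (B \<odot> X)" "tgt (swap A B X) = B \<odot> (A \<odot> X)"
  by (simp_all add: swap_def)

lemma swap_inverse: "inverse (swap A B X) (swap B A X)"
  unfolding swap_def comp_assoc[symmetric, of "a' A B X"] by (auto intro!: inverse_comp inverse_tensor)

lemma swap_nat: "swap (tgt f) (tgt g) (tgt h) \<cdot> (f \<otimes> (g \<otimes> h)) = (g \<otimes> (f \<otimes> h)) \<cdot> swap (src f) (src g) (src h)"
proof -
  let ?A = "tgt f" and ?B = "tgt g" and ?X = "tgt h"
  have "swap ?A ?B ?X \<cdot> (f \<otimes> (g \<otimes> h)) = a' ?B ?A ?X \<cdot> ((s ?A ?B \<cdot> (f \<otimes> g)) \<otimes> h) \<cdot> a (src f) (src g) (src h)"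
    using interchange[of "s ?A ?B" "f \<otimes> g" "\<one> ?X" h, symmetric, THEN comp_extend]
    by (simp add: swap_def comp_assoc a_nat)
  also have "\<dots> = (a' ?B ?A ?X \<cdot> ((g \<otimes> f) \<otimes> h)) \<cdot> (s (src f) (src g) \<otimes> \<one> (src h)) \<cdot> a (src f) (src g) (src h)"
    using interchange[of "g \<otimes> f" "s (src f) (src g)" h "\<one> (src h)", THEN comp_extend]
    by (simp add: comp_assoc s_nat)
  also have "\<dots> = (g \<otimes> (f \<otimes> h)) \<cdot> swap (src f) (src g) (src h)"
    by (simp only: a'_nat comp_assoc swap_def)
  finally show ?thesis .
qed

text \<open>Naturality of the associator in one argument, stated with the objects as parameters because the
  simplifier has to match identity arrows.\<close>

lemma a'_nat_right: "tgt h = H \<Longrightarrow> src h = H' \<Longrightarrow> a' A B H \<cdot> (\<one> (A \<odot> B) \<otimes> h) = (\<one> A \<otimes> (\<one> B \<otimes> h)) \<cdot> a' A B H'"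
  using a'_nat[of "\<one> A" "\<one> B" h] by simp
lemma a'_nat_mid: "tgt h = H \<Longrightarrow> src h = H' \<Longrightarrow> a' A H B \<cdot> ((\<one> A \<otimes> h) \<otimes> \<one> B) = (\<one> A \<otimes> (h \<otimes> \<one> B)) \<cdot> a' A H' B"
  using a'_nat[of "\<one> A" h "\<one> B"] by simp
lemma a'_nat_left: "tgt h = H \<Longrightarrow> src h = H' \<Longrightarrow> a' H A B \<cdot> ((h \<otimes> \<one> A) \<otimes> \<one> B) = (h \<otimes> \<one> (A \<odot> B)) \<cdot> a' H' A B"
  using a'_nat[of h "\<one> A" "\<one> B"] by simp

text \<open>The pentagon solved for two other pairs of its sides.\<close>

lemma pentagon'_a_right: "a' (A \<odot> B) C D \<cdot> (a A B C \<otimes> \<one> D) = a A B (C \<odot> D) \<cdot> (\<one> A \<otimes> a' B C D) \<cdot> a' A (B \<odot> C) D"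
proof -
  have "inverse (a' A B C \<otimes> \<one> D) (a A B C \<otimes> \<one> D)" by (auto intro!: inverse_tensor)
  from inverse_transpose[OF _ _ this, of "a' A B (C \<odot> D)" "a' (A \<odot> B) C D"
      "(\<one> A \<otimes> a' B C D) \<cdot> a' A (B \<odot> C) D" "a A B (C \<odot> D)"]
  show ?thesis by (simp add: pentagon' comp_assoc)
qed

lemma pentagon_mixed: "a' A (B \<odot> C) D \<cdot> (a' A B C \<otimes> \<one> D) \<cdot> a (A \<odot> B) C D = (\<one> A \<otimes> a B C D) \<cdot> a' A B (C \<odot> D)"
proof -
  have "inverse (a' (A \<odot> B) C D) (a (A \<odot> B) C D)" "inverse (\<one> A \<otimes> a' B C D) (\<one> A \<otimes> a B C D)"
    by (auto intro!: inverse_tensor)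
  from inverse_transpose[OF _ this(2,1), of "a' A (B \<odot> C) D \<cdot> (a' A B C \<otimes> \<one> D)" "a' A B (C \<odot> D)"]
  show ?thesis by (simp add: pentagon' comp_assoc)
qed

text \<open>The hexagon, with the associators carried to the right-nested side by three uses of the pentagon.\<close>

lemma swap_tensor_left:
  "(\<one> C \<otimes> a' A B X) \<cdot> swap (A \<odot> B) C X
    = swap A C (B \<odot> X) \<cdot> (\<one> A \<otimes> swap B C X) \<cdot> a' A B (C \<odot> X)"
proof -
  have s: "s (A \<odot> B) C = a' C A B \<cdot> (s A C \<otimes> \<one> B) \<cdot> a A C B \<cdot> (\<one> A \<otimes> s B C) \<cdot> a' A B C"
    using hexagon[of C A B, THEN comp_extend, of "a' A B C"]
    by - (rule inverse_cancel_left[of "a C A B" "a' C A B"], auto simp: comp_assoc)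
  have "(\<one> C \<otimes> a' A B X) \<cdot> swap (A \<odot> B) C X
      = ((\<one> C \<otimes> a' A B X) \<cdot> a' C (A \<odot> B) X \<cdot> (a' C A B \<otimes> \<one> X)) \<cdot> ((s A C \<otimes> \<one> B) \<otimes> \<one> X)
        \<cdot> (a A C B \<otimes> \<one> X) \<cdot> ((\<one> A \<otimes> s B C) \<otimes> \<one> X) \<cdot> (a' A B C \<otimes> \<one> X) \<cdot> a (A \<odot> B) C X"
    by (simp only: swap_def s whisker_right comp_assoc)
  also have "\<dots> = a' C A (B \<odot> X) \<cdot> (s A C \<otimes> \<one> (B \<odot> X)) \<cdot> (a' (A \<odot> C) B X
        \<cdot> (a A C B \<otimes> \<one> X)) \<cdot> ((\<one> A \<otimes> s B C) \<otimes> \<one> X) \<cdot> (a' A B C \<otimes> \<one> X) \<cdot> a (A \<odot> B) C X"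
    using a'_nat_left[of "s A C" _ _ B X, THEN comp_extend]
    by (simp add: comp_assoc pentagon'[symmetric])
  also have "\<dots> = a' C A (B \<odot> X) \<cdot> (s A C \<otimes> \<one> (B \<odot> X)) \<cdot> a A C (B \<odot> X) \<cdot> (\<one> A \<otimes> a' C B X)
        \<cdot> (\<one> A \<otimes> (s B C \<otimes> \<one> X)) \<cdot> (a' A (B \<odot> C) X \<cdot> (a' A B C \<otimes> \<one> X) \<cdot> a (A \<odot> B) C X)"
    using a'_nat_mid[of "s B C" _ _ A X, THEN comp_extend]
    by (simp add: comp_assoc pentagon'_a_right)
  also have "\<dots> = swap A C (B \<odot> X) \<cdot> (\<one> A \<otimes> swap B C X) \<cdot> a' A B (C \<odot> X)"
    by (simp only: pentagon_mixed swap_def whisker_left comp_assoc)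
  finally show ?thesis .
qed

lemma swap_tensor_right:
  "a' B C (A \<odot> X) \<cdot> swap A (B \<odot> C) X
    = (\<one> B \<otimes> swap A C X) \<cdot> swap A B (C \<odot> X) \<cdot> (\<one> A \<otimes> a' B C X)"
proof -
  have "inverse (swap B A (C \<odot> X) \<cdot> (\<one> B \<otimes> swap C A X)) ((\<one> B \<otimes> swap A C X) \<cdot> swap A B (C \<odot> X))"
    by (auto intro!: inverse_comp inverse_tensor swap_inverse)
  from inverse_transpose[OF _ this swap_inverse, of "a' B C (A \<odot> X)" "\<one> A \<otimes> a' B C X" "B \<odot> C" A X]
  show ?thesis by (simp add: swap_tensor_left comp_assoc)
qed

text \<open>The tail of an exchange may itself be a product.\<close>

lemma swap_tail:
  "(\<one> B \<otimes> a' A X Y) \<cdot> a' B (A \<odot> X) Y \<cdot> (swap A B X \<otimes> \<one> Y)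
    = swap A B (X \<odot> Y) \<cdot> (\<one> A \<otimes> a' B X Y) \<cdot> a' A (B \<odot> X) Y"
proof -
  have "(\<one> B \<otimes> a' A X Y) \<cdot> a' B (A \<odot> X) Y \<cdot> (swap A B X \<otimes> \<one> Y)
      = ((\<one> B \<otimes> a' A X Y) \<cdot> a' B (A \<odot> X) Y \<cdot> (a' B A X \<otimes> \<one> Y))
        \<cdot> ((s A B \<otimes> \<one> X) \<otimes> \<one> Y) \<cdot> (a A B X \<otimes> \<one> Y)"
    by (simp only: swap_def whisker_right comp_assoc)
  also have "\<dots> = a' B A (X \<odot> Y) \<cdot> (s A B \<otimes> \<one> (X \<odot> Y)) \<cdot> a' (A \<odot> B) X Y \<cdot> (a A B X \<otimes> \<one> Y)"
    using a'_nat_left[of "s A B" _ _ X Y, THEN comp_extend]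
    by (simp add: comp_assoc pentagon'[symmetric])
  also have "\<dots> = swap A B (X \<odot> Y) \<cdot> (\<one> A \<otimes> a' B X Y) \<cdot> a' A (B \<odot> X) Y"
    by (simp only: pentagon'_a_right swap_def comp_assoc)
  finally show ?thesis .
qed

text \<open>The middle-four interchange. It plays for two copies of the tensor the role that \<open>\<iota>\<close> plays for \<open>\<or>\<close>
  and \<open>\<and>\<close>, and satisfies the analogues \<open>mid_a\<close>, \<open>mid_s\<close>, \<open>mid_r\<close> of the first three SMI equations.\<close>

definition mid :: "'o \<Rightarrow> 'o \<Rightarrow> 'o \<Rightarrow> 'o \<Rightarrow> 'a" where
  "mid A B C D = a A C (B \<odot> D) \<cdot> (\<one> A \<otimes> swap B C D) \<cdot> a' A B (C \<odot> D)"

lemma mid_types [simp]: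
  "src (mid A B C D) = (A \<odot> B) \<odot> (C \<odot> D)" "tgt (mid A B C D) = (A \<odot> C) \<odot> (B \<odot> D)"
  by (simp_all add: mid_def)

lemma a'_mid: "a' A C (B \<odot> D) \<cdot> mid A B C D = (\<one> A \<otimes> swap B C D) \<cdot> a' A B (C \<odot> D)"
  by (simp add: mid_def)

lemma mid_nat:
  "mid (tgt f) (tgt g) (tgt h) (tgt k) \<cdot> ((f \<otimes> g) \<otimes> (h \<otimes> k))
    = ((f \<otimes> h) \<otimes> (g \<otimes> k)) \<cdot> mid (src f) (src g) (src h) (src k)"
proof -
  let ?w = "swap (src g) (src h) (src k)"
  have "mid (tgt f) (tgt g) (tgt h) (tgt k) \<cdot> ((f \<otimes> g) \<otimes> (h \<otimes> k))
      = a (tgt f) (tgt h) (tgt g \<odot> tgt k) \<cdot> ((\<one> (tgt f) \<otimes> swap (tgt g) (tgt h) (tgt k)) \<cdot> (f \<otimes> (g \<otimes> (h \<otimes> k))))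
        \<cdot> a' (src f) (src g) (src h \<odot> src k)"
    using a'_nat[of f g "h \<otimes> k"] by (simp add: mid_def comp_assoc)
  also have "\<dots> = (a (tgt f) (tgt h) (tgt g \<odot> tgt k) \<cdot> (f \<otimes> (h \<otimes> (g \<otimes> k)))) \<cdot> (\<one> (src f) \<otimes> ?w)
        \<cdot> a' (src f) (src g) (src h \<odot> src k)"
    using interchange[of "\<one> (tgt f)" f "swap (tgt g) (tgt h) (tgt k)" "g \<otimes> (h \<otimes> k)"]
      interchange[of f "\<one> (src f)" "h \<otimes> (g \<otimes> k)" ?w, THEN comp_extend]
    by (simp add: swap_nat comp_assoc)
  also have "\<dots> = ((f \<otimes> h) \<otimes> (g \<otimes> k)) \<cdot> mid (src f) (src g) (src h) (src k)"
    using a_nat[of f h "g \<otimes> k"] by (simp add: mid_def comp_assoc)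
  finally show ?thesis .
qed

lemma s_tensor_left: "s (A \<odot> B) C \<cdot> a A B C = swap A C B \<cdot> (\<one> A \<otimes> s B C)"
  by (rule inverse_cancel_left[of "a C A B" "a' C A B"]) (auto simp: hexagon swap_def comp_assoc)

text \<open>Both sides are compared in right-nested form. The exchange of two blocks decomposes into four
  exchanges of factors, of which one cancels against the exchange inside the left \<open>mid\<close>.\<close>

lemma mid_s: "mid C D A B \<cdot> s (A \<odot> B) (C \<odot> D) = (s A C \<otimes> s B D) \<cdot> mid A B C D"
proof -
  let ?L = "a' C A (D \<odot> B) \<cdot> mid C D A B \<cdot> s (A \<odot> B) (C \<odot> D) \<cdot> a A B (C \<odot> D)"
  have "?L = (\<one> C \<otimes> swap D A B) \<cdot> a' C D (A \<odot> B) \<cdot> swap A (C \<odot> D) B \<cdot> (\<one> A \<otimes> s B (C \<odot> D))"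
    using a'_mid[of C A D B, THEN comp_extend] by (simp add: comp_assoc s_tensor_left)
  also have "\<dots> = (\<one> C \<otimes> (swap D A B \<cdot> swap A D B)) \<cdot> swap A C (D \<odot> B)
      \<cdot> (\<one> A \<otimes> (a' C D B \<cdot> s B (C \<odot> D)))"
    using swap_tensor_right[of C D A B, THEN comp_extend] by (simp add: whisker_left comp_assoc)
  also have "\<dots> = swap A C (D \<odot> B) \<cdot> (\<one> A \<otimes> (a' C D B \<cdot> s B (C \<odot> D)))"
    using swap_inverse[of A D B] by (simp add: inverse_simps)
  also have "a' C D B \<cdot> s B (C \<odot> D) = (\<one> C \<otimes> s B D) \<cdot> swap B C D"
    using hexagon'[of C D B, THEN comp_extend, of "a B C D"] by (simp add: swap_def comp_assoc)
  also have "swap A C (D \<odot> B) \<cdot> (\<one> A \<otimes> ((\<one> C \<otimes> s B D) \<cdot> swap B C D))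
      = a' C A (D \<odot> B) \<cdot> (s A C \<otimes> \<one> (D \<odot> B)) \<cdot> (a A C (D \<odot> B) \<cdot> (\<one> A \<otimes> (\<one> C \<otimes> s B D))) \<cdot> (\<one> A \<otimes> swap B C D)"
    by (simp only: swap_def[of A C "D \<odot> B"] whisker_left comp_assoc)
  also have "\<dots> = a' C A (D \<odot> B) \<cdot> (s A C \<otimes> s B D) \<cdot> a A C (B \<odot> D) \<cdot> (\<one> A \<otimes> swap B C D)"
    using a_nat[of "\<one> A" "\<one> C" "s B D"] tensor_split[of "s A C" "s B D", THEN comp_extend]
    by (simp add: comp_assoc)
  also have "\<dots> = a' C A (D \<odot> B) \<cdot> (s A C \<otimes> s B D) \<cdot> mid A B C D \<cdot> a A B (C \<odot> D)"
    by (simp add: mid_def comp_assoc)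
  finally have "?L = \<dots>" .
  then have "(mid C D A B \<cdot> s (A \<odot> B) (C \<odot> D)) \<cdot> a A B (C \<odot> D) = ((s A C \<otimes> s B D) \<cdot> mid A B C D) \<cdot> a A B (C \<odot> D)"
    by - (rule inverse_cancel_left[of "a' C A (D \<odot> B)" "a C A (D \<odot> B)"], auto simp: comp_assoc)
  then show ?thesis by - (rule inverse_cancel_right, auto)
qed

text \<open>In right-nested form, with a tail, a middle-four interchange is one exchange.\<close>

lemma mid_nested:
  "a' A1 B1 (A2 \<odot> (B2 \<odot> Y)) \<cdot> (\<one> (A1 \<odot> B1) \<otimes> a' A2 B2 Y) \<cdot> a' (A1 \<odot> B1) (A2 \<odot> B2) Y \<cdot> (mid A1 A2 B1 B2 \<otimes> \<one> Y)
    = (\<one> A1 \<otimes> (swap A2 B1 (B2 \<odot> Y) \<cdot> (\<one> A2 \<otimes> a' B1 B2 Y))) \<cdot> a' A1 A2 ((B1 \<odot> B2) \<odot> Y) \<cdot> a' (A1 \<odot> A2) (B1 \<odot> B2) Y"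
proof -
  let ?W = "A2 \<odot> B2"
  have "a' A1 B1 (A2 \<odot> (B2 \<odot> Y)) \<cdot> (\<one> (A1 \<odot> B1) \<otimes> a' A2 B2 Y) \<cdot> a' (A1 \<odot> B1) ?W Y \<cdot> (mid A1 A2 B1 B2 \<otimes> \<one> Y)
    = (\<one> A1 \<otimes> (\<one> B1 \<otimes> a' A2 B2 Y)) \<cdot> (a' A1 B1 (?W \<odot> Y) \<cdot> a' (A1 \<odot> B1) ?W Y) \<cdot> (mid A1 A2 B1 B2 \<otimes> \<one> Y)"
    using a'_nat_right[of "a' A2 B2 Y" _ _ A1 B1, THEN comp_extend] by (simp add: comp_assoc)
  also have "\<dots> = (\<one> A1 \<otimes> (\<one> B1 \<otimes> a' A2 B2 Y)) \<cdot> (\<one> A1 \<otimes> a' B1 ?W Y) \<cdot> a' A1 (B1 \<odot> ?W) Y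
      \<cdot> ((a' A1 B1 ?W \<cdot> mid A1 A2 B1 B2) \<otimes> \<one> Y)"
    by (simp only: pentagon' comp_assoc whisker_right)
  also have "\<dots> = (\<one> A1 \<otimes> (\<one> B1 \<otimes> a' A2 B2 Y)) \<cdot> (\<one> A1 \<otimes> a' B1 ?W Y) \<cdot> a' A1 (B1 \<odot> ?W) Y
      \<cdot> ((\<one> A1 \<otimes> swap A2 B1 B2) \<otimes> \<one> Y) \<cdot> (a' A1 A2 (B1 \<odot> B2) \<otimes> \<one> Y)"
    by (simp only: a'_mid whisker_right)
  also have "\<dots> = (\<one> A1 \<otimes> ((\<one> B1 \<otimes> a' A2 B2 Y) \<cdot> a' B1 ?W Y \<cdot> (swap A2 B1 B2 \<otimes> \<one> Y)))
      \<cdot> a' A1 (A2 \<odot> (B1 \<odot> B2)) Y \<cdot> (a' A1 A2 (B1 \<odot> B2) \<otimes> \<one> Y)"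
    using a'_nat_mid[of "swap A2 B1 B2" _ _ A1 Y, THEN comp_extend] by (simp add: comp_assoc whisker_left)
  also have "\<dots> = (\<one> A1 \<otimes> (swap A2 B1 (B2 \<odot> Y) \<cdot> (\<one> A2 \<otimes> a' B1 B2 Y)))
      \<cdot> (\<one> A1 \<otimes> a' A2 (B1 \<odot> B2) Y) \<cdot> a' A1 (A2 \<odot> (B1 \<odot> B2)) Y \<cdot> (a' A1 A2 (B1 \<odot> B2) \<otimes> \<one> Y)"
    by (simp only: swap_tail whisker_left comp_assoc)
  also have "\<dots> = (\<one> A1 \<otimes> (swap A2 B1 (B2 \<odot> Y) \<cdot> (\<one> A2 \<otimes> a' B1 B2 Y)))
      \<cdot> a' A1 A2 ((B1 \<odot> B2) \<odot> Y) \<cdot> a' (A1 \<odot> A2) (B1 \<odot> B2) Y"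
    by (simp only: pentagon')
  finally show ?thesis .
qed

text \<open>Followed by the isomorphism with the right-nested product, both sides become the same composite of
  three exchanges: \<open>A2\<close> moves past \<open>B1\<close> and \<open>C1\<close>, and \<open>B2\<close> past \<open>C1\<close>.\<close>

lemma mid_a:
  "(a A1 B1 C1 \<otimes> a A2 B2 C2) \<cdot> mid A1 A2 (B1 \<odot> C1) (B2 \<odot> C2) \<cdot> (\<one> (A1 \<odot> A2) \<otimes> mid B1 B2 C1 C2)
    = mid (A1 \<odot> B1) (A2 \<odot> B2) C1 C2 \<cdot> (mid A1 A2 B1 B2 \<otimes> \<one> (C1 \<odot> C2)) \<cdot> a (A1 \<odot> A2) (B1 \<odot> B2) (C1 \<odot> C2)"
    (is "?a \<cdot> ?L = ?R")
proof -
  let ?Z = "A2 \<odot> (B2 \<odot> C2)" and ?Y = "C1 \<odot> C2"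
  let ?M = "(\<one> A1 \<otimes> ((\<one> B1 \<otimes> swap A2 C1 (B2 \<odot> C2)) \<cdot> (\<one> B1 \<otimes> (\<one> A2 \<otimes> swap B2 C1 C2))
    \<cdot> swap A2 B1 (B2 \<odot> ?Y) \<cdot> (\<one> A2 \<otimes> a' B1 B2 ?Y))) \<cdot> a' A1 A2 ((B1 \<odot> B2) \<odot> ?Y)"
  let ?N = "a' A1 B1 (C1 \<odot> ?Z) \<cdot> a' (A1 \<odot> B1) C1 ?Z"
  let ?n = "?N \<cdot> (\<one> ((A1 \<odot> B1) \<odot> C1) \<otimes> a' A2 B2 C2)"
  \<comment> \<open>the left side, up to the last associator, in right-nested form\<close>
  have "(\<one> A1 \<otimes> a' B1 C1 ?Z) \<cdot> a' A1 (B1 \<odot> C1) ?Z \<cdot> ?L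
      = (\<one> A1 \<otimes> (a' B1 C1 ?Z \<cdot> swap A2 (B1 \<odot> C1) (B2 \<odot> C2))) \<cdot> a' A1 A2 ((B1 \<odot> C1) \<odot> (B2 \<odot> C2))
        \<cdot> (\<one> (A1 \<odot> A2) \<otimes> mid B1 B2 C1 C2)"
    using a'_mid[of A1 "B1 \<odot> C1" A2 "B2 \<odot> C2", THEN comp_extend] by (simp add: comp_assoc whisker_left)
  also have "\<dots> = (\<one> A1 \<otimes> (((\<one> B1 \<otimes> swap A2 C1 (B2 \<odot> C2)) \<cdot> swap A2 B1 (C1 \<odot> (B2 \<odot> C2)) \<cdot> (\<one> A2 \<otimes> a' B1 C1 (B2 \<odot> C2)))
        \<cdot> (\<one> A2 \<otimes> mid B1 B2 C1 C2))) \<cdot> a' A1 A2 ((B1 \<odot> B2) \<odot> ?Y)"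
    using a'_nat_right[of "mid B1 B2 C1 C2" _ _ A1 A2]
    by (simp add: comp_assoc whisker_left swap_tensor_right)
  also have "\<dots> = (\<one> A1 \<otimes> ((\<one> B1 \<otimes> swap A2 C1 (B2 \<odot> C2)) \<cdot> swap A2 B1 (C1 \<odot> (B2 \<odot> C2))
        \<cdot> (\<one> A2 \<otimes> (\<one> B1 \<otimes> swap B2 C1 C2)) \<cdot> (\<one> A2 \<otimes> a' B1 B2 ?Y))) \<cdot> a' A1 A2 ((B1 \<odot> B2) \<odot> ?Y)"
    using a'_mid[of B1 C1 B2 C2] by (simp add: comp_assoc whisker_left[symmetric])
  also have "\<dots> = ?M"
    using swap_nat[of "\<one> A2" "\<one> B1" "swap B2 C1 C2", THEN comp_extend] by (simp add: comp_assoc)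
  finally have L: "(\<one> A1 \<otimes> a' B1 C1 ?Z) \<cdot> a' A1 (B1 \<odot> C1) ?Z \<cdot> ?L = ?M" .
  \<comment> \<open>the right side in right-nested form; its second interchange is treated by \<open>mid_nested\<close>\<close>
  have "?N \<cdot> (\<one> ((A1 \<odot> B1) \<odot> C1) \<otimes> a' A2 B2 C2) \<cdot> mid (A1 \<odot> B1) (A2 \<odot> B2) C1 C2
      = a' A1 B1 (C1 \<odot> ?Z) \<cdot> (\<one> (A1 \<odot> B1) \<otimes> (\<one> C1 \<otimes> a' A2 B2 C2)) \<cdot> a' (A1 \<odot> B1) C1 ((A2 \<odot> B2) \<odot> C2)
         \<cdot> mid (A1 \<odot> B1) (A2 \<odot> B2) C1 C2"
    using a'_nat_right[of "a' A2 B2 C2" _ _ "A1 \<odot> B1" C1, THEN comp_extend] by (simp add: comp_assoc)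
  also have "\<dots> = a' A1 B1 (C1 \<odot> ?Z) \<cdot> (\<one> (A1 \<odot> B1) \<otimes> ((\<one> C1 \<otimes> a' A2 B2 C2) \<cdot> swap (A2 \<odot> B2) C1 C2))
      \<cdot> a' (A1 \<odot> B1) (A2 \<odot> B2) ?Y"
    by (simp only: a'_mid whisker_left comp_assoc)
  also have "\<dots> = (a' A1 B1 (C1 \<odot> ?Z) \<cdot> (\<one> (A1 \<odot> B1) \<otimes> (swap A2 C1 (B2 \<odot> C2) \<cdot> (\<one> A2 \<otimes> swap B2 C1 C2))))
      \<cdot> (\<one> (A1 \<odot> B1) \<otimes> a' A2 B2 ?Y) \<cdot> a' (A1 \<odot> B1) (A2 \<odot> B2) ?Y"
    by (simp only: swap_tensor_left whisker_left comp_assoc)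
  also have "\<dots> = (\<one> A1 \<otimes> (\<one> B1 \<otimes> (swap A2 C1 (B2 \<odot> C2) \<cdot> (\<one> A2 \<otimes> swap B2 C1 C2))))
      \<cdot> a' A1 B1 (A2 \<odot> (B2 \<odot> ?Y)) \<cdot> (\<one> (A1 \<odot> B1) \<otimes> a' A2 B2 ?Y) \<cdot> a' (A1 \<odot> B1) (A2 \<odot> B2) ?Y"
    using a'_nat_right[of "swap A2 C1 (B2 \<odot> C2) \<cdot> (\<one> A2 \<otimes> swap B2 C1 C2)" _ _ A1 B1, THEN comp_extend]
    by (simp add: comp_assoc)
  finally have "?n \<cdot> ?R
      = (\<one> A1 \<otimes> (\<one> B1 \<otimes> (swap A2 C1 (B2 \<odot> C2) \<cdot> (\<one> A2 \<otimes> swap B2 C1 C2))))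
        \<cdot> (a' A1 B1 (A2 \<odot> (B2 \<odot> ?Y)) \<cdot> (\<one> (A1 \<odot> B1) \<otimes> a' A2 B2 ?Y) \<cdot> a' (A1 \<odot> B1) (A2 \<odot> B2) ?Y
          \<cdot> (mid A1 A2 B1 B2 \<otimes> \<one> ?Y)) \<cdot> a (A1 \<odot> A2) (B1 \<odot> B2) ?Y"
    by (metis comp_assoc)
  also have "\<dots> = ?M"
    by (simp only: mid_nested) (simp add: comp_assoc whisker_left)
  also have "\<dots> = (\<one> A1 \<otimes> a' B1 C1 ?Z) \<cdot> a' A1 (B1 \<odot> C1) ?Z \<cdot> ?L"
    by (simp only: L)
  also have "\<dots> = ?N \<cdot> (a A1 B1 C1 \<otimes> \<one> ?Z) \<cdot> ?L"
    using pentagon'[of A1 B1 C1 ?Z, THEN comp_extend, of "(a A1 B1 C1 \<otimes> \<one> ?Z) \<cdot> ?L"]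
      interchange[of "a' A1 B1 C1" "a A1 B1 C1" "\<one> ?Z" "\<one> ?Z", symmetric, THEN comp_extend]
    by (simp add: comp_assoc)
  also have "\<dots> = ?N \<cdot> (\<one> ((A1 \<odot> B1) \<odot> C1) \<otimes> a' A2 B2 C2) \<cdot> ?a \<cdot> ?L"
    using interchange[of "\<one> ((A1 \<odot> B1) \<odot> C1)" "a A1 B1 C1" "a' A2 B2 C2" "a A2 B2 C2", THEN comp_extend]
    by (simp add: comp_assoc)
  finally have "?n \<cdot> ?R = ?n \<cdot> ?a \<cdot> ?L" by (simp only: comp_assoc)
  moreover have "inverse ?n ((\<one> ((A1 \<odot> B1) \<odot> C1) \<otimes> a A2 B2 C2) \<cdot> a (A1 \<odot> B1) C1 ?Z \<cdot> a A1 B1 (C1 \<odot> ?Z))"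
    by (auto intro!: inverse_comp inverse_tensor)
  ultimately show ?thesis
    by - (rule inverse_cancel_left, auto)
qed

lemma l_swap: "l (B \<odot> X) \<cdot> swap B \<I> X = \<one> B \<otimes> l X"
proof -
  have "l (B \<odot> X) \<cdot> swap B \<I> X = ((l B \<cdot> s B \<I>) \<otimes> \<one> X) \<cdot> a B \<I> X"
    by (simp add: swap_def comp_assoc whisker_right unit_l_tensor)
  then show ?thesis by (simp only: unit_s_mirror triangle)
qed

lemma swap_l: "(\<one> B \<otimes> l X) \<cdot> swap \<I> B X = l (B \<odot> X)"
  using swap_inverse[of \<I> B X] by (simp add: l_swap[symmetric] comp_assoc inverse_simps)

lemma mid_r: "(r A \<otimes> r B) \<cdot> mid A B \<I> \<I> \<cdot> (\<one> (A \<odot> B) \<otimes> r' \<I>) = r (A \<odot> B)"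
proof -
  have "(r A \<otimes> r B) \<cdot> mid A B \<I> \<I> = ((r A \<otimes> \<one> B) \<cdot> (\<one> (A \<odot> \<I>) \<otimes> r B) \<cdot> a A \<I> (B \<odot> \<I>))
      \<cdot> (\<one> A \<otimes> swap B \<I> \<I>) \<cdot> a' A B (\<I> \<odot> \<I>)"
    using tensor_split[of "r A" "r B", THEN comp_extend] by (simp add: mid_def comp_assoc)
  also have "\<dots> = ((r A \<otimes> \<one> B) \<cdot> a A \<I> B \<cdot> (\<one> A \<otimes> (\<one> \<I> \<otimes> r B))) \<cdot> (\<one> A \<otimes> swap B \<I> \<I>) \<cdot> a' A B (\<I> \<odot> \<I>)"
    using a_nat[of "\<one> A" "\<one> \<I>" "r B"] by simp
  also have "\<dots> = (\<one> A \<otimes> (l B \<cdot> (\<one> \<I> \<otimes> r B) \<cdot> swap B \<I> \<I>)) \<cdot> a' A B (\<I> \<odot> \<I>)"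
    using triangle[of A B, THEN comp_extend] by (simp add: comp_assoc whisker_left)
  also have "l B \<cdot> (\<one> \<I> \<otimes> r B) \<cdot> swap B \<I> \<I> = r B \<cdot> (\<one> B \<otimes> l \<I>)"
    using l_nat[of "r B", THEN comp_extend] by (simp add: comp_assoc l_swap)
  also have "(\<one> A \<otimes> (r B \<cdot> (\<one> B \<otimes> l \<I>))) \<cdot> a' A B (\<I> \<odot> \<I>) = (\<one> A \<otimes> r B) \<cdot> a' A B \<I> \<cdot> (\<one> (A \<odot> B) \<otimes> l \<I>)"
    using a'_nat_right[of "l \<I>" _ _ A B] by (simp add: whisker_left comp_assoc)
  finally have "(r A \<otimes> r B) \<cdot> mid A B \<I> \<I> \<cdot> (\<one> (A \<odot> B) \<otimes> r' \<I>)
      = (\<one> A \<otimes> r B) \<cdot> a' A B \<I> \<cdot> (\<one> (A \<odot> B) \<otimes> (l \<I> \<cdot> r' \<I>))"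
    by (metis comp_assoc whisker_left)
  then show ?thesis
    by (simp add: unit_l_eq_r unit_r_tensor[symmetric] comp_assoc)
qed

text \<open>In the next two lemmas the four factors form two columns, and one of the columns consists of units.
  The interchange then separates it off.\<close>

lemma mid_right_units: "(\<one> (A \<odot> B) \<otimes> r \<I>) \<cdot> mid A \<I> B \<I> \<cdot> (r' A \<otimes> r' B) = r' (A \<odot> B)"
proof -
  have "(\<one> (A \<odot> B) \<otimes> l \<I>) \<cdot> mid A \<I> B \<I> = a A B \<I> \<cdot> (\<one> A \<otimes> ((\<one> B \<otimes> l \<I>) \<cdot> swap \<I> B \<I>)) \<cdot> a' A \<I> (B \<odot> \<I>)"
    using a_nat[of "\<one> A" "\<one> B" "l \<I>", THEN comp_extend] by (simp add: mid_def comp_assoc whisker_left)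
  also have "\<dots> = a A B \<I> \<cdot> ((r A \<otimes> \<one> (B \<odot> \<I>)) \<cdot> a A \<I> (B \<odot> \<I>)) \<cdot> a' A \<I> (B \<odot> \<I>)"
    by (simp only: swap_l triangle)
  also have "\<dots> = a A B \<I> \<cdot> (r A \<otimes> \<one> (B \<odot> \<I>))"
    by (simp add: comp_assoc)
  finally have "(\<one> (A \<odot> B) \<otimes> l \<I>) \<cdot> mid A \<I> B \<I> \<cdot> (r' A \<otimes> r' B) = a A B \<I> \<cdot> (\<one> A \<otimes> r' B)"
    using interchange[of "r A" "r' A" "\<one> (B \<odot> \<I>)" "r' B"] by (metis comp_assoc ident_comp r_inv(2) structural_types(10))
  also have "\<dots> = r' (A \<odot> B)"
    by (rule inverse_cancel_left[of "r (A \<odot> B)" "r' (A \<odot> B)"])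
      (auto simp: unit_r_tensor[THEN comp_extend, unfolded comp_assoc] whisker_left[symmetric])
  finally show ?thesis by (simp only: unit_l_eq_r)
qed

lemma mid_left_units: "(r \<I> \<otimes> \<one> (A \<odot> B)) \<cdot> mid \<I> A \<I> B \<cdot> (l' A \<otimes> l' B) = l' (A \<odot> B)"
proof -
  have "(r \<I> \<otimes> \<one> (A \<odot> B)) \<cdot> mid \<I> A \<I> B = (\<one> \<I> \<otimes> (l (A \<odot> B) \<cdot> swap A \<I> B)) \<cdot> a' \<I> A (\<I> \<odot> B)"
    using triangle[of \<I> "A \<odot> B", THEN comp_extend] by (simp add: mid_def comp_assoc whisker_left)
  also have "\<dots> = a' \<I> A B \<cdot> (\<one> (\<I> \<odot> A) \<otimes> l B)"
    using a'_nat_right[of "l B" _ _ \<I> A] by (simp add: l_swap)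
  finally have "(r \<I> \<otimes> \<one> (A \<odot> B)) \<cdot> mid \<I> A \<I> B \<cdot> (l' A \<otimes> l' B) = a' \<I> A B \<cdot> (l' A \<otimes> \<one> B)"
    using interchange[of "\<one> (\<I> \<odot> A)" "l' A" "l B" "l' B"] by (metis comp_assoc ident_comp l_inv(2) structural_types(14))
  also have "\<dots> = l' (A \<odot> B)"
    by (rule inverse_cong[OF unit_l_tensor[symmetric]]) (auto intro!: inverse_comp inverse_tensor)
  finally show ?thesis .
qed

text \<open>The exchange in the middle is the symmetry of the unit with itself, which is an identity.\<close>

lemma mid_inner_units: "mid A \<I> \<I> B = \<one> ((A \<odot> \<I>) \<odot> (\<I> \<odot> B))"
  by (simp add: mid_def swap_def s_unit)

end

section \<open>The syntactic category as an algebra\<close>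

primrec src :: "'p arrow_term \<Rightarrow> 'p form" where
  "src (Ident A) = A"
| "src (AlphaOrR A B C) = A \<or>\<^sub>f (B \<or>\<^sub>f C)"
| "src (AlphaOrL A B C) = (A \<or>\<^sub>f B) \<or>\<^sub>f C"
| "src (SigmaOr A B) = A \<or>\<^sub>f B"
| "src (RhoOrR A) = A \<or>\<^sub>f \<bottom>\<^sub>f"
| "src (RhoOrL A) = A"
| "src (LambdaOrR A) = \<bottom>\<^sub>f \<or>\<^sub>f A"
| "src (LambdaOrL A) = A"
| "src (AlphaAndR A B C) = A \<and>\<^sub>f (B \<and>\<^sub>f C)"
| "src (AlphaAndL A B C) = (A \<and>\<^sub>f B) \<and>\<^sub>f C"
| "src (SigmaAnd A B) = A \<and>\<^sub>f B"
| "src (RhoAndR A) = A \<and>\<^sub>f \<top>\<^sub>f"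
| "src (RhoAndL A) = A"
| "src (LambdaAndR A) = \<top>\<^sub>f \<and>\<^sub>f A"
| "src (LambdaAndL A) = A"
| "src (Iota A B C D) = (A \<and>\<^sub>f B) \<or>\<^sub>f (C \<and>\<^sub>f D)"
| "src BetaR = \<bottom>\<^sub>f \<and>\<^sub>f \<bottom>\<^sub>f"
| "src BetaL = \<bottom>\<^sub>f"
| "src TauR = \<top>\<^sub>f \<or>\<^sub>f \<top>\<^sub>f"
| "src TauL = \<top>\<^sub>f"
| "src Kappa = \<bottom>\<^sub>f"
| "src (g \<circ>\<^sub>a f) = src f"
| "src (f \<or>\<^sub>a g) = src f \<or>\<^sub>f src g"
| "src (f \<and>\<^sub>a g) = src f \<and>\<^sub>f src g"

primrec tgt :: "'p arrow_term \<Rightarrow> 'p form" where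
  "tgt (Ident A) = A"
| "tgt (AlphaOrR A B C) = (A \<or>\<^sub>f B) \<or>\<^sub>f C"
| "tgt (AlphaOrL A B C) = A \<or>\<^sub>f (B \<or>\<^sub>f C)"
| "tgt (SigmaOr A B) = B \<or>\<^sub>f A"
| "tgt (RhoOrR A) = A"
| "tgt (RhoOrL A) = A \<or>\<^sub>f \<bottom>\<^sub>f"
| "tgt (LambdaOrR A) = A"
| "tgt (LambdaOrL A) = \<bottom>\<^sub>f \<or>\<^sub>f A"
| "tgt (AlphaAndR A B C) = (A \<and>\<^sub>f B) \<and>\<^sub>f C"
| "tgt (AlphaAndL A B C) = A \<and>\<^sub>f (B \<and>\<^sub>f C)"
| "tgt (SigmaAnd A B) = B \<and>\<^sub>f A"
| "tgt (RhoAndR A) = A"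
| "tgt (RhoAndL A) = A \<and>\<^sub>f \<top>\<^sub>f"
| "tgt (LambdaAndR A) = A"
| "tgt (LambdaAndL A) = \<top>\<^sub>f \<and>\<^sub>f A"
| "tgt (Iota A B C D) = (A \<or>\<^sub>f C) \<and>\<^sub>f (B \<or>\<^sub>f D)"
| "tgt BetaR = \<bottom>\<^sub>f"
| "tgt BetaL = \<bottom>\<^sub>f \<and>\<^sub>f \<bottom>\<^sub>f"
| "tgt TauR = \<top>\<^sub>f"
| "tgt TauL = \<top>\<^sub>f \<or>\<^sub>f \<top>\<^sub>f"
| "tgt Kappa = \<top>\<^sub>f"
| "tgt (g \<circ>\<^sub>a f) = tgt g"
| "tgt (f \<or>\<^sub>a g) = tgt f \<or>\<^sub>f tgt g"
| "tgt (f \<and>\<^sub>a g) = tgt f \<and>\<^sub>f tgt g"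

definition typed :: "'p arrow_term \<Rightarrow> bool" where
  "typed f \<longleftrightarrow> f \<turnstile> src f \<rightarrow> tgt f"

lemma has_type_src_tgt: "f \<turnstile> A \<rightarrow> B \<Longrightarrow> src f = A \<and> tgt f = B"
  by (induction rule: has_type.induct) simp_all

lemma has_type_iff_typed: "f \<turnstile> A \<rightarrow> B \<longleftrightarrow> typed f \<and> src f = A \<and> tgt f = B"
  using has_type_src_tgt by (auto simp: typed_def)

lemma typed_simps [simp]:
  "typed (Ident A)" "typed (AlphaOrR A B C)" "typed (AlphaOrL A B C)" "typed (SigmaOr A B)"
  "typed (RhoOrR A)" "typed (RhoOrL A)" "typed (LambdaOrR A)" "typed (LambdaOrL A)"
  "typed (AlphaAndR A B C)" "typed (AlphaAndL A B C)" "typed (SigmaAnd A B)"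
  "typed (RhoAndR A)" "typed (RhoAndL A)" "typed (LambdaAndR A)" "typed (LambdaAndL A)"
  "typed (Iota A B C D)" "typed BetaR" "typed BetaL" "typed TauR" "typed TauL" "typed Kappa"
  "typed (g \<circ>\<^sub>a f) \<longleftrightarrow> typed f \<and> typed g \<and> tgt f = src g"
  "typed (f \<or>\<^sub>a g) \<longleftrightarrow> typed f \<and> typed g"
  "typed (f \<and>\<^sub>a g) \<longleftrightarrow> typed f \<and> typed g"
  by (auto simp: typed_def has_type_simps dest: has_type_src_tgt)

text \<open>Arrow equality extended to untyped terms. All untyped terms with the same formal source and target
  are related, which keeps the relation a congruence for the total operations on terms and makes the
  categorical laws hold for them too.\<close>

definition aeq :: "'p arrow_term \<Rightarrow> 'p arrow_term \<Rightarrow> bool" where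
  "aeq f g \<longleftrightarrow> f \<approx> g \<or> (\<not> typed f \<and> \<not> typed g \<and> src f = src g \<and> tgt f = tgt g)"

lemma arrow_eq_types: "f \<approx> g \<Longrightarrow> typed f \<and> typed g \<and> src f = src g \<and> tgt f = tgt g"
  by (auto dest!: arrow_eq_typed simp: has_type_iff_typed)

lemma aeq_types: "aeq f g \<Longrightarrow> (typed f \<longleftrightarrow> typed g) \<and> src f = src g \<and> tgt f = tgt g"
  by (auto simp: aeq_def dest: arrow_eq_types)

lemma aeqI:
  assumes "src f = src g" "tgt f = tgt g" "typed f \<longleftrightarrow> typed g" "typed f \<Longrightarrow> f \<approx> g"
  shows "aeq f g"
  using assms by (auto simp: aeq_def)

lemma aeq_refl: "aeq f f"
  by (rule aeqI) (auto simp: typed_def intro: arrow_eq.refl)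

lemma aeqD: "aeq f g \<Longrightarrow> typed f \<Longrightarrow> f \<approx> g"
  by (auto simp: aeq_def)

quotient_type 'p arrow = "'p arrow_term" / aeq
proof (rule equivpI)
  show "reflp aeq"
    by (rule reflpI, rule aeq_refl)
  show "symp aeq"
    by (rule sympI) (auto simp: aeq_def intro: arrow_eq.sym)
  show "transp aeq"
    by (rule transpI) (auto simp: aeq_def intro: arrow_eq.trans dest: arrow_eq_types)
qed

lift_definition cls :: "'p arrow_term \<Rightarrow> 'p arrow" is "\<lambda>f. f" .

lift_definition asrc :: "'p arrow \<Rightarrow> 'p form" is src by (simp add: aeq_types)
lift_definition atgt :: "'p arrow \<Rightarrow> 'p form" is tgt by (simp add: aeq_types)

lift_definition acomp :: "'p arrow \<Rightarrow> 'p arrow \<Rightarrow> 'p arrow" (infixr "\<cdot>" 65) is Comp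
proof -
  fix g g' f f' :: "'p arrow_term"
  assume eq: "aeq g g'" "aeq f f'"
  then show "aeq (g \<circ>\<^sub>a f) (g' \<circ>\<^sub>a f')"
    using eq[THEN aeq_types]
    by (intro aeqI) (auto dest: aeqD intro!: arrow_eq.comp_cong[unfolded has_type_iff_typed])
qed

lift_definition adisj :: "'p arrow \<Rightarrow> 'p arrow \<Rightarrow> 'p arrow" (infixr "\<squnion>" 70) is DisjA
  by (rule aeqI) (auto dest: aeq_types aeqD intro: arrow_eq.disj_cong)

lift_definition aconj :: "'p arrow \<Rightarrow> 'p arrow \<Rightarrow> 'p arrow" (infixr "\<sqinter>" 75) is ConjA
  by (rule aeqI) (auto dest: aeq_types aeqD intro: arrow_eq.conj_cong)

abbreviation aid :: "'p form \<Rightarrow> 'p arrow" ("\<one>") where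
  "\<one> A \<equiv> cls (Ident A)"

lemma cls_operations [simp]:
  "cls (g \<circ>\<^sub>a f) = cls g \<cdot> cls f" "cls (f \<or>\<^sub>a g) = cls f \<squnion> cls g" "cls (f \<and>\<^sub>a g) = cls f \<sqinter> cls g"
  "asrc (cls f) = src f" "atgt (cls f) = tgt f"
  by (transfer, rule aeq_refl)+ (transfer, rule HOL.refl)+

lemma asrc_atgt [simp]:
  "asrc (g \<cdot> f) = asrc f" "atgt (g \<cdot> f) = atgt g"
  "asrc (f \<squnion> g) = asrc f \<or>\<^sub>f asrc g" "atgt (f \<squnion> g) = atgt f \<or>\<^sub>f atgt g"
  "asrc (f \<sqinter> g) = asrc f \<and>\<^sub>f asrc g" "atgt (f \<sqinter> g) = atgt f \<and>\<^sub>f atgt g"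
  by (transfer, simp)+

lemma cls_eqI: "f \<approx> g \<Longrightarrow> cls f = cls g"
  by transfer (simp add: aeq_def)

lemma cls_eqD: "cls f = cls g \<Longrightarrow> f \<turnstile> A \<rightarrow> B \<Longrightarrow> f \<approx> g"
  by transfer (auto simp: aeqD has_type_iff_typed)

interpretation Arr: formal_category asrc atgt aid acomp
proof
  fix f g h :: "'p arrow" and A
  show "(h \<cdot> g) \<cdot> f = h \<cdot> (g \<cdot> f)"
    by (transfer, rule aeqI) (auto intro: arrow_eq.sym[OF arrow_eq.comp_assoc[unfolded has_type_iff_typed]])
  show "f \<cdot> \<one> A = f" if "asrc f = A"
    using that by (transfer, intro aeqI) (auto intro: arrow_eq.comp_id[unfolded has_type_iff_typed])
  show "\<one> A \<cdot> f = f" if "atgt f = A"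
    using that by (transfer, intro aeqI) (auto intro: arrow_eq.id_comp[unfolded has_type_iff_typed])
qed simp_all

text \<open>The naturality laws hold for all classes: if one of the arrows is untyped, both sides are untyped
  and agree in source and target.\<close>

interpretation Or: symmetric_monoidal asrc atgt aid acomp Disj Bot adisj
  "\<lambda>A B C. cls (AlphaOrR A B C)" "\<lambda>A B C. cls (AlphaOrL A B C)" "\<lambda>A B. cls (SigmaOr A B)"
  "\<lambda>A. cls (RhoOrR A)" "\<lambda>A. cls (RhoOrL A)" "\<lambda>A. cls (LambdaOrR A)" "\<lambda>A. cls (LambdaOrL A)"
proof
  fix f g h k :: "'p arrow"
  show "(g \<cdot> f) \<squnion> (k \<cdot> h) = (g \<squnion> k) \<cdot> (f \<squnion> h)"
    by (transfer, rule aeqI) (auto intro: arrow_eq.disj_comp[unfolded has_type_iff_typed])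
  show "cls (AlphaOrR (atgt f) (atgt g) (atgt h)) \<cdot> (f \<squnion> (g \<squnion> h))
      = ((f \<squnion> g) \<squnion> h) \<cdot> cls (AlphaOrR (asrc f) (asrc g) (asrc h))"
    by (transfer, rule aeqI) (auto intro: arrow_eq.alpha_or_nat[unfolded has_type_iff_typed])
  show "cls (SigmaOr (atgt f) (atgt g)) \<cdot> (f \<squnion> g) = (g \<squnion> f) \<cdot> cls (SigmaOr (asrc f) (asrc g))"
    by (transfer, rule aeqI) (auto intro: arrow_eq.sigma_or_nat[unfolded has_type_iff_typed])
  show "cls (RhoOrR (atgt f)) \<cdot> (f \<squnion> \<one> \<bottom>\<^sub>f) = f \<cdot> cls (RhoOrR (asrc f))"
    by (transfer, rule aeqI) (auto intro: arrow_eq.rho_or_nat[unfolded has_type_iff_typed])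
  show "cls (LambdaOrR (atgt f)) \<cdot> (\<one> \<bottom>\<^sub>f \<squnion> f) = f \<cdot> cls (LambdaOrR (asrc f))"
    by (transfer, rule aeqI) (auto intro: arrow_eq.lambda_or_nat[unfolded has_type_iff_typed])
qed (simp_all only: cls_operations(1-3)[symmetric] cls_operations(4,5) asrc_atgt src.simps tgt.simps,
  (rule cls_eqI, rule arrow_eq.intros(10-))+)

interpretation And: symmetric_monoidal asrc atgt aid acomp Conj Top aconj
  "\<lambda>A B C. cls (AlphaAndR A B C)" "\<lambda>A B C. cls (AlphaAndL A B C)" "\<lambda>A B. cls (SigmaAnd A B)"
  "\<lambda>A. cls (RhoAndR A)" "\<lambda>A. cls (RhoAndL A)" "\<lambda>A. cls (LambdaAndR A)" "\<lambda>A. cls (LambdaAndL A)"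
proof
  fix f g h k :: "'p arrow"
  show "(g \<cdot> f) \<sqinter> (k \<cdot> h) = (g \<sqinter> k) \<cdot> (f \<sqinter> h)"
    by (transfer, rule aeqI) (auto intro: arrow_eq.conj_comp[unfolded has_type_iff_typed])
  show "cls (AlphaAndR (atgt f) (atgt g) (atgt h)) \<cdot> (f \<sqinter> (g \<sqinter> h))
      = ((f \<sqinter> g) \<sqinter> h) \<cdot> cls (AlphaAndR (asrc f) (asrc g) (asrc h))"
    by (transfer, rule aeqI) (auto intro: arrow_eq.alpha_and_nat[unfolded has_type_iff_typed])
  show "cls (SigmaAnd (atgt f) (atgt g)) \<cdot> (f \<sqinter> g) = (g \<sqinter> f) \<cdot> cls (SigmaAnd (asrc f) (asrc g))"
    by (transfer, rule aeqI) (auto intro: arrow_eq.sigma_and_nat[unfolded has_type_iff_typed])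
  show "cls (RhoAndR (atgt f)) \<cdot> (f \<sqinter> \<one> \<top>\<^sub>f) = f \<cdot> cls (RhoAndR (asrc f))"
    by (transfer, rule aeqI) (auto intro: arrow_eq.rho_and_nat[unfolded has_type_iff_typed])
  show "cls (LambdaAndR (atgt f)) \<cdot> (\<one> \<top>\<^sub>f \<sqinter> f) = f \<cdot> cls (LambdaAndR (asrc f))"
    by (transfer, rule aeqI) (auto intro: arrow_eq.lambda_and_nat[unfolded has_type_iff_typed])
qed (simp_all only: cls_operations(1-3)[symmetric] cls_operations(4,5) asrc_atgt src.simps tgt.simps,
  (rule cls_eqI, rule arrow_eq.intros(10-))+)

lemma iota_natural:
  "cls (Iota (atgt f) (atgt g) (atgt h) (atgt k)) \<cdot> ((f \<sqinter> g) \<squnion> (h \<sqinter> k))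
    = ((f \<squnion> h) \<sqinter> (g \<squnion> k)) \<cdot> cls (Iota (asrc f) (asrc g) (asrc h) (asrc k))"
  by (transfer, rule aeqI) (auto intro: arrow_eq.iota_nat[unfolded has_type_iff_typed])

lemma inverse_beta [simp, intro]: "Arr.inverse (cls BetaL) (cls BetaR)" "Arr.inverse (cls BetaR) (cls BetaL)"
  using arrow_eq.beta_LR[THEN cls_eqI] arrow_eq.beta_RL[THEN cls_eqI]
  by (auto simp: Arr.inverse_def)

lemma inverse_tau [simp, intro]: "Arr.inverse (cls TauR) (cls TauL)" "Arr.inverse (cls TauL) (cls TauR)"
  using arrow_eq.tau_LR[THEN cls_eqI] arrow_eq.tau_RL[THEN cls_eqI]
  by (auto simp: Arr.inverse_def)

lemmas SMI1 = arrow_eq.smi1[THEN cls_eqI, unfolded cls_operations]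
lemmas SMI2 = arrow_eq.smi2[THEN cls_eqI, unfolded cls_operations]
lemmas SMI3 = arrow_eq.smi3[THEN cls_eqI, unfolded cls_operations]
lemmas SMI4 = arrow_eq.smi4[THEN cls_eqI, unfolded cls_operations]
lemmas SMI5 = arrow_eq.smi5[THEN cls_eqI, unfolded cls_operations]
lemmas SMI6 = arrow_eq.smi6[THEN cls_eqI, unfolded cls_operations]
lemmas SMI7 = arrow_eq.smi7[THEN cls_eqI, unfolded cls_operations]
lemmas SMI8 = arrow_eq.smi8[THEN cls_eqI, unfolded cls_operations]
lemmas SMI9 = arrow_eq.smi9[THEN cls_eqI, unfolded cls_operations]
lemmas SMI10 = arrow_eq.smi10[THEN cls_eqI, unfolded cls_operations]
lemmas SMI11 = arrow_eq.smi11[THEN cls_eqI, unfolded cls_operations]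
lemmas SMI12 = arrow_eq.smi12[THEN cls_eqI, unfolded cls_operations]

section \<open>Consequences of the SMI equations\<close>

text \<open>Structural arrows are abbreviated by a letter for the family (associator, symmetry, right and left
  unit) followed by \<open>O\<close> for disjunction or \<open>A\<close> for conjunction; a prime marks the inverse.
  The inverse of \<open>be\<close>, which points away from \<open>\<bottom>\<close>, is \<open>be'\<close>.\<close>

abbreviation aO where "aO A B C \<equiv> cls (AlphaOrR A B C)"
abbreviation aO' where "aO' A B C \<equiv> cls (AlphaOrL A B C)"
abbreviation sO where "sO A B \<equiv> cls (SigmaOr A B)"
abbreviation rO where "rO A \<equiv> cls (RhoOrR A)"
abbreviation rO' where "rO' A \<equiv> cls (RhoOrL A)"
abbreviation lO where "lO A \<equiv> cls (LambdaOrR A)"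
abbreviation lO' where "lO' A \<equiv> cls (LambdaOrL A)"
abbreviation aA where "aA A B C \<equiv> cls (AlphaAndR A B C)"
abbreviation aA' where "aA' A B C \<equiv> cls (AlphaAndL A B C)"
abbreviation sA where "sA A B \<equiv> cls (SigmaAnd A B)"
abbreviation rA where "rA A \<equiv> cls (RhoAndR A)"
abbreviation rA' where "rA' A \<equiv> cls (RhoAndL A)"
abbreviation lA where "lA A \<equiv> cls (LambdaAndR A)"
abbreviation lA' where "lA' A \<equiv> cls (LambdaAndL A)"
abbreviation io where "io A B C D \<equiv> cls (Iota A B C D)"
abbreviation be where "be \<equiv> cls BetaL"
abbreviation be' where "be' \<equiv> cls BetaR"
abbreviation ta where "ta \<equiv> cls TauR"
abbreviation ta' where "ta' \<equiv> cls TauL"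
abbreviation ka where "ka \<equiv> cls Kappa"

lemmas comp_assoc = Arr.comp_assoc
lemmas extend = Arr.comp_extend

lemma be_inv [simp]: "be' \<cdot> be = \<one> \<bottom>\<^sub>f" "be \<cdot> be' = \<one> (\<bottom>\<^sub>f \<and>\<^sub>f \<bottom>\<^sub>f)"
  using inverse_beta by (auto simp: Arr.inverse_def)
lemma ta_inv [simp]: "ta \<cdot> ta' = \<one> \<top>\<^sub>f" "ta' \<cdot> ta = \<one> (\<top>\<^sub>f \<or>\<^sub>f \<top>\<^sub>f)"
  using inverse_tau by (auto simp: Arr.inverse_def)

text \<open>In this lemma and the following ones the SMI equations are solved for inverse structural arrows, or
  reflected by a symmetry.\<close>

lemma iota_aA': "aA' (A \<or>\<^sub>f D) (B \<or>\<^sub>f E) (C \<or>\<^sub>f F) \<cdot> (io A B D E \<sqinter> \<one> (C \<or>\<^sub>f F)) \<cdot> io (A \<and>\<^sub>f B) C (D \<and>\<^sub>f E) F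
    = (\<one> (A \<or>\<^sub>f D) \<sqinter> io B C E F) \<cdot> io A (B \<and>\<^sub>f C) D (E \<and>\<^sub>f F) \<cdot> (aA' A B C \<squnion> aA' D E F)"
proof -
  have "Arr.inverse (aA A B C \<squnion> aA D E F) (aA' A B C \<squnion> aA' D E F)"
    by (auto intro!: Or.inverse_tensor)
  from Arr.inverse_transpose[OF _ And.inverse_structural(1) this, of "A \<or>\<^sub>f D" "B \<or>\<^sub>f E" "C \<or>\<^sub>f F"
      "(\<one> (A \<or>\<^sub>f D) \<sqinter> io B C E F) \<cdot> io A (B \<and>\<^sub>f C) D (E \<and>\<^sub>f F)"
      "(io A B D E \<sqinter> \<one> (C \<or>\<^sub>f F)) \<cdot> io (A \<and>\<^sub>f B) C (D \<and>\<^sub>f E) F"]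
  show ?thesis by (simp add: SMI7 comp_assoc)
qed

lemma iota_aO': "io A D (B \<or>\<^sub>f C) (E \<or>\<^sub>f F) \<cdot> (\<one> (A \<and>\<^sub>f D) \<squnion> io B E C F) \<cdot> aO' (A \<and>\<^sub>f D) (B \<and>\<^sub>f E) (C \<and>\<^sub>f F)
    = (aO' A B C \<sqinter> aO' D E F) \<cdot> io (A \<or>\<^sub>f B) (D \<or>\<^sub>f E) C F \<cdot> (io A D B E \<squnion> \<one> (C \<and>\<^sub>f F))"
proof -
  have "Arr.inverse (aO A B C \<sqinter> aO D E F) (aO' A B C \<sqinter> aO' D E F)"
    by (auto intro!: And.inverse_tensor)
  from Arr.inverse_transpose[OF _ this Or.inverse_structural(1), of
      "io A D (B \<or>\<^sub>f C) (E \<or>\<^sub>f F) \<cdot> (\<one> (A \<and>\<^sub>f D) \<squnion> io B E C F)"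
      "io (A \<or>\<^sub>f B) (D \<or>\<^sub>f E) C F \<cdot> (io A D B E \<squnion> \<one> (C \<and>\<^sub>f F))" "A \<and>\<^sub>f D" "B \<and>\<^sub>f E" "C \<and>\<^sub>f F"]
  show ?thesis by (simp add: SMI1[symmetric] comp_assoc)
qed

lemma beta_aA': "aA' \<bottom>\<^sub>f \<bottom>\<^sub>f \<bottom>\<^sub>f \<cdot> (be \<sqinter> \<one> \<bottom>\<^sub>f) \<cdot> be = (\<one> \<bottom>\<^sub>f \<sqinter> be) \<cdot> be"
  by (simp add: SMI8[symmetric])

lemma tau_aO': "ta \<cdot> (\<one> \<top>\<^sub>f \<squnion> ta) \<cdot> aO' \<top>\<^sub>f \<top>\<^sub>f \<top>\<^sub>f = ta \<cdot> (ta \<squnion> \<one> \<top>\<^sub>f)"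
  using SMI4[THEN extend, of "aO' \<top>\<^sub>f \<top>\<^sub>f \<top>\<^sub>f", symmetric] by (simp add: comp_assoc)

lemma iota_rA': "(\<one> (A \<or>\<^sub>f B) \<sqinter> ta) \<cdot> io A \<top>\<^sub>f B \<top>\<^sub>f \<cdot> (rA' A \<squnion> rA' B) = rA' (A \<or>\<^sub>f B)"
proof -
  have "Arr.inverse (rA A \<squnion> rA B) (rA' A \<squnion> rA' B)"
    by (auto intro!: Or.inverse_tensor)
  from Arr.inverse_transpose[OF _ And.inverse_structural(4) this, of "A \<or>\<^sub>f B"
      "(\<one> (A \<or>\<^sub>f B) \<sqinter> ta) \<cdot> io A \<top>\<^sub>f B \<top>\<^sub>f" "\<one> (A \<or>\<^sub>f B)"]
  show ?thesis by (simp add: SMI11 comp_assoc)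
qed

lemma iota_lA: "lA (A \<or>\<^sub>f B) \<cdot> (ta \<sqinter> \<one> (A \<or>\<^sub>f B)) \<cdot> io \<top>\<^sub>f A \<top>\<^sub>f B = lA A \<squnion> lA B"
proof -
  have "lA (A \<or>\<^sub>f B) \<cdot> (ta \<sqinter> \<one> (A \<or>\<^sub>f B)) \<cdot> io \<top>\<^sub>f A \<top>\<^sub>f B
      = rA (A \<or>\<^sub>f B) \<cdot> (sA \<top>\<^sub>f (A \<or>\<^sub>f B) \<cdot> (ta \<sqinter> \<one> (A \<or>\<^sub>f B))) \<cdot> io \<top>\<^sub>f A \<top>\<^sub>f B"
    by (simp add: And.unit_s[symmetric] comp_assoc)
  also have "\<dots> = rA (A \<or>\<^sub>f B) \<cdot> (\<one> (A \<or>\<^sub>f B) \<sqinter> ta) \<cdot> sA (\<top>\<^sub>f \<or>\<^sub>f \<top>\<^sub>f) (A \<or>\<^sub>f B) \<cdot> io \<top>\<^sub>f A \<top>\<^sub>f B"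
    using And.s_nat[of ta "\<one> (A \<or>\<^sub>f B)"] by (simp add: comp_assoc)
  also have "\<dots> = (rA (A \<or>\<^sub>f B) \<cdot> (\<one> (A \<or>\<^sub>f B) \<sqinter> ta) \<cdot> io A \<top>\<^sub>f B \<top>\<^sub>f) \<cdot> (sA \<top>\<^sub>f A \<squnion> sA \<top>\<^sub>f B)"
    by (simp only: SMI9 comp_assoc)
  also have "\<dots> = lA A \<squnion> lA B"
    by (simp only: SMI11 Or.interchange[symmetric] And.unit_s)
  finally show ?thesis .
qed

lemma iota_lA': "(ta \<sqinter> \<one> (A \<or>\<^sub>f B)) \<cdot> io \<top>\<^sub>f A \<top>\<^sub>f B \<cdot> (lA' A \<squnion> lA' B) = lA' (A \<or>\<^sub>f B)"
proof -
  have "Arr.inverse (lA A \<squnion> lA B) (lA' A \<squnion> lA' B)"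
    by (auto intro!: Or.inverse_tensor)
  from Arr.inverse_transpose[OF _ And.inverse_structural(6) this, of "A \<or>\<^sub>f B"
      "(ta \<sqinter> \<one> (A \<or>\<^sub>f B)) \<cdot> io \<top>\<^sub>f A \<top>\<^sub>f B" "\<one> (A \<or>\<^sub>f B)"]
  show ?thesis by (simp add: iota_lA comp_assoc)
qed

lemma iota_rO': "io A B \<bottom>\<^sub>f \<bottom>\<^sub>f \<cdot> (\<one> (A \<and>\<^sub>f B) \<squnion> be) \<cdot> rO' (A \<and>\<^sub>f B) = rO' A \<sqinter> rO' B"
proof -
  have "Arr.inverse (rO A \<sqinter> rO B) (rO' A \<sqinter> rO' B)"
    by (auto intro!: And.inverse_tensor)
  from Arr.inverse_transpose[OF _ this Or.inverse_structural(4), of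
      "io A B \<bottom>\<^sub>f \<bottom>\<^sub>f \<cdot> (\<one> (A \<and>\<^sub>f B) \<squnion> be)" "\<one> (A \<and>\<^sub>f B)" "A \<and>\<^sub>f B"]
  show ?thesis by (simp add: SMI3 comp_assoc)
qed

lemma iota_lO: "(lO A \<sqinter> lO B) \<cdot> io \<bottom>\<^sub>f \<bottom>\<^sub>f A B \<cdot> (be \<squnion> \<one> (A \<and>\<^sub>f B)) = lO (A \<and>\<^sub>f B)"
proof -
  have "(lO A \<sqinter> lO B) \<cdot> io \<bottom>\<^sub>f \<bottom>\<^sub>f A B \<cdot> (be \<squnion> \<one> (A \<and>\<^sub>f B))
      = (rO A \<sqinter> rO B) \<cdot> ((sO \<bottom>\<^sub>f A \<sqinter> sO \<bottom>\<^sub>f B) \<cdot> io \<bottom>\<^sub>f \<bottom>\<^sub>f A B) \<cdot> (be \<squnion> \<one> (A \<and>\<^sub>f B))"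
    by (simp only: And.interchange Or.unit_s[symmetric] comp_assoc)
  also have "\<dots> = (rO A \<sqinter> rO B) \<cdot> io A B \<bottom>\<^sub>f \<bottom>\<^sub>f \<cdot> (sO (\<bottom>\<^sub>f \<and>\<^sub>f \<bottom>\<^sub>f) (A \<and>\<^sub>f B) \<cdot> (be \<squnion> \<one> (A \<and>\<^sub>f B)))"
    by (simp only: SMI2[symmetric] comp_assoc)
  also have "\<dots> = ((rO A \<sqinter> rO B) \<cdot> io A B \<bottom>\<^sub>f \<bottom>\<^sub>f \<cdot> (\<one> (A \<and>\<^sub>f B) \<squnion> be)) \<cdot> sO \<bottom>\<^sub>f (A \<and>\<^sub>f B)"
    using Or.s_nat[of be "\<one> (A \<and>\<^sub>f B)"] by (simp add: comp_assoc)
  also have "\<dots> = lO (A \<and>\<^sub>f B)"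
    by (simp only: SMI3 Or.unit_s)
  finally show ?thesis .
qed

lemma beta_kappa: "(\<one> \<bottom>\<^sub>f \<sqinter> ka) \<cdot> be = (rA' \<bottom>\<^sub>f :: 'p arrow)"
proof -
  have "rA' \<bottom>\<^sub>f \<cdot> rA \<bottom>\<^sub>f \<cdot> (\<one> \<bottom>\<^sub>f \<sqinter> ka) \<cdot> be = (rA' \<bottom>\<^sub>f :: 'p arrow)"
    by (simp only: SMI12) simp
  then show ?thesis by simp
qed

text \<open>This is naturality of \<open>split\<close> at \<open>\<kappa>\<close>.\<close>

lemma kappa_beta: "(ka \<sqinter> ka) \<cdot> be = rA' \<top>\<^sub>f \<cdot> (ka :: 'p arrow)"
  using And.r'_nat[of "ka :: 'p arrow"] And.interchange[of "ka :: 'p arrow" "\<one> \<bottom>\<^sub>f" "\<one> \<top>\<^sub>f" ka, THEN extend, of be]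
  by (simp add: comp_assoc beta_kappa)

lemma iota_nat_left:
  "io (atgt f) B (atgt g) D \<cdot> ((f \<sqinter> \<one> B) \<squnion> (g \<sqinter> \<one> D))
    = ((f \<squnion> g) \<sqinter> \<one> (B \<or>\<^sub>f D)) \<cdot> io (asrc f) B (asrc g) D"
  using iota_natural[of f "\<one> B" g "\<one> D"] by simp

lemma iota_nat_right:
  "io A (atgt f) C (atgt g) \<cdot> ((\<one> A \<sqinter> f) \<squnion> (\<one> C \<sqinter> g))
    = (\<one> (A \<or>\<^sub>f C) \<sqinter> (f \<squnion> g)) \<cdot> io A (asrc f) C (asrc g)"
  using iota_natural[of "\<one> A" f "\<one> C" g] by simp

text \<open>\<open>\<iota>\<close> commutes with the exchange of \<open>\<and>\<close>-factors: the seventh SMI equation moves the brackets on both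
  sides of the exchange, and the ninth moves the symmetry through \<open>\<iota>\<close>.\<close>

lemma iota_swap:
  "And.swap (A \<or>\<^sub>f D) (B \<or>\<^sub>f E) (C \<or>\<^sub>f F) \<cdot> (\<one> (A \<or>\<^sub>f D) \<sqinter> io B C E F) \<cdot> io A (B \<and>\<^sub>f C) D (E \<and>\<^sub>f F)
    = (\<one> (B \<or>\<^sub>f E) \<sqinter> io A C D F) \<cdot> io B (A \<and>\<^sub>f C) E (D \<and>\<^sub>f F) \<cdot> (And.swap A B C \<squnion> And.swap D E F)"
proof -
  let ?X = "\<one> (C \<or>\<^sub>f F)"
  have "And.swap (A \<or>\<^sub>f D) (B \<or>\<^sub>f E) (C \<or>\<^sub>f F) \<cdot> (\<one> (A \<or>\<^sub>f D) \<sqinter> io B C E F) \<cdot> io A (B \<and>\<^sub>f C) D (E \<and>\<^sub>f F)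
      = aA' (B \<or>\<^sub>f E) (A \<or>\<^sub>f D) (C \<or>\<^sub>f F) \<cdot> ((sA (A \<or>\<^sub>f D) (B \<or>\<^sub>f E) \<cdot> io A B D E) \<sqinter> ?X)
        \<cdot> io (A \<and>\<^sub>f B) C (D \<and>\<^sub>f E) F \<cdot> (aA A B C \<squnion> aA D E F)"
    by (simp only: And.swap_def comp_assoc SMI7 And.whisker_right)
  also have "\<dots> = aA' (B \<or>\<^sub>f E) (A \<or>\<^sub>f D) (C \<or>\<^sub>f F) \<cdot> (io B A E D \<sqinter> ?X)
        \<cdot> (((sA A B \<squnion> sA D E) \<sqinter> ?X) \<cdot> io (A \<and>\<^sub>f B) C (D \<and>\<^sub>f E) F) \<cdot> (aA A B C \<squnion> aA D E F)"
    by (simp only: SMI9 And.whisker_right comp_assoc)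
  also have "\<dots> = (aA' (B \<or>\<^sub>f E) (A \<or>\<^sub>f D) (C \<or>\<^sub>f F) \<cdot> (io B A E D \<sqinter> ?X) \<cdot> io (B \<and>\<^sub>f A) C (E \<and>\<^sub>f D) F)
        \<cdot> ((sA A B \<sqinter> \<one> C) \<squnion> (sA D E \<sqinter> \<one> F)) \<cdot> (aA A B C \<squnion> aA D E F)"
    using iota_nat_left[of "sA A B" C "sA D E" F, THEN extend] by (simp add: comp_assoc)
  also have "\<dots> = (\<one> (B \<or>\<^sub>f E) \<sqinter> io A C D F) \<cdot> io B (A \<and>\<^sub>f C) E (D \<and>\<^sub>f F) \<cdot> (And.swap A B C \<squnion> And.swap D E F)"
    by (simp only: iota_aA' And.swap_def Or.interchange comp_assoc)
  finally show ?thesis .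
qed

text \<open>The interchange of \<open>\<iota>\<close> with the middle-four interchange, which is what makes \<open>split\<close> natural at
  \<open>\<iota>\<close>. Written through associators and one exchange, \<open>mid\<close> passes through \<open>\<iota>\<close> by the seventh equation,
  \<open>iota_swap\<close>, and the seventh equation once more.\<close>

lemma iota_mid:
  "And.mid (A1 \<or>\<^sub>f C1) (A2 \<or>\<^sub>f C2) (B1 \<or>\<^sub>f D1) (B2 \<or>\<^sub>f D2) \<cdot> (io A1 A2 C1 C2 \<sqinter> io B1 B2 D1 D2)
      \<cdot> io (A1 \<and>\<^sub>f A2) (B1 \<and>\<^sub>f B2) (C1 \<and>\<^sub>f C2) (D1 \<and>\<^sub>f D2)
    = (io A1 B1 C1 D1 \<sqinter> io A2 B2 C2 D2) \<cdot> io (A1 \<and>\<^sub>f B1) (A2 \<and>\<^sub>f B2) (C1 \<and>\<^sub>f D1) (C2 \<and>\<^sub>f D2)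
      \<cdot> (And.mid A1 A2 B1 B2 \<squnion> And.mid C1 C2 D1 D2)" (is "?lhs = ?rhs")
proof -
  let ?A1 = "A1 \<or>\<^sub>f C1" and ?A2 = "A2 \<or>\<^sub>f C2" and ?B1 = "B1 \<or>\<^sub>f D1" and ?B2 = "B2 \<or>\<^sub>f D2"
  let ?sA = "And.swap A2 B1 B2" and ?sC = "And.swap C2 D1 D2" and ?s = "And.swap ?A2 ?B1 ?B2"
  have "?lhs = aA ?A1 ?B1 (?A2 \<and>\<^sub>f ?B2) \<cdot> (\<one> ?A1 \<sqinter> ?s) \<cdot> (aA' ?A1 ?A2 (?B1 \<and>\<^sub>f ?B2)
      \<cdot> (\<one> (?A1 \<and>\<^sub>f ?A2) \<sqinter> io B1 B2 D1 D2)) \<cdot> (io A1 A2 C1 C2 \<sqinter> \<one> ((B1 \<and>\<^sub>f B2) \<or>\<^sub>f (D1 \<and>\<^sub>f D2)))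
      \<cdot> io (A1 \<and>\<^sub>f A2) (B1 \<and>\<^sub>f B2) (C1 \<and>\<^sub>f C2) (D1 \<and>\<^sub>f D2)"
    using And.tensor_split'[of "io A1 A2 C1 C2" "io B1 B2 D1 D2", THEN extend]
    by (simp add: And.mid_def comp_assoc)
  also have "\<dots> = aA ?A1 ?B1 (?A2 \<and>\<^sub>f ?B2) \<cdot> (\<one> ?A1 \<sqinter> ?s) \<cdot> (\<one> ?A1 \<sqinter> (\<one> ?A2 \<sqinter> io B1 B2 D1 D2))
      \<cdot> (aA' ?A1 ?A2 ((B1 \<and>\<^sub>f B2) \<or>\<^sub>f (D1 \<and>\<^sub>f D2)) \<cdot> (io A1 A2 C1 C2 \<sqinter> \<one> ((B1 \<and>\<^sub>f B2) \<or>\<^sub>f (D1 \<and>\<^sub>f D2)))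
        \<cdot> io (A1 \<and>\<^sub>f A2) (B1 \<and>\<^sub>f B2) (C1 \<and>\<^sub>f C2) (D1 \<and>\<^sub>f D2))"
    using And.a'_nat_right[of "io B1 B2 D1 D2" _ _ ?A1 ?A2] by (simp add: comp_assoc)
  also have "\<dots> = aA ?A1 ?B1 (?A2 \<and>\<^sub>f ?B2)
      \<cdot> (\<one> ?A1 \<sqinter> (?s \<cdot> (\<one> ?A2 \<sqinter> io B1 B2 D1 D2) \<cdot> io A2 (B1 \<and>\<^sub>f B2) C2 (D1 \<and>\<^sub>f D2)))
      \<cdot> io A1 (A2 \<and>\<^sub>f (B1 \<and>\<^sub>f B2)) C1 (C2 \<and>\<^sub>f (D1 \<and>\<^sub>f D2))
      \<cdot> (aA' A1 A2 (B1 \<and>\<^sub>f B2) \<squnion> aA' C1 C2 (D1 \<and>\<^sub>f D2))"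
    by (simp only: iota_aA' And.whisker_left comp_assoc)
  also have "\<dots> = (aA ?A1 ?B1 (?A2 \<and>\<^sub>f ?B2) \<cdot> (\<one> ?A1 \<sqinter> (\<one> ?B1 \<sqinter> io A2 B2 C2 D2)))
      \<cdot> (\<one> ?A1 \<sqinter> io B1 (A2 \<and>\<^sub>f B2) D1 (C2 \<and>\<^sub>f D2))
      \<cdot> ((\<one> ?A1 \<sqinter> (?sA \<squnion> ?sC)) \<cdot> io A1 (A2 \<and>\<^sub>f (B1 \<and>\<^sub>f B2)) C1 (C2 \<and>\<^sub>f (D1 \<and>\<^sub>f D2)))
      \<cdot> (aA' A1 A2 (B1 \<and>\<^sub>f B2) \<squnion> aA' C1 C2 (D1 \<and>\<^sub>f D2))"
    by (simp only: iota_swap And.whisker_left comp_assoc)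
  also have "\<dots> = (\<one> (?A1 \<and>\<^sub>f ?B1) \<sqinter> io A2 B2 C2 D2) \<cdot> (aA ?A1 ?B1 ((A2 \<and>\<^sub>f B2) \<or>\<^sub>f (C2 \<and>\<^sub>f D2))
      \<cdot> (\<one> ?A1 \<sqinter> io B1 (A2 \<and>\<^sub>f B2) D1 (C2 \<and>\<^sub>f D2))
      \<cdot> io A1 (B1 \<and>\<^sub>f (A2 \<and>\<^sub>f B2)) C1 (D1 \<and>\<^sub>f (C2 \<and>\<^sub>f D2)))
      \<cdot> ((\<one> A1 \<sqinter> ?sA) \<squnion> (\<one> C1 \<sqinter> ?sC))
      \<cdot> (aA' A1 A2 (B1 \<and>\<^sub>f B2) \<squnion> aA' C1 C2 (D1 \<and>\<^sub>f D2))"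
    using And.a_nat[of "\<one> ?A1" "\<one> ?B1" "io A2 B2 C2 D2"] iota_nat_right[of A1 ?sA C1 ?sC, THEN extend]
    by (simp add: comp_assoc)
  also have "\<dots> = ((\<one> (?A1 \<and>\<^sub>f ?B1) \<sqinter> io A2 B2 C2 D2) \<cdot> (io A1 B1 C1 D1 \<sqinter> \<one> ((A2 \<and>\<^sub>f B2) \<or>\<^sub>f (C2 \<and>\<^sub>f D2))))
      \<cdot> io (A1 \<and>\<^sub>f B1) (A2 \<and>\<^sub>f B2) (C1 \<and>\<^sub>f D1) (C2 \<and>\<^sub>f D2) \<cdot> (And.mid A1 A2 B1 B2 \<squnion> And.mid C1 C2 D1 D2)"
    by (simp only: SMI7 And.mid_def Or.interchange comp_assoc)
  also have "\<dots> = ?rhs"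
    using And.tensor_split'[of "io A1 B1 C1 D1" "io A2 B2 C2 D2"] by simp
  finally show ?thesis .
qed

text \<open>The nullary case of \<open>iota_mid\<close>, with \<open>\<beta>\<close> in the place of \<open>\<iota>\<close>.\<close>

lemma beta_mid: "And.mid \<bottom>\<^sub>f \<bottom>\<^sub>f \<bottom>\<^sub>f \<bottom>\<^sub>f \<cdot> (be \<sqinter> be) \<cdot> be = (be \<sqinter> be) \<cdot> (be :: 'p arrow)"
proof -
  let ?b = "\<bottom>\<^sub>f" and ?e = "be :: 'p arrow"
  have swap: "And.swap ?b ?b ?b \<cdot> (\<one> ?b \<sqinter> be) \<cdot> ?e = (\<one> ?b \<sqinter> be) \<cdot> be"
  proof -
    have "And.swap ?b ?b ?b \<cdot> (\<one> ?b \<sqinter> be) \<cdot> ?e = aA' ?b ?b ?b \<cdot> ((sA ?b ?b \<cdot> be) \<sqinter> \<one> ?b) \<cdot> be"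
      by (simp only: And.swap_def comp_assoc SMI8 And.whisker_right)
    then show ?thesis by (simp only: SMI10 beta_aA')
  qed
  have "And.mid ?b ?b ?b ?b \<cdot> (be \<sqinter> be) \<cdot> ?e = aA ?b ?b (?b \<and>\<^sub>f ?b) \<cdot> (\<one> ?b \<sqinter> And.swap ?b ?b ?b)
      \<cdot> (aA' ?b ?b (?b \<and>\<^sub>f ?b) \<cdot> (\<one> (?b \<and>\<^sub>f ?b) \<sqinter> be)) \<cdot> (be \<sqinter> \<one> ?b) \<cdot> be"
    using And.tensor_split'[of ?e ?e, THEN extend] by (simp add: And.mid_def comp_assoc)
  also have "\<dots> = aA ?b ?b (?b \<and>\<^sub>f ?b) \<cdot> (\<one> ?b \<sqinter> And.swap ?b ?b ?b) \<cdot> (\<one> ?b \<sqinter> (\<one> ?b \<sqinter> be))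
      \<cdot> (aA' ?b ?b ?b \<cdot> (be \<sqinter> \<one> ?b) \<cdot> be)"
    using And.a'_nat_right[of ?e _ _ ?b ?b] by (simp add: comp_assoc)
  also have "\<dots> = aA ?b ?b (?b \<and>\<^sub>f ?b) \<cdot> (\<one> ?b \<sqinter> (And.swap ?b ?b ?b \<cdot> (\<one> ?b \<sqinter> be) \<cdot> be)) \<cdot> be"
    by (simp only: beta_aA' And.whisker_left comp_assoc)
  also have "\<dots> = (aA ?b ?b (?b \<and>\<^sub>f ?b) \<cdot> (\<one> ?b \<sqinter> (\<one> ?b \<sqinter> be))) \<cdot> (\<one> ?b \<sqinter> be) \<cdot> be"
    by (simp only: swap And.whisker_left comp_assoc)
  also have "\<dots> = (\<one> (?b \<and>\<^sub>f ?b) \<sqinter> be) \<cdot> (aA ?b ?b ?b \<cdot> (\<one> ?b \<sqinter> be) \<cdot> be)"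
    using And.a_nat[of "\<one> ?b" "\<one> ?b" ?e] by (simp add: comp_assoc)
  also have "\<dots> = (be \<sqinter> be) \<cdot> be"
    using And.tensor_split'[of ?e ?e, THEN extend] by (simp add: SMI8 comp_assoc)
  finally show ?thesis .
qed

section \<open>Splitting along a set of letters\<close>

text \<open>A letter outside \<open>S\<close> becomes \<open>\<top>\<close>, the unit of the connective along which formulae are split.\<close>

primrec restrict :: "'p set \<Rightarrow> 'p form \<Rightarrow> 'p form" where
  "restrict S (Letter p) = (if p \<in> S then Letter p else \<top>\<^sub>f)"
| "restrict S \<bottom>\<^sub>f = \<bottom>\<^sub>f"
| "restrict S \<top>\<^sub>f = \<top>\<^sub>f"
| "restrict S (A \<or>\<^sub>f B) = restrict S A \<or>\<^sub>f restrict S B"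
| "restrict S (A \<and>\<^sub>f B) = restrict S A \<and>\<^sub>f restrict S B"

primrec restrict_arrow :: "'p set \<Rightarrow> 'p arrow_term \<Rightarrow> 'p arrow_term" where
  "restrict_arrow S (Ident A) = Ident (restrict S A)"
| "restrict_arrow S (AlphaOrR A B C) = AlphaOrR (restrict S A) (restrict S B) (restrict S C)"
| "restrict_arrow S (AlphaOrL A B C) = AlphaOrL (restrict S A) (restrict S B) (restrict S C)"
| "restrict_arrow S (SigmaOr A B) = SigmaOr (restrict S A) (restrict S B)"
| "restrict_arrow S (RhoOrR A) = RhoOrR (restrict S A)"
| "restrict_arrow S (RhoOrL A) = RhoOrL (restrict S A)"
| "restrict_arrow S (LambdaOrR A) = LambdaOrR (restrict S A)"
| "restrict_arrow S (LambdaOrL A) = LambdaOrL (restrict S A)"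
| "restrict_arrow S (AlphaAndR A B C) = AlphaAndR (restrict S A) (restrict S B) (restrict S C)"
| "restrict_arrow S (AlphaAndL A B C) = AlphaAndL (restrict S A) (restrict S B) (restrict S C)"
| "restrict_arrow S (SigmaAnd A B) = SigmaAnd (restrict S A) (restrict S B)"
| "restrict_arrow S (RhoAndR A) = RhoAndR (restrict S A)"
| "restrict_arrow S (RhoAndL A) = RhoAndL (restrict S A)"
| "restrict_arrow S (LambdaAndR A) = LambdaAndR (restrict S A)"
| "restrict_arrow S (LambdaAndL A) = LambdaAndL (restrict S A)"
| "restrict_arrow S (Iota A B C D) = Iota (restrict S A) (restrict S B) (restrict S C) (restrict S D)"
| "restrict_arrow S BetaR = BetaR"
| "restrict_arrow S BetaL = BetaL"
| "restrict_arrow S TauR = TauR"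
| "restrict_arrow S TauL = TauL"
| "restrict_arrow S Kappa = Kappa"
| "restrict_arrow S (g \<circ>\<^sub>a f) = restrict_arrow S g \<circ>\<^sub>a restrict_arrow S f"
| "restrict_arrow S (f \<or>\<^sub>a g) = restrict_arrow S f \<or>\<^sub>a restrict_arrow S g"
| "restrict_arrow S (f \<and>\<^sub>a g) = restrict_arrow S f \<and>\<^sub>a restrict_arrow S g"

lemma restrict_arrow_has_type:
  "f \<turnstile> A \<rightarrow> B \<Longrightarrow> restrict_arrow S f \<turnstile> restrict S A \<rightarrow> restrict S B"
  by (induction rule: has_type.induct) (auto intro: has_type.intros)

lemma src_tgt_restrict_arrow [simp]:
  "src (restrict_arrow S f) = restrict S (src f)" "tgt (restrict_arrow S f) = restrict S (tgt f)"
  by (induction f) simp_all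

primrec split :: "'p set \<Rightarrow> 'p form \<Rightarrow> 'p arrow" where
  "split S (Letter p) = (if p \<in> S then rA' (Letter p) else lA' (Letter p))"
| "split S \<bottom>\<^sub>f = be"
| "split S \<top>\<^sub>f = rA' \<top>\<^sub>f"
| "split S (A \<or>\<^sub>f B) = io (restrict S A) (restrict (- S) A) (restrict S B) (restrict (- S) B)
    \<cdot> (split S A \<squnion> split S B)"
| "split S (A \<and>\<^sub>f B) = And.mid (restrict S A) (restrict (- S) A) (restrict S B) (restrict (- S) B)
    \<cdot> (split S A \<sqinter> split S B)"

lemma split_types [simp]:
  "asrc (split S A) = A" "atgt (split S A) = restrict S A \<and>\<^sub>f restrict (- S) A"
  by (induction A) auto

definition split_natural :: "'p set \<Rightarrow> 'p arrow_term \<Rightarrow> bool" where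
  "split_natural S f \<longleftrightarrow> split S (tgt f) \<cdot> cls f
    = (cls (restrict_arrow S f) \<sqinter> cls (restrict_arrow (- S) f)) \<cdot> split S (src f)"

text \<open>Naturality at an isomorphism gives naturality at its inverse, so that only one arrow of each pair of
  inverse generators has to be examined.\<close>

lemma split_natural_inverse:
  assumes "split_natural S f"
    and "Arr.inverse (cls f) (cls g)"
    and "Arr.inverse (cls (restrict_arrow S f)) (cls (restrict_arrow S g))"
    and "Arr.inverse (cls (restrict_arrow (- S) f)) (cls (restrict_arrow (- S) g))"
  shows "split_natural S g"
proof -
  have "Arr.inverse (cls (restrict_arrow S f) \<sqinter> cls (restrict_arrow (- S) f))
      (cls (restrict_arrow S g) \<sqinter> cls (restrict_arrow (- S) g))"
    using assms by (auto intro!: And.inverse_tensor)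
  moreover have "tgt g = src f" "src g = tgt f"
    using assms(2) by (auto simp: Arr.inverse_def)
  ultimately show ?thesis
    using Arr.inverse_transpose[OF assms(1)[unfolded split_natural_def, symmetric] _ assms(2)]
    by (simp add: split_natural_def)
qed

text \<open>The first three SMI equations.\<close>

lemma split_natural_or:
  "split_natural S (AlphaOrR A B C)" "split_natural S (SigmaOr A B)"
  "split_natural S (RhoOrR A)"
proof -
  let ?R = "restrict S" and ?R' = "restrict (- S)" and ?s = "split S"
  have "?s ((A \<or>\<^sub>f B) \<or>\<^sub>f C) \<cdot> aO A B C = io (?R A \<or>\<^sub>f ?R B) (?R' A \<or>\<^sub>f ?R' B) (?R C) (?R' C)
      \<cdot> (io (?R A) (?R' A) (?R B) (?R' B) \<squnion> \<one> (?R C \<and>\<^sub>f ?R' C)) \<cdot> ((?s A \<squnion> ?s B) \<squnion> ?s C) \<cdot> aO A B C"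
    using Or.interchange[of "io (?R A) (?R' A) (?R B) (?R' B)" "?s A \<squnion> ?s B" "\<one> (?R C \<and>\<^sub>f ?R' C)" "?s C"]
    by (simp add: comp_assoc)
  also have "\<dots> = (io (?R A \<or>\<^sub>f ?R B) (?R' A \<or>\<^sub>f ?R' B) (?R C) (?R' C)
      \<cdot> (io (?R A) (?R' A) (?R B) (?R' B) \<squnion> \<one> (?R C \<and>\<^sub>f ?R' C))
      \<cdot> aO (?R A \<and>\<^sub>f ?R' A) (?R B \<and>\<^sub>f ?R' B) (?R C \<and>\<^sub>f ?R' C)) \<cdot> (?s A \<squnion> (?s B \<squnion> ?s C))"
    using Or.a_nat[of "?s A" "?s B" "?s C", symmetric] by (simp add: comp_assoc)
  also have "\<dots> = (aO (?R A) (?R B) (?R C) \<sqinter> aO (?R' A) (?R' B) (?R' C))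
      \<cdot> io (?R A) (?R' A) (?R B \<or>\<^sub>f ?R C) (?R' B \<or>\<^sub>f ?R' C)
      \<cdot> (\<one> (?R A \<and>\<^sub>f ?R' A) \<squnion> io (?R B) (?R' B) (?R C) (?R' C)) \<cdot> (?s A \<squnion> (?s B \<squnion> ?s C))"
    by (simp only: SMI1 comp_assoc)
  also have "\<dots> = (aO (?R A) (?R B) (?R C) \<sqinter> aO (?R' A) (?R' B) (?R' C)) \<cdot> ?s (A \<or>\<^sub>f (B \<or>\<^sub>f C))"
    by (simp add: Or.interchange[symmetric] comp_assoc)
  finally show "split_natural S (AlphaOrR A B C)" by (simp add: split_natural_def)
  have "?s (B \<or>\<^sub>f A) \<cdot> sO A B = (io (?R B) (?R' B) (?R A) (?R' A)
      \<cdot> sO (?R A \<and>\<^sub>f ?R' A) (?R B \<and>\<^sub>f ?R' B)) \<cdot> (?s A \<squnion> ?s B)"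
    using Or.s_nat[of "?s A" "?s B"] by (simp add: comp_assoc)
  also have "\<dots> = (sO (?R A) (?R B) \<sqinter> sO (?R' A) (?R' B)) \<cdot> ?s (A \<or>\<^sub>f B)"
    by (simp only: SMI2) (simp add: comp_assoc)
  finally show "split_natural S (SigmaOr A B)" by (simp add: split_natural_def)
  have "(rO (?R A) \<sqinter> rO (?R' A)) \<cdot> ?s (A \<or>\<^sub>f \<bottom>\<^sub>f)
      = ((rO (?R A) \<sqinter> rO (?R' A)) \<cdot> io (?R A) (?R' A) \<bottom>\<^sub>f \<bottom>\<^sub>f \<cdot> (\<one> (?R A \<and>\<^sub>f ?R' A) \<squnion> be)) \<cdot> (?s A \<squnion> \<one> \<bottom>\<^sub>f)"
    using Or.tensor_split'[of "?s A" be] by (simp add: comp_assoc)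
  also have "\<dots> = ?s A \<cdot> rO A"
    using Or.r_nat[of "?s A"] by (simp only: SMI3) simp
  finally show "split_natural S (RhoOrR A)" by (simp add: split_natural_def)
qed

text \<open>The analogues of the first three SMI equations for the middle-four interchange.\<close>

lemma split_natural_and:
  "split_natural S (AlphaAndR A B C)" "split_natural S (SigmaAnd A B)"
  "split_natural S (RhoAndR A)"
proof -
  let ?R = "restrict S" and ?R' = "restrict (- S)" and ?s = "split S"
  have "?s ((A \<and>\<^sub>f B) \<and>\<^sub>f C) \<cdot> aA A B C = And.mid (?R A \<and>\<^sub>f ?R B) (?R' A \<and>\<^sub>f ?R' B) (?R C) (?R' C)
      \<cdot> (And.mid (?R A) (?R' A) (?R B) (?R' B) \<sqinter> \<one> (?R C \<and>\<^sub>f ?R' C)) \<cdot> ((?s A \<sqinter> ?s B) \<sqinter> ?s C) \<cdot> aA A B C"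
    using And.interchange[of "And.mid (?R A) (?R' A) (?R B) (?R' B)" "?s A \<sqinter> ?s B" "\<one> (?R C \<and>\<^sub>f ?R' C)" "?s C"]
    by (simp add: comp_assoc)
  also have "\<dots> = (And.mid (?R A \<and>\<^sub>f ?R B) (?R' A \<and>\<^sub>f ?R' B) (?R C) (?R' C)
      \<cdot> (And.mid (?R A) (?R' A) (?R B) (?R' B) \<sqinter> \<one> (?R C \<and>\<^sub>f ?R' C))
      \<cdot> aA (?R A \<and>\<^sub>f ?R' A) (?R B \<and>\<^sub>f ?R' B) (?R C \<and>\<^sub>f ?R' C)) \<cdot> (?s A \<sqinter> (?s B \<sqinter> ?s C))"
    using And.a_nat[of "?s A" "?s B" "?s C", symmetric] by (simp add: comp_assoc)
  also have "\<dots> = (aA (?R A) (?R B) (?R C) \<sqinter> aA (?R' A) (?R' B) (?R' C))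
      \<cdot> And.mid (?R A) (?R' A) (?R B \<and>\<^sub>f ?R C) (?R' B \<and>\<^sub>f ?R' C)
      \<cdot> (\<one> (?R A \<and>\<^sub>f ?R' A) \<sqinter> And.mid (?R B) (?R' B) (?R C) (?R' C)) \<cdot> (?s A \<sqinter> (?s B \<sqinter> ?s C))"
    by (simp only: And.mid_a[symmetric] comp_assoc)
  also have "\<dots> = (aA (?R A) (?R B) (?R C) \<sqinter> aA (?R' A) (?R' B) (?R' C)) \<cdot> ?s (A \<and>\<^sub>f (B \<and>\<^sub>f C))"
    by (simp add: And.interchange[symmetric] comp_assoc)
  finally show "split_natural S (AlphaAndR A B C)" by (simp add: split_natural_def)
  have "?s (B \<and>\<^sub>f A) \<cdot> sA A B = (And.mid (?R B) (?R' B) (?R A) (?R' A)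
      \<cdot> sA (?R A \<and>\<^sub>f ?R' A) (?R B \<and>\<^sub>f ?R' B)) \<cdot> (?s A \<sqinter> ?s B)"
    using And.s_nat[of "?s A" "?s B"] by (simp add: comp_assoc)
  also have "\<dots> = (sA (?R A) (?R B) \<sqinter> sA (?R' A) (?R' B)) \<cdot> ?s (A \<and>\<^sub>f B)"
    by (simp only: And.mid_s) (simp add: comp_assoc)
  finally show "split_natural S (SigmaAnd A B)" by (simp add: split_natural_def)
  have "(rA (?R A) \<sqinter> rA (?R' A)) \<cdot> ?s (A \<and>\<^sub>f \<top>\<^sub>f)
      = ((rA (?R A) \<sqinter> rA (?R' A)) \<cdot> And.mid (?R A) (?R' A) \<top>\<^sub>f \<top>\<^sub>f \<cdot> (\<one> (?R A \<and>\<^sub>f ?R' A) \<sqinter> rA' \<top>\<^sub>f)) \<cdot> (?s A \<sqinter> \<one> \<top>\<^sub>f)"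
    using And.tensor_split'[of "?s A" "rA' \<top>\<^sub>f"] by (simp add: comp_assoc)
  also have "\<dots> = ?s A \<cdot> rA A"
    using And.r_nat[of "?s A"] by (simp only: And.mid_r) simp
  finally show "split_natural S (RhoAndR A)" by (simp add: split_natural_def)
qed

lemma split_natural_iota: "split_natural S (Iota A B C D)"
proof -
  let ?R = "restrict S" and ?R' = "restrict (- S)" and ?s = "split S"
  let ?i = "io (?R A) (?R' A) (?R C) (?R' C) \<sqinter> io (?R B) (?R' B) (?R D) (?R' D)"
  let ?m = "And.mid (?R A \<or>\<^sub>f ?R C) (?R' A \<or>\<^sub>f ?R' C) (?R B \<or>\<^sub>f ?R D) (?R' B \<or>\<^sub>f ?R' D)"
  have "?s ((A \<or>\<^sub>f C) \<and>\<^sub>f (B \<or>\<^sub>f D)) \<cdot> io A B C D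
      = ?m \<cdot> ?i \<cdot> ((?s A \<squnion> ?s C) \<sqinter> (?s B \<squnion> ?s D)) \<cdot> io A B C D"
    by (simp add: And.interchange comp_assoc)
  also have "\<dots> = (?m \<cdot> ?i \<cdot> io (?R A \<and>\<^sub>f ?R' A) (?R B \<and>\<^sub>f ?R' B) (?R C \<and>\<^sub>f ?R' C) (?R D \<and>\<^sub>f ?R' D))
      \<cdot> ((?s A \<sqinter> ?s B) \<squnion> (?s C \<sqinter> ?s D))"
    using iota_natural[of "?s A" "?s B" "?s C" "?s D"] by (simp add: comp_assoc)
  also have "\<dots> = (io (?R A) (?R B) (?R C) (?R D) \<sqinter> io (?R' A) (?R' B) (?R' C) (?R' D))
      \<cdot> ?s ((A \<and>\<^sub>f B) \<or>\<^sub>f (C \<and>\<^sub>f D))"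
    by (simp only: iota_mid) (simp add: Or.interchange comp_assoc)
  finally show ?thesis by (simp add: split_natural_def)
qed

lemma split_natural_constants:
  "split_natural S (BetaL :: 'a arrow_term)" "split_natural S (TauR :: 'a arrow_term)"
  "split_natural S (Kappa :: 'a arrow_term)"
proof -
  have "(ta \<sqinter> ta) \<cdot> io \<top>\<^sub>f \<top>\<^sub>f \<top>\<^sub>f \<top>\<^sub>f \<cdot> (rA' \<top>\<^sub>f \<squnion> rA' \<top>\<^sub>f) = (ta \<sqinter> \<one> \<top>\<^sub>f) \<cdot> rA' (\<top>\<^sub>f \<or>\<^sub>f \<top>\<^sub>f :: 'a form)"
    using And.tensor_split[of "ta :: 'a arrow" ta, THEN extend] iota_rA'[of "\<top>\<^sub>f :: 'a form" "\<top>\<^sub>f"]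
    by (simp add: comp_assoc)
  then show "split_natural S TauR"
    using And.r'_nat[of "ta :: 'a arrow"] by (simp add: split_natural_def comp_assoc)
qed (simp_all add: split_natural_def beta_mid kappa_beta comp_assoc)

lemma split_natural_comp:
  assumes "split_natural S f" "split_natural S g" "src g = tgt f"
  shows "split_natural S (g \<circ>\<^sub>a f)"
  using assms(1) assms(2)[unfolded split_natural_def, THEN extend, of "cls f"] assms(3)
  by (simp add: split_natural_def And.interchange comp_assoc)

text \<open>The left unit isomorphisms are composites of a right one with a symmetry. On disjunctions and
  conjunctions of arrows the claim is naturality of \<open>\<iota>\<close> and of \<open>mid\<close>.\<close>

lemma split_natural_typed: "f \<turnstile> A \<rightarrow> B \<Longrightarrow> split_natural S f"
proof (induction rule: has_type.induct)
  case (ty_alpha_or_L A B C)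
  show ?case by (rule split_natural_inverse[OF split_natural_or(1)]) auto
next
  case (ty_rho_or_L A)
  show ?case by (rule split_natural_inverse[OF split_natural_or(3)]) auto
next
  case (ty_lambda_or_R A)
  have "split_natural S (RhoOrR A \<circ>\<^sub>a SigmaOr \<bottom>\<^sub>f A)"
    by (rule split_natural_comp) (simp_all add: split_natural_or)
  then show ?case by (simp add: split_natural_def Or.unit_s)
next
  case (ty_lambda_or_L A)
  have "split_natural S (SigmaOr A \<bottom>\<^sub>f \<circ>\<^sub>a RhoOrL A)"
    by (rule split_natural_comp[OF split_natural_inverse[OF split_natural_or(3)] split_natural_or(2)]) auto
  then show ?case by (simp add: split_natural_def Or.unit_s')
next
  case (ty_alpha_and_L A B C)
  show ?case by (rule split_natural_inverse[OF split_natural_and(1)]) auto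
next
  case (ty_rho_and_L A)
  show ?case by (rule split_natural_inverse[OF split_natural_and(3)]) auto
next
  case (ty_lambda_and_R A)
  have "split_natural S (RhoAndR A \<circ>\<^sub>a SigmaAnd \<top>\<^sub>f A)"
    by (rule split_natural_comp) (simp_all add: split_natural_and)
  then show ?case by (simp add: split_natural_def And.unit_s)
next
  case (ty_lambda_and_L A)
  have "split_natural S (SigmaAnd A \<top>\<^sub>f \<circ>\<^sub>a RhoAndL A)"
    by (rule split_natural_comp[OF split_natural_inverse[OF split_natural_and(3)] split_natural_and(2)]) auto
  then show ?case by (simp add: split_natural_def And.unit_s')
next
  case ty_beta_R
  show ?case by (rule split_natural_inverse[OF split_natural_constants(1)]) auto
next
  case ty_tau_L
  show ?case by (rule split_natural_inverse[OF split_natural_constants(2)]) auto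
next
  case (ty_comp f A B g C)
  then show ?case by (intro split_natural_comp) (auto simp: has_type_iff_typed)
next
  case (ty_disj f A B g C D)
  let ?R = "restrict S" and ?R' = "restrict (- S)" and ?s = "split S"
  have *: "src f = A" "src g = C" "tgt f = B" "tgt g = D"
    using ty_disj.hyps has_type_src_tgt by blast+
  have "?s (B \<or>\<^sub>f D) \<cdot> (cls f \<squnion> cls g)
      = io (?R B) (?R' B) (?R D) (?R' D) \<cdot> ((?s B \<cdot> cls f) \<squnion> (?s D \<cdot> cls g))"
    by (simp add: Or.interchange comp_assoc)
  also have "\<dots> = ((cls (restrict_arrow S f) \<squnion> cls (restrict_arrow S g))
      \<sqinter> (cls (restrict_arrow (- S) f) \<squnion> cls (restrict_arrow (- S) g))) \<cdot> ?s (A \<or>\<^sub>f C)"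
    using ty_disj.IH * iota_natural[of "cls (restrict_arrow S f)" "cls (restrict_arrow (- S) f)"
      "cls (restrict_arrow S g)" "cls (restrict_arrow (- S) g)", THEN extend]
    by (simp add: split_natural_def Or.interchange comp_assoc)
  finally show ?case using * by (simp add: split_natural_def)
next
  case (ty_conj f A B g C D)
  let ?R = "restrict S" and ?R' = "restrict (- S)" and ?s = "split S"
  have *: "src f = A" "src g = C" "tgt f = B" "tgt g = D"
    using ty_conj.hyps has_type_src_tgt by blast+
  have "?s (B \<and>\<^sub>f D) \<cdot> (cls f \<sqinter> cls g)
      = And.mid (?R B) (?R' B) (?R D) (?R' D) \<cdot> ((?s B \<cdot> cls f) \<sqinter> (?s D \<cdot> cls g))"
    by (simp add: And.interchange comp_assoc)
  also have "\<dots> = ((cls (restrict_arrow S f) \<sqinter> cls (restrict_arrow S g))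
      \<sqinter> (cls (restrict_arrow (- S) f) \<sqinter> cls (restrict_arrow (- S) g))) \<cdot> ?s (A \<and>\<^sub>f C)"
    using ty_conj.IH * And.mid_nat[of "cls (restrict_arrow S f)" "cls (restrict_arrow (- S) f)"
      "cls (restrict_arrow S g)" "cls (restrict_arrow (- S) g)", THEN extend]
    by (simp add: split_natural_def And.interchange comp_assoc)
  finally show ?case using * by (simp add: split_natural_def)
qed (simp_all add: split_natural_or split_natural_and split_natural_iota split_natural_constants
    split_natural_def[of S "Ident _"])


primrec constant_free :: "'p form \<Rightarrow> bool" where
  "constant_free (Letter p) = True"
| "constant_free \<bottom>\<^sub>f = False"
| "constant_free \<top>\<^sub>f = False"
| "constant_free (A \<or>\<^sub>f B) = (constant_free A \<and> constant_free B)"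
| "constant_free (A \<and>\<^sub>f B) = (constant_free A \<and> constant_free B)"

text \<open>If every letter of a constant-free formula becomes \<open>\<top>\<close>, the result is isomorphic to \<open>\<top>\<close>. The arrow
  does not depend on the set along which the formula is restricted. On \<open>\<bottom>\<close> the value is a default:
  \<open>\<bottom>\<close> is not isomorphic to \<open>\<top>\<close>.\<close>

primrec collapse :: "'p form \<Rightarrow> 'p arrow_term" where
  "collapse (Letter p) = Ident \<top>\<^sub>f"
| "collapse \<bottom>\<^sub>f = Ident \<bottom>\<^sub>f"
| "collapse \<top>\<^sub>f = Ident \<top>\<^sub>f"
| "collapse (A \<or>\<^sub>f B) = TauR \<circ>\<^sub>a (collapse A \<or>\<^sub>a collapse B)"
| "collapse (A \<and>\<^sub>f B) = RhoAndR \<top>\<^sub>f \<circ>\<^sub>a (collapse A \<and>\<^sub>a collapse B)"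

lemma collapse_type:
  "constant_free A \<Longrightarrow> letters A \<subseteq> - S \<Longrightarrow> collapse A \<turnstile> restrict S A \<rightarrow> \<top>\<^sub>f"
  by (induction A) (auto simp: intro!: has_type.intros)

lemma collapse_src_tgt:
  assumes "constant_free A" "letters A \<subseteq> - S"
  shows "src (collapse A) = restrict S A" "tgt (collapse A) = \<top>\<^sub>f"
  using collapse_type[OF assms] has_type_src_tgt by blast+

lemma restrict_all: "letters A \<subseteq> S \<Longrightarrow> restrict S A = A"
  by (induction A) auto

text \<open>If all letters of the formula lie in \<open>S\<close>, the second factor of the splitting collapses to \<open>\<top>\<close>, and
  the splitting becomes the unit isomorphism. For a disjunction this is the eleventh SMI equation,
  for a conjunction the splitting off of a column of units from a middle-four interchange.\<close>

lemma split_all: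
  assumes "constant_free A" "letters A \<subseteq> S"
  shows "(\<one> A \<sqinter> cls (collapse A)) \<cdot> split S A = rA' A"
  using assms
proof (induction A)
  case (Disj A B)
  let ?R = "restrict (- S)"
  have t: "src (collapse A) = ?R A" "tgt (collapse A) = \<top>\<^sub>f" "src (collapse B) = ?R B" "tgt (collapse B) = \<top>\<^sub>f"
    "restrict S A = A" "restrict S B = B"
    using Disj.prems by (auto simp: collapse_src_tgt[of _ "- S"] restrict_all)
  have "(\<one> (A \<or>\<^sub>f B) \<sqinter> cls (collapse (A \<or>\<^sub>f B))) \<cdot> split S (A \<or>\<^sub>f B)
      = (\<one> (A \<or>\<^sub>f B) \<sqinter> ta) \<cdot> ((\<one> (A \<or>\<^sub>f B) \<sqinter> (cls (collapse A) \<squnion> cls (collapse B)))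
        \<cdot> io A (?R A) B (?R B)) \<cdot> (split S A \<squnion> split S B)"
    by (simp add: And.whisker_left comp_assoc t)
  also have "\<dots> = (\<one> (A \<or>\<^sub>f B) \<sqinter> ta) \<cdot> io A \<top>\<^sub>f B \<top>\<^sub>f
      \<cdot> (((\<one> A \<sqinter> cls (collapse A)) \<cdot> split S A) \<squnion> ((\<one> B \<sqinter> cls (collapse B)) \<cdot> split S B))"
    using iota_nat_right[of A "cls (collapse A)" B "cls (collapse B)", THEN extend]
    by (simp add: t Or.interchange comp_assoc)
  also have "\<dots> = rA' (A \<or>\<^sub>f B)"
    using Disj by (simp add: iota_rA')
  finally show ?case .
next
  case (Conj A B)
  let ?R = "restrict (- S)"
  have t: "src (collapse A) = ?R A" "tgt (collapse A) = \<top>\<^sub>f" "src (collapse B) = ?R B" "tgt (collapse B) = \<top>\<^sub>f"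
    "restrict S A = A" "restrict S B = B"
    using Conj.prems by (auto simp: collapse_src_tgt[of _ "- S"] restrict_all)
  have "(\<one> (A \<and>\<^sub>f B) \<sqinter> cls (collapse (A \<and>\<^sub>f B))) \<cdot> split S (A \<and>\<^sub>f B)
      = (\<one> (A \<and>\<^sub>f B) \<sqinter> rA \<top>\<^sub>f) \<cdot> (((\<one> A \<sqinter> \<one> B) \<sqinter> (cls (collapse A) \<sqinter> cls (collapse B)))
        \<cdot> And.mid A (?R A) B (?R B)) \<cdot> (split S A \<sqinter> split S B)"
    by (simp add: And.whisker_left comp_assoc t)
  also have "\<dots> = (\<one> (A \<and>\<^sub>f B) \<sqinter> rA \<top>\<^sub>f) \<cdot> And.mid A \<top>\<^sub>f B \<top>\<^sub>f
      \<cdot> (((\<one> A \<sqinter> cls (collapse A)) \<cdot> split S A) \<sqinter> ((\<one> B \<sqinter> cls (collapse B)) \<cdot> split S B))"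
    using And.mid_nat[of "\<one> A" "cls (collapse A)" "\<one> B" "cls (collapse B)", THEN extend]
    by (simp add: t And.interchange comp_assoc)
  also have "\<dots> = rA' (A \<and>\<^sub>f B)"
    using Conj by (simp add: And.mid_right_units)
  finally show ?case .
qed simp_all

text \<open>The mirror image of \<open>split_all\<close>.\<close>

lemma split_none:
  assumes "constant_free A" "letters A \<subseteq> - S"
  shows "(cls (collapse A) \<sqinter> \<one> A) \<cdot> split S A = lA' A"
  using assms
proof (induction A)
  case (Disj A B)
  let ?R = "restrict S"
  have t: "src (collapse A) = ?R A" "tgt (collapse A) = \<top>\<^sub>f" "src (collapse B) = ?R B" "tgt (collapse B) = \<top>\<^sub>f"
    "restrict (- S) A = A" "restrict (- S) B = B"
    using Disj.prems by (auto simp: collapse_src_tgt[of _ S] intro!: restrict_all)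
  have "(cls (collapse (A \<or>\<^sub>f B)) \<sqinter> \<one> (A \<or>\<^sub>f B)) \<cdot> split S (A \<or>\<^sub>f B)
      = (ta \<sqinter> \<one> (A \<or>\<^sub>f B)) \<cdot> (((cls (collapse A) \<squnion> cls (collapse B)) \<sqinter> \<one> (A \<or>\<^sub>f B))
        \<cdot> io (?R A) A (?R B) B) \<cdot> (split S A \<squnion> split S B)"
    by (simp add: And.whisker_right comp_assoc t)
  also have "\<dots> = (ta \<sqinter> \<one> (A \<or>\<^sub>f B)) \<cdot> io \<top>\<^sub>f A \<top>\<^sub>f B
      \<cdot> (((cls (collapse A) \<sqinter> \<one> A) \<cdot> split S A) \<squnion> ((cls (collapse B) \<sqinter> \<one> B) \<cdot> split S B))"
    using iota_nat_left[of "cls (collapse A)" A "cls (collapse B)" B, THEN extend]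
    by (simp add: t Or.interchange comp_assoc)
  also have "\<dots> = lA' (A \<or>\<^sub>f B)"
    using Disj by (simp add: iota_lA')
  finally show ?case .
next
  case (Conj A B)
  let ?R = "restrict S"
  have t: "src (collapse A) = ?R A" "tgt (collapse A) = \<top>\<^sub>f" "src (collapse B) = ?R B" "tgt (collapse B) = \<top>\<^sub>f"
    "restrict (- S) A = A" "restrict (- S) B = B"
    using Conj.prems by (auto simp: collapse_src_tgt[of _ S] intro!: restrict_all)
  have "(cls (collapse (A \<and>\<^sub>f B)) \<sqinter> \<one> (A \<and>\<^sub>f B)) \<cdot> split S (A \<and>\<^sub>f B)
      = (rA \<top>\<^sub>f \<sqinter> \<one> (A \<and>\<^sub>f B)) \<cdot> (((cls (collapse A) \<sqinter> cls (collapse B)) \<sqinter> (\<one> A \<sqinter> \<one> B))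
        \<cdot> And.mid (?R A) A (?R B) B) \<cdot> (split S A \<sqinter> split S B)"
    by (simp add: And.whisker_right comp_assoc t)
  also have "\<dots> = (rA \<top>\<^sub>f \<sqinter> \<one> (A \<and>\<^sub>f B)) \<cdot> And.mid \<top>\<^sub>f A \<top>\<^sub>f B
      \<cdot> (((cls (collapse A) \<sqinter> \<one> A) \<cdot> split S A) \<sqinter> ((cls (collapse B) \<sqinter> \<one> B) \<cdot> split S B))"
    using And.mid_nat[of "cls (collapse A)" "\<one> A" "cls (collapse B)" "\<one> B", THEN extend]
    by (simp add: t And.interchange comp_assoc)
  also have "\<dots> = lA' (A \<and>\<^sub>f B)"
    using Conj by (simp add: And.mid_left_units)
  finally show ?case .
qed simp_all

text \<open>Collapsing \<open>C\<close> in the first factor and \<open>B\<close> in the second leaves the interchange of \<open>B\<close>, two units and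
  \<open>C\<close>, which is an identity.\<close>

lemma split_conj_retract:
  assumes "constant_free B" "letters B \<subseteq> S" "constant_free C" "letters C \<subseteq> - S"
  shows "(cls (RhoAndR B \<circ>\<^sub>a (Ident B \<and>\<^sub>a collapse C)) \<sqinter> cls (LambdaAndR C \<circ>\<^sub>a (collapse B \<and>\<^sub>a Ident C)))
    \<cdot> split S (B \<and>\<^sub>f C) = \<one> (B \<and>\<^sub>f C)"
proof -
  have t: "src (collapse B) = restrict (- S) B" "tgt (collapse B) = \<top>\<^sub>f" "src (collapse C) = restrict S C"
    "tgt (collapse C) = \<top>\<^sub>f" "restrict S B = B" "restrict (- S) C = C"
    using assms by (auto simp: collapse_src_tgt[of B "- S"] collapse_src_tgt[of C S] intro!: restrict_all)
  have "(cls (RhoAndR B \<circ>\<^sub>a (Ident B \<and>\<^sub>a collapse C)) \<sqinter> cls (LambdaAndR C \<circ>\<^sub>a (collapse B \<and>\<^sub>a Ident C)))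
      \<cdot> split S (B \<and>\<^sub>f C)
    = (rA B \<sqinter> lA C) \<cdot> (((\<one> B \<sqinter> cls (collapse C)) \<sqinter> (cls (collapse B) \<sqinter> \<one> C))
      \<cdot> And.mid B (restrict (- S) B) (restrict S C) C) \<cdot> (split S B \<sqinter> split S C)"
    by (simp add: t And.interchange comp_assoc)
  also have "\<dots> = (rA B \<sqinter> lA C) \<cdot> And.mid B \<top>\<^sub>f \<top>\<^sub>f C
      \<cdot> (((\<one> B \<sqinter> cls (collapse B)) \<cdot> split S B) \<sqinter> ((cls (collapse C) \<sqinter> \<one> C) \<cdot> split S C))"
    using And.mid_nat[of "\<one> B" "cls (collapse B)" "cls (collapse C)" "\<one> C", THEN extend]
    by (simp add: t And.interchange comp_assoc)
  also have "\<dots> = \<one> (B \<and>\<^sub>f C)"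
    using assms by (simp add: split_all split_none And.mid_inner_units And.interchange[symmetric])
  finally show ?thesis .
qed

definition thin :: "'p form \<Rightarrow> 'p form \<Rightarrow> bool" where
  "thin A B \<longleftrightarrow> (\<forall>f g. f \<turnstile> A \<rightarrow> B \<longrightarrow> g \<turnstile> A \<rightarrow> B \<longrightarrow> f \<approx> g)"

text \<open>An arrow \<open>h\<close> into \<open>B \<and> C\<close> equals the retraction of \<open>split_conj_retract\<close> after \<open>split S (B \<and> C) \<cdot> h\<close>,
  and by naturality the latter is \<open>split S A\<close> followed by the two restrictions of \<open>h\<close>. So \<open>h\<close> is
  determined by an arrow into \<open>B\<close> and an arrow into \<open>C\<close>. The uniqueness of these is only asked for where
  such an arrow exists, since its existence restricts the possible sources.\<close>

lemma thin_conj: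
  assumes B: "constant_free B" "letters B \<subseteq> S" and C: "constant_free C" "letters C \<subseteq> - S"
    and left: "(\<exists>f. f \<turnstile> restrict S A \<rightarrow> B) \<Longrightarrow> thin (restrict S A) B"
    and right: "(\<exists>f. f \<turnstile> restrict (- S) A \<rightarrow> C) \<Longrightarrow> thin (restrict (- S) A) C"
  shows "thin A (B \<and>\<^sub>f C)"
  unfolding thin_def
proof (intro allI impI)
  fix f g assume f: "f \<turnstile> A \<rightarrow> B \<and>\<^sub>f C" and g: "g \<turnstile> A \<rightarrow> B \<and>\<^sub>f C"
  define p q where "p = RhoAndR B \<circ>\<^sub>a (Ident B \<and>\<^sub>a collapse C)" and "q = LambdaAndR C \<circ>\<^sub>a (collapse B \<and>\<^sub>a Ident C)"
  have p: "p \<turnstile> restrict S (B \<and>\<^sub>f C) \<rightarrow> B" and q: "q \<turnstile> restrict (- S) (B \<and>\<^sub>f C) \<rightarrow> C"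
    using collapse_type[of B "- S"] collapse_type[of C S] restrict_all[of B S] restrict_all[of C "- S"] B C
    by (auto simp: p_def q_def intro!: has_type.intros)
  have factor: "cls h = (cls (p \<circ>\<^sub>a restrict_arrow S h) \<sqinter> cls (q \<circ>\<^sub>a restrict_arrow (- S) h)) \<cdot> split S A"
    if h: "h \<turnstile> A \<rightarrow> B \<and>\<^sub>f C" for h
  proof -
    have "cls h = ((cls p \<sqinter> cls q) \<cdot> split S (B \<and>\<^sub>f C)) \<cdot> cls h"
      using split_conj_retract[OF B C] has_type_src_tgt[OF h] by (simp only: p_def q_def) simp
    also have "\<dots> = (cls p \<sqinter> cls q) \<cdot> split S (tgt h) \<cdot> cls h"
      using has_type_src_tgt[OF h] by (simp only: comp_assoc)
    also have "\<dots> = (cls (p \<circ>\<^sub>a restrict_arrow S h) \<sqinter> cls (q \<circ>\<^sub>a restrict_arrow (- S) h)) \<cdot> split S A"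
      using split_natural_typed[OF h, of S] has_type_src_tgt[OF h]
      by (simp only: split_natural_def cls_operations And.interchange comp_assoc)
    finally show ?thesis .
  qed
  have "p \<circ>\<^sub>a restrict_arrow S h \<turnstile> restrict S A \<rightarrow> B \<and> q \<circ>\<^sub>a restrict_arrow (- S) h \<turnstile> restrict (- S) A \<rightarrow> C"
    if h: "h \<turnstile> A \<rightarrow> B \<and>\<^sub>f C" for h
    using restrict_arrow_has_type[OF h] p q by (auto intro: has_type.intros)
  then have "p \<circ>\<^sub>a restrict_arrow S f \<approx> p \<circ>\<^sub>a restrict_arrow S g"
    "q \<circ>\<^sub>a restrict_arrow (- S) f \<approx> q \<circ>\<^sub>a restrict_arrow (- S) g"
    using f g left right unfolding thin_def by blast+
  then have "cls f = cls g"
    using factor[OF f] factor[OF g] by (simp only: cls_eqI)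
  then show "f \<approx> g" using f by (rule cls_eqD)
qed

section \<open>Duality\<close>

primrec dual :: "'p form \<Rightarrow> 'p form" where
  "dual (Letter p) = Letter p"
| "dual \<bottom>\<^sub>f = \<top>\<^sub>f"
| "dual \<top>\<^sub>f = \<bottom>\<^sub>f"
| "dual (A \<or>\<^sub>f B) = dual A \<and>\<^sub>f dual B"
| "dual (A \<and>\<^sub>f B) = dual A \<or>\<^sub>f dual B"

lemma dual_dual [simp]: "dual (dual A) = A"
  by (induction A) simp_all

lemma letters_dual [simp]: "letters (dual A) = letters A"
  by (induction A) auto

text \<open>Reverses arrows and exchanges the two monoidal structures. The associators exchange their directions
  and \<open>\<iota>\<close> its two middle arguments, which makes the operation an involution.\<close>

primrec dual_arrow :: "'p arrow_term \<Rightarrow> 'p arrow_term" where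
  "dual_arrow (Ident A) = Ident (dual A)"
| "dual_arrow (AlphaOrR A B C) = AlphaAndL (dual A) (dual B) (dual C)"
| "dual_arrow (AlphaOrL A B C) = AlphaAndR (dual A) (dual B) (dual C)"
| "dual_arrow (SigmaOr A B) = SigmaAnd (dual B) (dual A)"
| "dual_arrow (RhoOrR A) = RhoAndL (dual A)"
| "dual_arrow (RhoOrL A) = RhoAndR (dual A)"
| "dual_arrow (LambdaOrR A) = LambdaAndL (dual A)"
| "dual_arrow (LambdaOrL A) = LambdaAndR (dual A)"
| "dual_arrow (AlphaAndR A B C) = AlphaOrL (dual A) (dual B) (dual C)"
| "dual_arrow (AlphaAndL A B C) = AlphaOrR (dual A) (dual B) (dual C)"
| "dual_arrow (SigmaAnd A B) = SigmaOr (dual B) (dual A)"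
| "dual_arrow (RhoAndR A) = RhoOrL (dual A)"
| "dual_arrow (RhoAndL A) = RhoOrR (dual A)"
| "dual_arrow (LambdaAndR A) = LambdaOrL (dual A)"
| "dual_arrow (LambdaAndL A) = LambdaOrR (dual A)"
| "dual_arrow (Iota A B C D) = Iota (dual A) (dual C) (dual B) (dual D)"
| "dual_arrow BetaR = TauL"
| "dual_arrow BetaL = TauR"
| "dual_arrow TauR = BetaL"
| "dual_arrow TauL = BetaR"
| "dual_arrow Kappa = Kappa"
| "dual_arrow (g \<circ>\<^sub>a f) = dual_arrow f \<circ>\<^sub>a dual_arrow g"
| "dual_arrow (f \<or>\<^sub>a g) = dual_arrow f \<and>\<^sub>a dual_arrow g"
| "dual_arrow (f \<and>\<^sub>a g) = dual_arrow f \<or>\<^sub>a dual_arrow g"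

lemma dual_arrow_dual_arrow [simp]: "dual_arrow (dual_arrow f) = f"
  by (induction f) simp_all

lemma dual_arrow_has_type: "f \<turnstile> A \<rightarrow> B \<Longrightarrow> dual_arrow f \<turnstile> dual B \<rightarrow> dual A"
  by (induction rule: has_type.induct) (auto intro: has_type.intros)

lemma src_tgt_dual_arrow [simp]:
  "src (dual_arrow f) = dual (tgt f)" "tgt (dual_arrow f) = dual (src f)"
  by (induction f) simp_all

text \<open>The equations come in dual pairs: the SMI equations 1 and 7, 2 and 9, 3 and 11, 4 and 8, 5 and 10,
  6 and 12. The dual of an equation is its partner, or its partner solved for inverse structural arrows.\<close>

lemma dual_arrow_eq: "f \<approx> g \<Longrightarrow> cls (dual_arrow f) = cls (dual_arrow g)"
proof (induction rule: arrow_eq.induct)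
  case (alpha_or_nat f A A' g B B' h C C')
  then show ?case
    using And.a'_nat[of "cls (dual_arrow f)" "cls (dual_arrow g)" "cls (dual_arrow h)"]
    by (simp add: has_type_iff_typed)
next
  case (sigma_or_nat f A A' g B B')
  then show ?case
    using And.s_nat[of "cls (dual_arrow g)" "cls (dual_arrow f)"] by (simp add: has_type_iff_typed)
next
  case (rho_or_nat f A A')
  then show ?case using And.r'_nat[of "cls (dual_arrow f)"] by (simp add: has_type_iff_typed)
next
  case (lambda_or_nat f A A')
  then show ?case using And.l'_nat[of "cls (dual_arrow f)"] by (simp add: has_type_iff_typed)
next
  case (alpha_and_nat f A A' g B B' h C C')
  then show ?case
    using Or.a'_nat[of "cls (dual_arrow f)" "cls (dual_arrow g)" "cls (dual_arrow h)"]
    by (simp add: has_type_iff_typed)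
next
  case (sigma_and_nat f A A' g B B')
  then show ?case
    using Or.s_nat[of "cls (dual_arrow g)" "cls (dual_arrow f)"] by (simp add: has_type_iff_typed)
next
  case (rho_and_nat f A A')
  then show ?case using Or.r'_nat[of "cls (dual_arrow f)"] by (simp add: has_type_iff_typed)
next
  case (lambda_and_nat f A A')
  then show ?case using Or.l'_nat[of "cls (dual_arrow f)"] by (simp add: has_type_iff_typed)
next
  case (iota_nat f A A' g B B' h C C' k D D')
  then show ?case
    using iota_natural[of "cls (dual_arrow f)" "cls (dual_arrow h)" "cls (dual_arrow g)" "cls (dual_arrow k)"]
    by (simp add: has_type_iff_typed)
qed (simp_all add: has_type_iff_typed comp_assoc And.interchange Or.interchange
    And.pentagon' Or.pentagon' And.triangle' Or.triangle' And.hexagon' Or.hexagon' And.unit_s' Or.unit_s'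
    iota_aA' iota_aO' SMI2 SMI9 iota_rA' iota_rO' beta_aA' tau_aO' SMI5 SMI10 SMI6 beta_kappa)

lemma thin_dual: "thin (dual B) (dual A) \<Longrightarrow> thin A B"
  unfolding thin_def
proof (intro allI impI)
  fix f g assume thin: "\<forall>f g. f \<turnstile> dual B \<rightarrow> dual A \<longrightarrow> g \<turnstile> dual B \<rightarrow> dual A \<longrightarrow> f \<approx> g"
    and f: "f \<turnstile> A \<rightarrow> B" and g: "g \<turnstile> A \<rightarrow> B"
  then have "dual_arrow f \<approx> dual_arrow g" by (blast intro: dual_arrow_has_type)
  from dual_arrow_eq[OF this] show "f \<approx> g" using f by (auto intro: cls_eqD)
qed

section \<open>Invariants of arrows\<close>

text \<open>What the normal form of a formula reveals about \<open>\<bottom>\<close>: the formula is \<open>\<bottom>\<close>, it is \<open>\<top>\<close>, it is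
  compound or a letter and free of \<open>\<bottom>\<close>, or it properly contains \<open>\<bottom>\<close> (\<open>purity_norm_form\<close>). With the
  operations \<open>vor\<close>, \<open>vand\<close> and the order \<open>vle\<close> these values form an ordered algebra that satisfies the
  inequality of \<open>\<iota>\<close>; arrows are therefore interpreted as inequalities.\<close>

datatype purity = VBot | VTop | VPure | VMixed

definition vor :: "purity \<Rightarrow> purity \<Rightarrow> purity" where
  "vor x y = (if x = VBot then y else if y = VBot then x else if x = VTop \<and> y = VTop then VTop
    else if x = VMixed \<or> y = VMixed then VMixed else VPure)"

definition vand :: "purity \<Rightarrow> purity \<Rightarrow> purity" where
  "vand x y = (if x = VTop then y else if y = VTop then x else if x = VBot \<and> y = VBot then VBot
    else if x = VPure \<and> y = VPure then VPure else VMixed)"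

definition vle :: "purity \<Rightarrow> purity \<Rightarrow> bool" where
  "vle x y \<longleftrightarrow> x = y \<or> (x = VBot \<and> y = VTop) \<or> (x = VMixed \<and> y = VPure)"

primrec purity_of :: "'p form \<Rightarrow> purity" where
  "purity_of (Letter p) = VPure"
| "purity_of \<bottom>\<^sub>f = VBot"
| "purity_of \<top>\<^sub>f = VTop"
| "purity_of (A \<or>\<^sub>f B) = vor (purity_of A) (purity_of B)"
| "purity_of (A \<and>\<^sub>f B) = vand (purity_of A) (purity_of B)"

lemma vle_trans: "vle x y \<Longrightarrow> vle y z \<Longrightarrow> vle x z"
  by (auto simp: vle_def)

lemma vle_vor: "vle x y \<Longrightarrow> vle z w \<Longrightarrow> vle (vor x z) (vor y w)"
  by (cases x; cases y; cases z; cases w) (simp_all add: vle_def vor_def)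

lemma vle_vand: "vle x y \<Longrightarrow> vle z w \<Longrightarrow> vle (vand x z) (vand y w)"
  by (cases x; cases y; cases z; cases w) (simp_all add: vle_def vand_def)

lemma vle_iota: "vle (vor (vand x y) (vand z w)) (vand (vor x z) (vor y w))"
  by (cases x; cases y; cases z; cases w) (simp_all add: vle_def vand_def vor_def)

lemma vor_vand_algebra:
  "vor x (vor y z) = vor (vor x y) z" "vor x y = vor y x" "vor x VBot = x" "vor VBot x = x"
  "vand x (vand y z) = vand (vand x y) z" "vand x y = vand y x" "vand x VTop = x" "vand VTop x = x"
  "vand VBot VBot = VBot" "vor VTop VTop = VTop"
  by (cases x; cases y; cases z; simp add: vor_def vand_def)+

lemma purity_mono: "f \<turnstile> A \<rightarrow> B \<Longrightarrow> vle (purity_of A) (purity_of B)"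
proof (induction rule: has_type.induct)
  case (ty_comp f A B g C)
  then show ?case using vle_trans by blast
next
  case (ty_sigma_or A B)
  show ?case using vor_vand_algebra(2)[of "purity_of A" "purity_of B"] by (simp add: vle_def)
next
  case (ty_sigma_and A B)
  show ?case using vor_vand_algebra(6)[of "purity_of A" "purity_of B"] by (simp add: vle_def)
qed (simp_all add: vle_iota vle_vor vle_vand, simp_all add: vle_def vor_vand_algebra(1,3-5,7-10))

lemma purity_norm_form: "purity_of A = (if norm_form A = \<bottom>\<^sub>f then VBot else if norm_form A = \<top>\<^sub>f then VTop
    else if \<bottom>\<^sub>f \<in> subformulae (norm_form A) then VMixed else VPure)"
  by (induction A) (auto simp: vor_def vand_def)

lemma bot_pure_iff: "bot_pure A \<longleftrightarrow> purity_of A = VTop \<or> purity_of A = VPure"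
  by (auto simp: bot_pure_def nu_eq_norm_form purity_norm_form)

text \<open>The values without \<open>\<bottom>\<close> in the normal form are closed upwards in the order \<open>vle\<close>.\<close>

lemma bot_pure_mono: "f \<turnstile> A \<rightarrow> B \<Longrightarrow> bot_pure A \<Longrightarrow> bot_pure B"
  using purity_mono[of f A B] by (auto simp: bot_pure_iff vle_def)

lemma dual_eq_iff [simp]: "dual A = dual B \<longleftrightarrow> A = B"
  by (metis dual_dual)

lemma dual_eq_constant [simp]: "dual A = \<bottom>\<^sub>f \<longleftrightarrow> A = \<top>\<^sub>f" "dual A = \<top>\<^sub>f \<longleftrightarrow> A = \<bottom>\<^sub>f"
  by (cases A; simp)+

lemma norm_form_dual: "norm_form (dual A) = dual (norm_form A)"
  by (induction A) auto

lemma subformulae_dual: "subformulae (dual A) = dual ` subformulae A"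
  by (induction A) auto

lemma bot_pure_dual: "bot_pure (dual A) \<longleftrightarrow> top_pure (A :: 'a form)"
proof -
  have "\<bottom>\<^sub>f \<in> dual ` X \<longleftrightarrow> \<top>\<^sub>f \<in> X" for X :: "'a form set"
  proof
    assume "\<bottom>\<^sub>f \<in> dual ` X"
    then obtain C where C: "C \<in> X" "\<bottom>\<^sub>f = dual C" by (elim imageE)
    then have "C = \<top>\<^sub>f" by (cases C) simp_all
    then show "\<top>\<^sub>f \<in> X" using C(1) by simp
  qed (auto intro: image_eqI[of _ _ "\<top>\<^sub>f"])
  then show ?thesis
    by (simp add: bot_pure_def top_pure_def nu_eq_norm_form norm_form_dual subformulae_dual)
qed

lemma pure_dual [simp]: "pure (dual A) \<longleftrightarrow> pure A"
  using bot_pure_dual[of A] bot_pure_dual[of "dual A"] by (auto simp: pure_def)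

lemma top_pure_mono: "f \<turnstile> A \<rightarrow> B \<Longrightarrow> top_pure B \<Longrightarrow> top_pure A"
  using bot_pure_mono[OF dual_arrow_has_type] by (simp add: bot_pure_dual)

text \<open>Replacing letters by \<open>\<top>\<close> can only turn a value \<open>VPure\<close> into \<open>VTop\<close>, as long as \<open>VMixed\<close> does not
  occur.\<close>

lemma bot_pure_restrict:
  assumes "bot_pure A"
  shows "bot_pure (restrict S A)"
proof -
  \<comment> \<open>relates the value of a formula to the possible values of its restrictions\<close>
  define R where "R x y \<longleftrightarrow> y = x \<or> (x = VPure \<and> y = VTop) \<or> x = VMixed" for x y
  have R: "R (vor x z) (vor y w)" "R (vand x z) (vand y w)" if "R x y" "R z w" for x y z w
    using that by (cases x; cases y; cases z; cases w; simp add: R_def vor_def vand_def)+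
  have "R (purity_of A) (purity_of (restrict S A))"
    by (induction A) (simp_all add: R, simp_all add: R_def)
  then show ?thesis using assms by (auto simp: bot_pure_iff R_def)
qed

lemma occurrences_eq: "f \<turnstile> A \<rightarrow> B \<Longrightarrow> occurrences p A = occurrences p B"
  by (induction rule: has_type.induct) simp_all

lemma letters_iff_occurrences: "p \<in> letters A \<longleftrightarrow> occurrences p A > 0"
  by (induction A) auto

lemma letters_eq: "f \<turnstile> A \<rightarrow> B \<Longrightarrow> letters A = letters B"
  by (auto simp: letters_iff_occurrences occurrences_eq)

lemma occurrences_norm_form [simp]: "occurrences p (norm_form A) = occurrences p A"
  by (induction A) auto

lemma letters_norm_form [simp]: "letters (norm_form A) = letters A"
  by (auto simp: letters_iff_occurrences)

lemma occurrences_dual [simp]: "occurrences p (dual A) = occurrences p A"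
  by (induction A) auto

lemma diversified_dual [simp]: "diversified (dual A) \<longleftrightarrow> diversified A"
  by (simp add: diversified_def)

lemma diversified_restrict: "diversified A \<Longrightarrow> diversified (restrict S A)"
proof -
  have "occurrences p (restrict S A) \<le> occurrences p A" for p
    by (induction A) auto
  then show "diversified A \<Longrightarrow> diversified (restrict S A)"
    unfolding diversified_def using le_trans by blast
qed

lemma diversified_components:
  assumes "diversified (A \<or>\<^sub>f B) \<or> diversified (A \<and>\<^sub>f B)"
  shows "letters A \<inter> letters B = {}" "diversified A" "diversified B"
proof -
  have sum: "occurrences p A + occurrences p B \<le> 1" for p
    using assms by (auto simp: diversified_def)
  show "letters A \<inter> letters B = {}"
  proof (rule equals0I)
    fix p assume "p \<in> letters A \<inter> letters B"
    then show False using sum[of p] by (simp add: letters_iff_occurrences)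
  qed
  show "diversified A"
    unfolding diversified_def
  proof
    show "occurrences p A \<le> 1" for p using sum[of p] by simp
  qed
  show "diversified B"
    unfolding diversified_def
  proof
    show "occurrences p B \<le> 1" for p using sum[of p] by simp
  qed
qed

text \<open>The pairs of letters with occurrences whose smallest common subformula is a conjunction. The only generator that
  changes this relation is \<open>\<iota>\<close>, and it enlarges it.\<close>

primrec conj_pairs :: "'p form \<Rightarrow> ('p \<times> 'p) set" where
  "conj_pairs (Letter p) = {}"
| "conj_pairs \<bottom>\<^sub>f = {}"
| "conj_pairs \<top>\<^sub>f = {}"
| "conj_pairs (A \<or>\<^sub>f B) = conj_pairs A \<union> conj_pairs B"
| "conj_pairs (A \<and>\<^sub>f B) = conj_pairs A \<union> conj_pairs B \<union> letters A \<times> letters B \<union> letters B \<times> letters A"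

lemma conj_pairs_mono: "f \<turnstile> A \<rightarrow> B \<Longrightarrow> conj_pairs A \<subseteq> conj_pairs B"
proof (induction rule: has_type.induct)
  case (ty_conj f A B g C D)
  then show ?case using letters_eq[of f A B] letters_eq[of g C D] by auto
qed auto

lemma conj_pairs_letters: "conj_pairs A \<subseteq> letters A \<times> letters A"
  by (induction A) auto

lemma constant_free_letters: "constant_free A \<Longrightarrow> letters A \<noteq> {}"
  by (induction A) auto

lemma constant_free_norm_form: "constant_free A \<Longrightarrow> norm_form A = A"
proof (induction A)
  case (Disj A B)
  then show ?case by (cases A; cases B; auto)
next
  case (Conj A B)
  then show ?case by (cases A; cases B; auto)
qed auto

lemma constant_free_iff: "constant_free A \<longleftrightarrow> \<bottom>\<^sub>f \<notin> subformulae A \<and> \<top>\<^sub>f \<notin> subformulae A"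
  by (induction A) auto

lemma pure_iff: "pure A \<longleftrightarrow> constant_free (norm_form A)"
  by (auto simp: pure_def bot_pure_def top_pure_def nu_eq_norm_form constant_free_iff)

text \<open>In the graph \<open>conj_pairs\<close> of the source every letter of \<open>A\<close> is adjacent to every letter of \<open>B\<close>, so
  this graph is connected; in the larger graph of the target no edge joins \<open>C\<close> and \<open>D\<close>.\<close>

lemma no_arrow_conj_disj:
  assumes "constant_free (A \<and>\<^sub>f B)" "constant_free (C \<or>\<^sub>f D)" "letters C \<inter> letters D = {}"
  shows "\<not> f \<turnstile> A \<and>\<^sub>f B \<rightarrow> C \<or>\<^sub>f D"
proof
  assume f: "f \<turnstile> A \<and>\<^sub>f B \<rightarrow> C \<or>\<^sub>f D"
  have L: "letters A \<union> letters B = letters C \<union> letters D"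
    using letters_eq[OF f] by simp
  have pairs: "a \<in> letters C \<longleftrightarrow> b \<in> letters C" if "a \<in> letters A" "b \<in> letters B" for a b
  proof -
    have "(a, b) \<in> letters C \<times> letters C \<union> letters D \<times> letters D"
      using conj_pairs_mono[OF f] conj_pairs_letters[of C] conj_pairs_letters[of D] that by auto
    then show ?thesis using assms(3) by auto
  qed
  obtain a b where ab: "a \<in> letters A" "b \<in> letters B"
    using assms(1) constant_free_letters by fastforce
  obtain c d where cd: "c \<in> letters C" "d \<in> letters D"
    using assms(2) constant_free_letters by fastforce
  have "x \<in> letters C \<longleftrightarrow> a \<in> letters C" if "x \<in> letters A \<union> letters B" for x
    using that pairs[of x b] pairs[of a b] pairs[of a x] ab by auto
  then have "c \<in> letters C \<longleftrightarrow> d \<in> letters C"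
    using cd L by blast
  then show False using cd assms(3) by blast
qed

lemma single_letter:
  assumes "constant_free A" "\<And>q. occurrences q A = occurrences q (Letter p)"
  shows "A = Letter p"
proof -
  have two: "occurrences p A = occurrences p B + occurrences p C \<Longrightarrow> letters A = letters B \<union> letters C \<Longrightarrow> letters B \<noteq> {}
      \<Longrightarrow> letters C \<noteq> {} \<Longrightarrow> False" for B C
  proof -
    assume o: "occurrences p A = occurrences p B + occurrences p C" and "letters A = letters B \<union> letters C"
      "letters B \<noteq> {}" "letters C \<noteq> {}"
    moreover have "letters A = {p}"
      using assms(2) by (auto simp: letters_iff_occurrences split: if_splits)
    ultimately have "p \<in> letters B" "p \<in> letters C" by auto
    then show False using o assms(2)[of p] by (simp add: letters_iff_occurrences)
  qed
  show ?thesis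
  proof (cases A)
    case (Letter q)
    then show ?thesis using assms(2)[of p] by (auto split: if_splits)
  next
    case (Disj B C)
    then show ?thesis using two[of B C] assms(1) constant_free_letters by auto
  next
    case (Conj B C)
    then show ?thesis using two[of B C] assms(1) constant_free_letters by auto
  qed (use assms(1) in auto)
qed

section \<open>Formulae whose normal form is a letter or a constant\<close>

definition atomic :: "'p form \<Rightarrow> bool" where
  "atomic A \<longleftrightarrow> A = \<bottom>\<^sub>f \<or> A = \<top>\<^sub>f \<or> (\<exists>p. A = Letter p)"

text \<open>The order of the tests is that of \<open>ndisj\<close>. For two copies of \<open>\<bottom>\<close> both unit isomorphisms apply, and
  they are equal.\<close>

definition reduce_or :: "'p form \<Rightarrow> 'p form \<Rightarrow> 'p arrow_term" where
  "reduce_or A B = (if B = \<bottom>\<^sub>f then RhoOrR A else if A = \<bottom>\<^sub>f then LambdaOrR B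
    else if A = \<top>\<^sub>f \<and> B = \<top>\<^sub>f then TauR else Ident (A \<or>\<^sub>f B))"

definition reduce_and :: "'p form \<Rightarrow> 'p form \<Rightarrow> 'p arrow_term" where
  "reduce_and A B = (if B = \<top>\<^sub>f then RhoAndR A else if A = \<top>\<^sub>f then LambdaAndR B
    else if A = \<bottom>\<^sub>f \<and> B = \<bottom>\<^sub>f then BetaR else Ident (A \<and>\<^sub>f B))"

primrec reduce :: "'p form \<Rightarrow> 'p arrow_term" where
  "reduce (Letter p) = Ident (Letter p)"
| "reduce \<bottom>\<^sub>f = Ident \<bottom>\<^sub>f"
| "reduce \<top>\<^sub>f = Ident \<top>\<^sub>f"
| "reduce (A \<or>\<^sub>f B) = reduce_or (norm_form A) (norm_form B) \<circ>\<^sub>a (reduce A \<or>\<^sub>a reduce B)"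
| "reduce (A \<and>\<^sub>f B) = reduce_and (norm_form A) (norm_form B) \<circ>\<^sub>a (reduce A \<and>\<^sub>a reduce B)"

lemma reduce_or_type: "reduce_or A B \<turnstile> A \<or>\<^sub>f B \<rightarrow> ndisj A B"
  by (auto simp: reduce_or_def intro: has_type.intros)

lemma reduce_and_type: "reduce_and A B \<turnstile> A \<and>\<^sub>f B \<rightarrow> nconj A B"
  by (auto simp: reduce_and_def intro: has_type.intros)

lemma reduce_type: "reduce A \<turnstile> A \<rightarrow> norm_form A"
proof (induction A)
  case (Disj A B)
  then show ?case
    using ty_comp[OF ty_disj[OF Disj] reduce_or_type] by (simp del: ndisj.simps)
next
  case (Conj A B)
  then show ?case
    using ty_comp[OF ty_conj[OF Conj] reduce_and_type] by (simp del: nconj.simps)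
qed (auto intro: has_type.intros)

lemma src_tgt_reduce [simp]:
  "src (reduce_or A B) = A \<or>\<^sub>f B" "tgt (reduce_or A B) = ndisj A B"
  "src (reduce_and A B) = A \<and>\<^sub>f B" "tgt (reduce_and A B) = nconj A B"
  "src (reduce A) = A" "tgt (reduce A) = norm_form A"
  using has_type_src_tgt[OF reduce_or_type] has_type_src_tgt[OF reduce_and_type] has_type_src_tgt[OF reduce_type]
  by blast+

definition expand :: "'p form \<Rightarrow> 'p arrow_term \<Rightarrow> bool" where
  "expand A g \<longleftrightarrow> g \<turnstile> norm_form A \<rightarrow> A \<and> Arr.inverse (cls (reduce A)) (cls g)"

lemma ex_expand: "\<exists>g. expand A g"
proof (induction A)
  case (Disj A B)
  then obtain f g where f: "expand A f" and g: "expand B g" by blast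
  obtain h where h: "h \<turnstile> ndisj (norm_form A) (norm_form B) \<rightarrow> norm_form A \<or>\<^sub>f norm_form B"
      "Arr.inverse (cls (reduce_or (norm_form A) (norm_form B))) (cls h)"
  proof (rule that)
    let ?h = "let A = norm_form A; B = norm_form B in
      if B = \<bottom>\<^sub>f then RhoOrL A else if A = \<bottom>\<^sub>f then LambdaOrL B
      else if A = \<top>\<^sub>f \<and> B = \<top>\<^sub>f then TauL else Ident (A \<or>\<^sub>f B)"
    show "?h \<turnstile> ndisj (norm_form A) (norm_form B) \<rightarrow> norm_form A \<or>\<^sub>f norm_form B"
      by (auto simp: Let_def intro: has_type.intros)
    show "Arr.inverse (cls (reduce_or (norm_form A) (norm_form B))) (cls ?h)"
      by (auto simp: reduce_or_def Let_def)
  qed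
  have "expand (A \<or>\<^sub>f B) ((f \<or>\<^sub>a g) \<circ>\<^sub>a h)"
    using f g h by (auto simp: expand_def simp del: ndisj.simps intro!: ty_comp ty_disj Arr.inverse_comp Or.inverse_tensor)
  then show ?case by blast
next
  case (Conj A B)
  then obtain f g where f: "expand A f" and g: "expand B g" by blast
  obtain h where h: "h \<turnstile> nconj (norm_form A) (norm_form B) \<rightarrow> norm_form A \<and>\<^sub>f norm_form B"
      "Arr.inverse (cls (reduce_and (norm_form A) (norm_form B))) (cls h)"
  proof (rule that)
    let ?h = "let A = norm_form A; B = norm_form B in
      if B = \<top>\<^sub>f then RhoAndL A else if A = \<top>\<^sub>f then LambdaAndL B
      else if A = \<bottom>\<^sub>f \<and> B = \<bottom>\<^sub>f then BetaL else Ident (A \<and>\<^sub>f B)"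
    show "?h \<turnstile> nconj (norm_form A) (norm_form B) \<rightarrow> norm_form A \<and>\<^sub>f norm_form B"
      by (auto simp: Let_def intro: has_type.intros)
    show "Arr.inverse (cls (reduce_and (norm_form A) (norm_form B))) (cls ?h)"
      by (auto simp: reduce_and_def Let_def)
  qed
  have "expand (A \<and>\<^sub>f B) ((f \<and>\<^sub>a g) \<circ>\<^sub>a h)"
    using f g h by (auto simp: expand_def simp del: nconj.simps intro!: ty_comp ty_conj Arr.inverse_comp And.inverse_tensor)
  then show ?case by blast
next
  case (Letter p)
  show ?case by (rule exI[of _ "Ident (Letter p)"]) (simp add: expand_def ty_id)
next
  case Bot
  show ?case by (rule exI[of _ "Ident \<bottom>\<^sub>f"]) (simp add: expand_def ty_id)
next
  case Top
  show ?case by (rule exI[of _ "Ident \<top>\<^sub>f"]) (simp add: expand_def ty_id)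
qed

text \<open>Uniqueness of arrows is invariant under isomorphism of source and target.\<close>

lemma thin_norm_form:
  assumes "thin (norm_form A) (norm_form B)"
  shows "thin A B"
  unfolding thin_def
proof (intro allI impI)
  fix f g assume f: "f \<turnstile> A \<rightarrow> B" and g: "g \<turnstile> A \<rightarrow> B"
  obtain e where e: "e \<turnstile> norm_form A \<rightarrow> A" "Arr.inverse (cls (reduce A)) (cls e)"
    using ex_expand by (auto simp: expand_def)
  obtain e' where e': "Arr.inverse (cls (reduce B)) (cls e')"
    using ex_expand by (auto simp: expand_def)
  have "reduce B \<circ>\<^sub>a f \<circ>\<^sub>a e \<turnstile> norm_form A \<rightarrow> norm_form B" "reduce B \<circ>\<^sub>a g \<circ>\<^sub>a e \<turnstile> norm_form A \<rightarrow> norm_form B"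
    using f g e reduce_type[of B] by (auto intro!: ty_comp)
  then have "cls (reduce B \<circ>\<^sub>a f \<circ>\<^sub>a e) = cls (reduce B \<circ>\<^sub>a g \<circ>\<^sub>a e)"
    using assms unfolding thin_def by (blast intro: cls_eqI)
  then have "cls f \<cdot> cls e = cls g \<cdot> cls e"
    using has_type_src_tgt[OF f] has_type_src_tgt[OF g]
    by - (rule Arr.inverse_cancel_left[OF e'], auto)
  then have "cls f = cls g"
    using has_type_src_tgt[OF f] has_type_src_tgt[OF g] has_type_src_tgt[OF e(1)]
    by - (rule Arr.inverse_cancel_right[OF Arr.inverse_sym[OF e(2)]], auto)
  then show "f \<approx> g" using f by (rule cls_eqD)
qed

text \<open>The only candidate for an arrow between two letters or constants.\<close>

definition compare :: "'p form \<Rightarrow> 'p form \<Rightarrow> 'p arrow_term" where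
  "compare A B = (if A = \<bottom>\<^sub>f \<and> B = \<top>\<^sub>f then Kappa else Ident A)"

lemma atomic_arrow:
  assumes f: "f \<turnstile> A \<rightarrow> B" and "atomic (norm_form A)" "atomic (norm_form B)"
  shows "norm_form A = norm_form B \<or> (norm_form A = \<bottom>\<^sub>f \<and> norm_form B = \<top>\<^sub>f)"
proof -
  have le: "vle (purity_of A) (purity_of B)" using f by (rule purity_mono)
  consider "norm_form A = \<bottom>\<^sub>f" | "norm_form A = \<top>\<^sub>f" | p where "norm_form A = Letter p"
    using assms(2) by (auto simp: atomic_def)
  then show ?thesis
  proof cases
    case 1
    then show ?thesis
      using le by (auto simp: purity_norm_form vle_def split: if_splits)
  next
    case 2
    then show ?thesis
      using le by (auto simp: purity_norm_form vle_def split: if_splits)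
  next
    case 3
    then have "norm_form B \<noteq> \<bottom>\<^sub>f \<and> norm_form B \<noteq> \<top>\<^sub>f"
      using le by (auto simp: purity_norm_form vle_def)
    then obtain q where "norm_form B = Letter q"
      using assms(3) by (auto simp: atomic_def)
    then show ?thesis
      using 3 occurrences_eq[OF f, of p] occurrences_norm_form[of p A] occurrences_norm_form[of p B]
      by (simp split: if_splits)
  qed
qed

text \<open>If the outer normal forms are constants, nothing but constants can occur in the middle, by
  \<open>purity_mono\<close>. If they are a letter, the middle formula is \<open>\<bottom>\<close>-pure because the source is, and
  \<open>\<top>\<close>-pure because the target is; so its normal form is free of constants and has a single letter.\<close>

lemma atomic_between:
  assumes f: "f \<turnstile> A \<rightarrow> B" and g: "g \<turnstile> B \<rightarrow> C" and A: "atomic (norm_form A)" and C: "atomic (norm_form C)"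
  shows "atomic (norm_form B)"
proof -
  have le: "vle (purity_of A) (purity_of B)" using f by (rule purity_mono)
  consider "norm_form A = \<bottom>\<^sub>f \<or> norm_form A = \<top>\<^sub>f" | p where "norm_form A = Letter p"
    using A by (auto simp: atomic_def)
  then show ?thesis
  proof cases
    case 1
    then have "purity_of B = VBot \<or> purity_of B = VTop"
      using le by (auto simp: purity_norm_form[of A] vle_def)
    then show ?thesis by (auto simp: purity_norm_form[of B] atomic_def split: if_splits)
  next
    case 2
    have "norm_form C = Letter p"
      using atomic_arrow[OF ty_comp[OF f g] A C] 2 by auto
    then have "pure A" "pure C" using 2 by (simp_all add: pure_iff)
    then have "pure B" using bot_pure_mono[OF f] top_pure_mono[OF g] by (simp add: pure_def)
    moreover have "occurrences q (norm_form B) = occurrences q (Letter p)" for q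
      using occurrences_eq[OF f, of q] 2 occurrences_norm_form[of q A] by simp
    ultimately show ?thesis
      using single_letter[of "norm_form B" p] by (auto simp: pure_iff atomic_def)
  qed
qed


lemma ndisj_units [simp]: "ndisj A \<bottom>\<^sub>f = A" "ndisj \<bottom>\<^sub>f A = A" "ndisj \<top>\<^sub>f \<top>\<^sub>f = \<top>\<^sub>f"
  by simp_all

lemma nconj_units [simp]: "nconj A \<top>\<^sub>f = A" "nconj \<top>\<^sub>f A = A" "nconj \<bottom>\<^sub>f \<bottom>\<^sub>f = \<bottom>\<^sub>f"
  by simp_all

declare ndisj.simps [simp del] nconj.simps [simp del]

lemma atomic_constants [simp]: "atomic \<bottom>\<^sub>f" "atomic \<top>\<^sub>f" "\<not> atomic (A \<or>\<^sub>f B)" "\<not> atomic (A \<and>\<^sub>f B)"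
  by (auto simp: atomic_def)

text \<open>A disjunction can reduce to a letter or constant only through one of the three reduction rules, which
  bounds the case distinctions below.\<close>

lemma atomic_ndisjD: "atomic (ndisj A B) \<Longrightarrow> B = \<bottom>\<^sub>f \<or> A = \<bottom>\<^sub>f \<or> (A = \<top>\<^sub>f \<and> B = \<top>\<^sub>f)"
  by (auto simp: ndisj.simps split: if_splits)

lemma atomic_nconjD: "atomic (nconj A B) \<Longrightarrow> B = \<top>\<^sub>f \<or> A = \<top>\<^sub>f \<or> (A = \<bottom>\<^sub>f \<and> B = \<bottom>\<^sub>f)"
  by (auto simp: nconj.simps split: if_splits)

lemma reduce_or_cls [simp]:
  "cls (reduce_or A \<bottom>\<^sub>f) = rO A" "cls (reduce_or \<bottom>\<^sub>f A) = lO A" "cls (reduce_or \<top>\<^sub>f \<top>\<^sub>f) = ta"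
  by (auto simp: reduce_or_def Or.unit_l_eq_r)

lemma reduce_and_cls [simp]:
  "cls (reduce_and A \<top>\<^sub>f) = rA A" "cls (reduce_and \<top>\<^sub>f A) = lA A" "cls (reduce_and \<bottom>\<^sub>f \<bottom>\<^sub>f) = be'"
  by (auto simp: reduce_and_def And.unit_l_eq_r)

lemma compare_same [simp]: "compare A A = Ident A" "compare \<bottom>\<^sub>f \<top>\<^sub>f = Kappa"
  by (auto simp: compare_def)

text \<open>The sixth SMI equation reflected by the symmetry, and its combination with naturality.\<close>

lemma tau_kappa:
  "ta \<cdot> (ka \<squnion> \<one> \<top>\<^sub>f) = lO (\<top>\<^sub>f :: 'p form)" "ta \<cdot> (ka \<squnion> ka) = ka \<cdot> rO (\<bottom>\<^sub>f :: 'p form)"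
proof -
  have "ta \<cdot> (ka \<squnion> \<one> \<top>\<^sub>f) = (ta \<cdot> sO \<top>\<^sub>f \<top>\<^sub>f) \<cdot> (ka \<squnion> \<one> (\<top>\<^sub>f :: 'p form))"
    by (simp only: SMI5)
  also have "\<dots> = (ta \<cdot> (\<one> \<top>\<^sub>f \<squnion> ka)) \<cdot> sO \<bottom>\<^sub>f \<top>\<^sub>f"
    using Or.s_nat[of "ka :: 'p arrow" "\<one> \<top>\<^sub>f"] by (simp add: comp_assoc)
  finally show "ta \<cdot> (ka \<squnion> \<one> \<top>\<^sub>f) = lO (\<top>\<^sub>f :: 'p form)"
    by (simp only: SMI6 Or.unit_s)
  have "ta \<cdot> (ka \<squnion> ka) = (ta \<cdot> (\<one> \<top>\<^sub>f \<squnion> ka)) \<cdot> ((ka :: 'p arrow) \<squnion> \<one> \<bottom>\<^sub>f)"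
    using Or.tensor_split'[of "ka :: 'p arrow" ka] by (simp add: comp_assoc)
  then show "ta \<cdot> (ka \<squnion> ka) = ka \<cdot> rO (\<bottom>\<^sub>f :: 'p form)"
    using Or.r_nat[of "ka :: 'p arrow"] by (simp add: SMI6)
qed

text \<open>In particular \<open>\<kappa> \<and> \<one>\<close> on \<open>\<bottom>\<close> is invertible, by the twelfth SMI equation.\<close>

lemma kappa_beta':
  "rA \<bottom>\<^sub>f \<cdot> (\<one> \<bottom>\<^sub>f \<sqinter> ka) = (be' :: 'p arrow)" "lA \<bottom>\<^sub>f \<cdot> (ka \<sqinter> \<one> \<bottom>\<^sub>f) = (be' :: 'p arrow)"
  "rA \<top>\<^sub>f \<cdot> (ka \<sqinter> ka) = ka \<cdot> (be' :: 'p arrow)"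
proof -
  show right: "rA \<bottom>\<^sub>f \<cdot> (\<one> \<bottom>\<^sub>f \<sqinter> ka) = (be' :: 'p arrow)"
    by (rule Arr.inverse_cancel_right[OF inverse_beta(1)]) (simp_all add: comp_assoc SMI12)
  have "lA \<bottom>\<^sub>f \<cdot> (ka \<sqinter> \<one> \<bottom>\<^sub>f) = (rA \<bottom>\<^sub>f \<cdot> (\<one> \<bottom>\<^sub>f \<sqinter> ka)) \<cdot> sA \<bottom>\<^sub>f (\<bottom>\<^sub>f :: 'p form)"
    using And.s_nat[of "ka :: 'p arrow" "\<one> \<bottom>\<^sub>f"] by (simp add: And.unit_s[symmetric] comp_assoc)
  also have "\<dots> = be' \<cdot> sA \<bottom>\<^sub>f \<bottom>\<^sub>f" by (simp only: right)
  also have "\<dots> = be'"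
    by (rule Arr.inverse_cong[OF SMI10]) (auto intro!: Arr.inverse_comp)
  finally show "lA \<bottom>\<^sub>f \<cdot> (ka \<sqinter> \<one> \<bottom>\<^sub>f) = (be' :: 'p arrow)" .
  show "rA \<top>\<^sub>f \<cdot> (ka \<sqinter> ka) = ka \<cdot> (be' :: 'p arrow)"
    by (rule Arr.inverse_cancel_right[OF inverse_beta(1)]) (simp_all add: comp_assoc kappa_beta)
qed

lemma reduce_or_compare:
  assumes atomic: "atomic (ndisj X Y)" "atomic (ndisj X' Y')"
    and X: "X = X' \<or> X = \<bottom>\<^sub>f \<and> X' = \<top>\<^sub>f" and Y: "Y = Y' \<or> Y = \<bottom>\<^sub>f \<and> Y' = \<top>\<^sub>f"
  shows "cls (reduce_or X' Y') \<cdot> (cls (compare X X') \<squnion> cls (compare Y Y'))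
    = cls (compare (ndisj X Y) (ndisj X' Y')) \<cdot> cls (reduce_or X Y)"
proof -
  have types: "src (compare X X') = X" "tgt (compare X X') = X'" "src (compare Y Y') = Y" "tgt (compare Y Y') = Y'"
    using X Y by (auto simp: compare_def)
  consider "Y = \<bottom>\<^sub>f" "Y' = \<bottom>\<^sub>f" | "X = \<bottom>\<^sub>f" "X' = \<bottom>\<^sub>f"
    | "X' = \<top>\<^sub>f" "Y' = \<top>\<^sub>f" "X = \<bottom>\<^sub>f \<or> X = \<top>\<^sub>f" "Y = \<bottom>\<^sub>f \<or> Y = \<top>\<^sub>f"
    using atomic[THEN atomic_ndisjD] X Y by auto
  then show ?thesis
  proof cases
    case 1
    then show ?thesis using Or.r_nat[of "cls (compare X X')"] by (simp add: types)
  next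
    case 2
    then show ?thesis using Or.l_nat[of "cls (compare Y Y')"] by (simp add: types)
  next
    case 3
    then show ?thesis by (auto simp: tau_kappa SMI6)
  qed
qed

lemma reduce_and_compare:
  assumes atomic: "atomic (nconj X Y)" "atomic (nconj X' Y')"
    and X: "X = X' \<or> X = \<bottom>\<^sub>f \<and> X' = \<top>\<^sub>f" and Y: "Y = Y' \<or> Y = \<bottom>\<^sub>f \<and> Y' = \<top>\<^sub>f"
  shows "cls (reduce_and X' Y') \<cdot> (cls (compare X X') \<sqinter> cls (compare Y Y'))
    = cls (compare (nconj X Y) (nconj X' Y')) \<cdot> cls (reduce_and X Y)"
proof -
  have types: "src (compare X X') = X" "tgt (compare X X') = X'" "src (compare Y Y') = Y" "tgt (compare Y Y') = Y'"
    using X Y by (auto simp: compare_def)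
  consider "Y = \<top>\<^sub>f" "Y' = \<top>\<^sub>f" | "X = \<top>\<^sub>f" "X' = \<top>\<^sub>f"
    | "X = \<bottom>\<^sub>f" "Y = \<bottom>\<^sub>f" "X' = \<bottom>\<^sub>f \<or> X' = \<top>\<^sub>f" "Y' = \<bottom>\<^sub>f \<or> Y' = \<top>\<^sub>f"
    using atomic[THEN atomic_nconjD] X Y by auto
  then show ?thesis
  proof cases
    case 1
    then show ?thesis using And.r_nat[of "cls (compare X X')"] by (simp add: types)
  next
    case 2
    then show ?thesis using And.l_nat[of "cls (compare Y Y')"] by (simp add: types)
  next
    case 3
    then show ?thesis by (auto simp: kappa_beta')
  qed
qed

text \<open>If one of the three formulae is \<open>\<bottom>\<close>, this is the triangle or one of Kelly's two consequences of it;
  otherwise all three are \<open>\<top>\<close>, and it is the fourth SMI equation.\<close>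

lemma reduce_or_assoc:
  assumes atomic: "atomic (ndisj X (ndisj Y Z))"
  shows "ndisj (ndisj X Y) Z = ndisj X (ndisj Y Z)"
    and "cls (reduce_or (ndisj X Y) Z) \<cdot> (cls (reduce_or X Y) \<squnion> \<one> Z) \<cdot> aO X Y Z
      = cls (reduce_or X (ndisj Y Z)) \<cdot> (\<one> X \<squnion> cls (reduce_or Y Z))"
proof -
  have cases: "X = \<bottom>\<^sub>f \<or> Y = \<bottom>\<^sub>f \<or> Z = \<bottom>\<^sub>f \<or> (X = \<top>\<^sub>f \<and> Y = \<top>\<^sub>f \<and> Z = \<top>\<^sub>f)"
    using atomic by (auto simp: ndisj.simps split: if_splits)
  then show "ndisj (ndisj X Y) Z = ndisj X (ndisj Y Z)" by auto
  from cases consider "X = \<bottom>\<^sub>f" | "Y = \<bottom>\<^sub>f" | "Z = \<bottom>\<^sub>f" | "X = \<top>\<^sub>f" "Y = \<top>\<^sub>f" "Z = \<top>\<^sub>f" by blast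
  then show "cls (reduce_or (ndisj X Y) Z) \<cdot> (cls (reduce_or X Y) \<squnion> \<one> Z) \<cdot> aO X Y Z
      = cls (reduce_or X (ndisj Y Z)) \<cdot> (\<one> X \<squnion> cls (reduce_or Y Z))"
  proof cases
    case 1
    then show ?thesis using Or.l_nat[of "cls (reduce_or Y Z)"] by (simp add: Or.unit_l_tensor)
  next
    case 2
    then show ?thesis by (simp add: Or.triangle)
  next
    case 3
    then show ?thesis
      using Or.r_nat[of "cls (reduce_or X Y)", THEN extend] Or.unit_r_tensor[of X Y]
      by (simp add: comp_assoc)
  next
    case 4
    then show ?thesis by (simp add: SMI4)
  qed
qed

text \<open>Dual to \<open>reduce_or_assoc\<close>, with the eighth SMI equation.\<close>

lemma reduce_and_assoc:
  assumes atomic: "atomic (nconj X (nconj Y Z))"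
  shows "nconj (nconj X Y) Z = nconj X (nconj Y Z)"
    and "cls (reduce_and (nconj X Y) Z) \<cdot> (cls (reduce_and X Y) \<sqinter> \<one> Z) \<cdot> aA X Y Z
      = cls (reduce_and X (nconj Y Z)) \<cdot> (\<one> X \<sqinter> cls (reduce_and Y Z))"
proof -
  have cases: "X = \<top>\<^sub>f \<or> Y = \<top>\<^sub>f \<or> Z = \<top>\<^sub>f \<or> (X = \<bottom>\<^sub>f \<and> Y = \<bottom>\<^sub>f \<and> Z = \<bottom>\<^sub>f)"
    using atomic by (auto simp: nconj.simps split: if_splits)
  then show "nconj (nconj X Y) Z = nconj X (nconj Y Z)" by auto
  from cases consider "X = \<top>\<^sub>f" | "Y = \<top>\<^sub>f" | "Z = \<top>\<^sub>f" | "X = \<bottom>\<^sub>f" "Y = \<bottom>\<^sub>f" "Z = \<bottom>\<^sub>f" by blast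
  then show "cls (reduce_and (nconj X Y) Z) \<cdot> (cls (reduce_and X Y) \<sqinter> \<one> Z) \<cdot> aA X Y Z
      = cls (reduce_and X (nconj Y Z)) \<cdot> (\<one> X \<sqinter> cls (reduce_and Y Z))"
  proof cases
    case 1
    then show ?thesis using And.l_nat[of "cls (reduce_and Y Z)"] by (simp add: And.unit_l_tensor)
  next
    case 2
    then show ?thesis by (simp add: And.triangle)
  next
    case 3
    then show ?thesis
      using And.r_nat[of "cls (reduce_and X Y)", THEN extend] And.unit_r_tensor[of X Y]
      by (simp add: comp_assoc)
  next
    case 4
    have "be' \<cdot> (\<one> \<bottom>\<^sub>f \<sqinter> be') \<cdot> aA' \<bottom>\<^sub>f \<bottom>\<^sub>f \<bottom>\<^sub>f = be' \<cdot> (be' \<sqinter> \<one> (\<bottom>\<^sub>f :: 'a form))"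
      by (rule Arr.inverse_cong[OF SMI8[unfolded comp_assoc[symmetric]]])
        (auto intro!: Arr.inverse_comp And.inverse_tensor)
    from this[THEN extend, of "aA \<bottom>\<^sub>f \<bottom>\<^sub>f \<bottom>\<^sub>f"] show ?thesis
      using 4 by (simp add: comp_assoc)
  qed
qed

lemma reduce_sigma:
  "atomic (ndisj X Y) \<Longrightarrow> ndisj Y X = ndisj X Y \<and> cls (reduce_or Y X) \<cdot> sO X Y = cls (reduce_or X Y)"
  "atomic (nconj X Y) \<Longrightarrow> nconj Y X = nconj X Y \<and> cls (reduce_and Y X) \<cdot> sA X Y = cls (reduce_and X Y)"
proof -
  show "ndisj Y X = ndisj X Y \<and> cls (reduce_or Y X) \<cdot> sO X Y = cls (reduce_or X Y)" if "atomic (ndisj X Y)"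
    using atomic_ndisjD[OF that] by (auto simp: SMI5 Or.unit_s Or.unit_s_mirror)
  have "be' \<cdot> sA \<bottom>\<^sub>f \<bottom>\<^sub>f = (be' :: 'a arrow)"
    by (rule Arr.inverse_cong[OF SMI10]) (auto intro!: Arr.inverse_comp)
  then show "nconj Y X = nconj X Y \<and> cls (reduce_and Y X) \<cdot> sA X Y = cls (reduce_and X Y)" if "atomic (nconj X Y)"
    using atomic_nconjD[OF that] by (auto simp: And.unit_s And.unit_s_mirror)
qed

text \<open>The two instances of \<open>\<iota>\<close> between constants that no SMI equation evaluates directly. Both go from \<open>\<bottom>\<close>
  to \<open>\<top>\<close> up to isomorphism and are equal to \<open>\<kappa>\<close>.\<close>

lemma iota_mixed:
  "rA \<top>\<^sub>f \<cdot> (rO \<top>\<^sub>f \<sqinter> lO \<top>\<^sub>f) \<cdot> io \<top>\<^sub>f \<bottom>\<^sub>f \<bottom>\<^sub>f \<top>\<^sub>f = ka \<cdot> rO \<bottom>\<^sub>f \<cdot> (lA \<bottom>\<^sub>f \<squnion> rA (\<bottom>\<^sub>f :: 'p form))"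
    (is "?lhs = ?rhs")
  "rA \<top>\<^sub>f \<cdot> (lO \<top>\<^sub>f \<sqinter> rO \<top>\<^sub>f) \<cdot> io \<bottom>\<^sub>f \<top>\<^sub>f \<top>\<^sub>f \<bottom>\<^sub>f = ka \<cdot> rO \<bottom>\<^sub>f \<cdot> (rA \<bottom>\<^sub>f \<squnion> lA (\<bottom>\<^sub>f :: 'p form))"
proof -
  let ?k = "ka :: 'p arrow" and ?b = "\<bottom>\<^sub>f :: 'p form" and ?t = "\<top>\<^sub>f :: 'p form"
  \<comment> \<open>\<open>?h\<close> is invertible and replaces the first two arguments of \<open>\<iota>\<close> by \<open>\<bottom>\<close>, where \<open>iota_lO\<close> applies\<close>
  let ?h = "(?k \<sqinter> \<one> ?b) \<squnion> \<one> (?b \<and>\<^sub>f ?t)"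
  have "lA' ?b \<cdot> lA ?b \<cdot> (?k \<sqinter> \<one> ?b) = lA' ?b \<cdot> be'"
    by (simp only: kappa_beta')
  then have "?k \<sqinter> \<one> ?b = lA' ?b \<cdot> be'"
    by simp
  then have "Arr.inverse (?k \<sqinter> \<one> ?b) (be \<cdot> lA ?b)"
    by (auto intro!: Arr.inverse_comp)
  then have h: "Arr.inverse ?h ((be \<cdot> lA ?b) \<squnion> \<one> (?b \<and>\<^sub>f ?t))"
    by (auto intro!: Or.inverse_tensor)
  have "?lhs \<cdot> ?h = rA ?t \<cdot> (((rO ?t \<cdot> (?k \<squnion> \<one> ?b)) \<sqinter> lO ?t)) \<cdot> io ?b ?b ?b ?t"
    using iota_nat_left[of ?k ?b "\<one> ?b" ?t]
      And.interchange[of "rO ?t" "?k \<squnion> \<one> ?b" "lO ?t" "\<one> (?b \<or>\<^sub>f ?t)", THEN extend]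
    by (simp add: comp_assoc)
  also have "\<dots> = (rA ?t \<cdot> (?k \<sqinter> \<one> ?t)) \<cdot> (rO ?b \<sqinter> lO ?t) \<cdot> io ?b ?b ?b ?t"
    using Or.r_nat[of ?k] And.interchange[of ?k "rO ?b" "\<one> ?t" "lO ?t", THEN extend]
    by (simp add: comp_assoc)
  also have "\<dots> = ?k \<cdot> rA ?b \<cdot> ((lO ?b \<sqinter> lO ?t) \<cdot> io ?b ?b ?b ?t \<cdot> (be \<squnion> \<one> (?b \<and>\<^sub>f ?t))) \<cdot> (be' \<squnion> \<one> (?b \<and>\<^sub>f ?t))"
    using And.r_nat[of ?k] Or.interchange[of be be' "\<one> (?b \<and>\<^sub>f ?t)" "\<one> (?b \<and>\<^sub>f ?t)", symmetric]
    by (simp add: comp_assoc Or.unit_l_eq_r)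
  also have "\<dots> = ?k \<cdot> (rA ?b \<cdot> lO (?b \<and>\<^sub>f ?t)) \<cdot> (be' \<squnion> \<one> (?b \<and>\<^sub>f ?t))"
    by (simp only: iota_lO comp_assoc)
  also have "\<dots> = ?k \<cdot> rO ?b \<cdot> (be' \<squnion> rA ?b)"
    using Or.l_nat[of "rA ?b", THEN extend] Or.tensor_split'[of be' "rA ?b"]
    by (simp add: Or.unit_l_eq_r comp_assoc)
  also have "\<dots> = ?rhs \<cdot> ?h"
    by (simp add: comp_assoc Or.interchange[symmetric] kappa_beta')
  finally show left: "?lhs = ?rhs"
    by - (rule Arr.inverse_cancel_right[OF h], auto)
  have "rA ?t \<cdot> (lO ?t \<sqinter> rO ?t) \<cdot> io ?b ?t ?t ?b = rA ?t \<cdot> (rO ?t \<sqinter> lO ?t) \<cdot> ((sO ?b ?t \<sqinter> sO ?t ?b) \<cdot> io ?b ?t ?t ?b)"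
    using And.interchange[of "rO ?t" "sO ?b ?t" "lO ?t" "sO ?t ?b", THEN extend]
    by (simp add: Or.unit_s Or.unit_s_mirror comp_assoc)
  also have "\<dots> = (?lhs) \<cdot> sO (?b \<and>\<^sub>f ?t) (?t \<and>\<^sub>f ?b)"
    by (simp only: SMI2[symmetric] comp_assoc)
  also have "\<dots> = ?k \<cdot> rO ?b \<cdot> sO ?b ?b \<cdot> (rA ?b \<squnion> lA ?b)"
    using Or.s_nat[of "rA ?b" "lA ?b"] by (simp only: left) (simp add: comp_assoc)
  finally show "rA \<top>\<^sub>f \<cdot> (lO \<top>\<^sub>f \<sqinter> rO \<top>\<^sub>f) \<cdot> io \<bottom>\<^sub>f \<top>\<^sub>f \<top>\<^sub>f \<bottom>\<^sub>f = ka \<cdot> rO \<bottom>\<^sub>f \<cdot> (rA \<bottom>\<^sub>f \<squnion> lA ?b)"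
    by (simp add: Or.s_unit)
qed

text \<open>If source and target reduce to letters or constants, then the first or the last two arguments of \<open>\<iota>\<close>
  are \<open>\<bottom>\<close>, where the third SMI equation evaluates it, or two corresponding ones are \<open>\<top>\<close>, where the
  eleventh does, or it is one of the two instances of \<open>iota_mixed\<close>.\<close>

lemma reduce_iota:
  assumes atomic: "atomic (ndisj (nconj X Y) (nconj Z W))" "atomic (nconj (ndisj X Z) (ndisj Y W))"
  shows "cls (reduce_and (ndisj X Z) (ndisj Y W)) \<cdot> (cls (reduce_or X Z) \<sqinter> cls (reduce_or Y W)) \<cdot> io X Y Z W
    = cls (compare (ndisj (nconj X Y) (nconj Z W)) (nconj (ndisj X Z) (ndisj Y W)))
      \<cdot> cls (reduce_or (nconj X Y) (nconj Z W)) \<cdot> (cls (reduce_and X Y) \<squnion> cls (reduce_and Z W))"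
proof -
  consider "Z = \<bottom>\<^sub>f" "W = \<bottom>\<^sub>f" | "X = \<bottom>\<^sub>f" "Y = \<bottom>\<^sub>f" | "Y = \<top>\<^sub>f" "W = \<top>\<^sub>f" | "X = \<top>\<^sub>f" "Z = \<top>\<^sub>f"
    | "X = \<top>\<^sub>f" "Y = \<bottom>\<^sub>f" "Z = \<bottom>\<^sub>f" "W = \<top>\<^sub>f" | "X = \<bottom>\<^sub>f" "Y = \<top>\<^sub>f" "Z = \<top>\<^sub>f" "W = \<bottom>\<^sub>f"
    using atomic by (cases "X = \<bottom>\<^sub>f"; cases "X = \<top>\<^sub>f"; cases "Y = \<bottom>\<^sub>f"; cases "Y = \<top>\<^sub>f";
      cases "Z = \<bottom>\<^sub>f"; cases "Z = \<top>\<^sub>f"; cases "W = \<bottom>\<^sub>f"; cases "W = \<top>\<^sub>f"; simp add: ndisj.simps nconj.simps)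
  then show ?thesis
  proof cases
    case 1
    have "(rO X \<sqinter> rO Y) \<cdot> io X Y \<bottom>\<^sub>f \<bottom>\<^sub>f = ((rO X \<sqinter> rO Y) \<cdot> io X Y \<bottom>\<^sub>f \<bottom>\<^sub>f \<cdot> (\<one> (X \<and>\<^sub>f Y) \<squnion> be)) \<cdot> (\<one> (X \<and>\<^sub>f Y) \<squnion> be')"
      by (simp add: comp_assoc Or.interchange[symmetric])
    also have "\<dots> = rO (X \<and>\<^sub>f Y) \<cdot> (\<one> (X \<and>\<^sub>f Y) \<squnion> be')"
      by (simp only: SMI3)
    finally show ?thesis
      using 1 Or.tensor_split[of "cls (reduce_and X Y)" be'] Or.r_nat[of "cls (reduce_and X Y)", THEN extend]
      by (simp add: comp_assoc)
  next
    case 2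
    have "(lO Z \<sqinter> lO W) \<cdot> io \<bottom>\<^sub>f \<bottom>\<^sub>f Z W = ((lO Z \<sqinter> lO W) \<cdot> io \<bottom>\<^sub>f \<bottom>\<^sub>f Z W \<cdot> (be \<squnion> \<one> (Z \<and>\<^sub>f W))) \<cdot> (be' \<squnion> \<one> (Z \<and>\<^sub>f W))"
      by (simp add: comp_assoc Or.interchange[symmetric])
    also have "\<dots> = lO (Z \<and>\<^sub>f W) \<cdot> (be' \<squnion> \<one> (Z \<and>\<^sub>f W))"
      by (simp only: iota_lO)
    finally show ?thesis
      using 2 Or.tensor_split'[of be' "cls (reduce_and Z W)"] Or.l_nat[of "cls (reduce_and Z W)", THEN extend]
      by (simp add: comp_assoc)
  next
    case 3
    have "rA (ndisj X Z) \<cdot> (cls (reduce_or X Z) \<sqinter> ta) \<cdot> io X \<top>\<^sub>f Z \<top>\<^sub>f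
        = cls (reduce_or X Z) \<cdot> rA (X \<or>\<^sub>f Z) \<cdot> (\<one> (X \<or>\<^sub>f Z) \<sqinter> ta) \<cdot> io X \<top>\<^sub>f Z \<top>\<^sub>f"
      using And.tensor_split[of "cls (reduce_or X Z)" ta] And.r_nat[of "cls (reduce_or X Z)", THEN extend]
      by (simp add: comp_assoc)
    then show ?thesis using 3 by (simp add: SMI11)
  next
    case 4
    have "lA (ndisj Y W) \<cdot> (ta \<sqinter> cls (reduce_or Y W)) \<cdot> io \<top>\<^sub>f Y \<top>\<^sub>f W
        = cls (reduce_or Y W) \<cdot> lA (Y \<or>\<^sub>f W) \<cdot> (ta \<sqinter> \<one> (Y \<or>\<^sub>f W)) \<cdot> io \<top>\<^sub>f Y \<top>\<^sub>f W"
      using And.tensor_split'[of ta "cls (reduce_or Y W)"] And.l_nat[of "cls (reduce_or Y W)", THEN extend]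
      by (simp add: comp_assoc)
    then show ?thesis using 4 by (simp add: iota_lA)
  next
    case 5
    then show ?thesis by (simp add: iota_mixed)
  next
    case 6
    then show ?thesis by (simp add: iota_mixed Or.unit_l_eq_r And.unit_l_eq_r)
  qed
qed

text \<open>Reduction to normal form absorbs the arrow. This holds for the isomorphisms among the generators
  if their source reduces to a letter or constant, and passes to inverses.\<close>

definition preserves_reduce :: "'p arrow_term \<Rightarrow> bool" where
  "preserves_reduce f \<longleftrightarrow> norm_form (src f) = norm_form (tgt f)
    \<and> cls (reduce (tgt f)) \<cdot> cls f = cls (reduce (src f))"

lemma preserves_reduce_inverse:
  assumes "preserves_reduce f" "Arr.inverse (cls f) (cls g)"
  shows "preserves_reduce g"
proof -
  have t: "src g = tgt f" "tgt g = src f" and c: "cls f \<cdot> cls g = \<one> (tgt f)"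
    using assms(2) by (auto simp: Arr.inverse_def)
  have "cls (reduce (src f)) \<cdot> cls g = cls (reduce (tgt f)) \<cdot> (cls f \<cdot> cls g)"
    using assms(1) by (simp only: preserves_reduce_def comp_assoc[symmetric])
  then show ?thesis using assms(1) t c by (simp add: preserves_reduce_def)
qed

lemma preserves_reduce_or:
  "atomic (norm_form (A \<or>\<^sub>f (B \<or>\<^sub>f C))) \<Longrightarrow> preserves_reduce (AlphaOrR A B C)"
  "atomic (norm_form (A \<or>\<^sub>f B)) \<Longrightarrow> preserves_reduce (SigmaOr A B)"
  "preserves_reduce (RhoOrR A)" "preserves_reduce (LambdaOrR A)"
proof -
  let ?n = norm_form and ?r = "\<lambda>A. cls (reduce A)"
  show "preserves_reduce (AlphaOrR A B C)" if "atomic (norm_form (A \<or>\<^sub>f (B \<or>\<^sub>f C)))"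
  proof -
    have *: "atomic (ndisj (?n A) (ndisj (?n B) (?n C)))" using that by simp
    have "?r ((A \<or>\<^sub>f B) \<or>\<^sub>f C) \<cdot> aO A B C = cls (reduce_or (ndisj (?n A) (?n B)) (?n C))
        \<cdot> (cls (reduce_or (?n A) (?n B)) \<squnion> \<one> (?n C)) \<cdot> ((?r A \<squnion> ?r B) \<squnion> ?r C) \<cdot> aO A B C"
      using Or.interchange[of "cls (reduce_or (?n A) (?n B))" "?r A \<squnion> ?r B" "\<one> (?n C)" "?r C"]
      by (simp add: comp_assoc)
    also have "\<dots> = (cls (reduce_or (ndisj (?n A) (?n B)) (?n C)) \<cdot> (cls (reduce_or (?n A) (?n B)) \<squnion> \<one> (?n C))
        \<cdot> aO (?n A) (?n B) (?n C)) \<cdot> (?r A \<squnion> (?r B \<squnion> ?r C))"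
      using Or.a_nat[of "?r A" "?r B" "?r C"] by (simp add: comp_assoc)
    also have "\<dots> = cls (reduce_or (?n A) (ndisj (?n B) (?n C))) \<cdot> (\<one> (?n A) \<squnion> cls (reduce_or (?n B) (?n C)))
        \<cdot> (?r A \<squnion> (?r B \<squnion> ?r C))"
      by (simp only: reduce_or_assoc(2)[OF *] comp_assoc)
    also have "\<dots> = ?r (A \<or>\<^sub>f (B \<or>\<^sub>f C))"
      by (simp add: Or.interchange[symmetric])
    finally show ?thesis
      using reduce_or_assoc(1)[OF *] by (simp add: preserves_reduce_def)
  qed
  show "preserves_reduce (SigmaOr A B)" if "atomic (norm_form (A \<or>\<^sub>f B))"
  proof -
    have *: "ndisj (?n B) (?n A) = ndisj (?n A) (?n B)"
        "cls (reduce_or (?n B) (?n A)) \<cdot> sO (?n A) (?n B) = cls (reduce_or (?n A) (?n B))"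
      using reduce_sigma(1)[of "?n A" "?n B"] that by simp_all
    have "cls (reduce_or (?n B) (?n A)) \<cdot> (?r B \<squnion> ?r A) \<cdot> sO A B
        = (cls (reduce_or (?n B) (?n A)) \<cdot> sO (?n A) (?n B)) \<cdot> (?r A \<squnion> ?r B)"
      using Or.s_nat[of "?r A" "?r B"] by (simp add: comp_assoc)
    then show ?thesis by (simp add: preserves_reduce_def * comp_assoc)
  qed
  show "preserves_reduce (RhoOrR A)" "preserves_reduce (LambdaOrR A)"
    using Or.r_nat[of "?r A"] Or.l_nat[of "?r A"] by (simp_all add: preserves_reduce_def)
qed

lemma preserves_reduce_and:
  "atomic (norm_form (A \<and>\<^sub>f (B \<and>\<^sub>f C))) \<Longrightarrow> preserves_reduce (AlphaAndR A B C)"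
  "atomic (norm_form (A \<and>\<^sub>f B)) \<Longrightarrow> preserves_reduce (SigmaAnd A B)"
  "preserves_reduce (RhoAndR A)" "preserves_reduce (LambdaAndR A)"
proof -
  let ?n = norm_form and ?r = "\<lambda>A. cls (reduce A)"
  show "preserves_reduce (AlphaAndR A B C)" if "atomic (norm_form (A \<and>\<^sub>f (B \<and>\<^sub>f C)))"
  proof -
    have *: "atomic (nconj (?n A) (nconj (?n B) (?n C)))" using that by simp
    have "?r ((A \<and>\<^sub>f B) \<and>\<^sub>f C) \<cdot> aA A B C = cls (reduce_and (nconj (?n A) (?n B)) (?n C))
        \<cdot> (cls (reduce_and (?n A) (?n B)) \<sqinter> \<one> (?n C)) \<cdot> ((?r A \<sqinter> ?r B) \<sqinter> ?r C) \<cdot> aA A B C"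
      using And.interchange[of "cls (reduce_and (?n A) (?n B))" "?r A \<sqinter> ?r B" "\<one> (?n C)" "?r C"]
      by (simp add: comp_assoc)
    also have "\<dots> = (cls (reduce_and (nconj (?n A) (?n B)) (?n C)) \<cdot> (cls (reduce_and (?n A) (?n B)) \<sqinter> \<one> (?n C))
        \<cdot> aA (?n A) (?n B) (?n C)) \<cdot> (?r A \<sqinter> (?r B \<sqinter> ?r C))"
      using And.a_nat[of "?r A" "?r B" "?r C"] by (simp add: comp_assoc)
    also have "\<dots> = cls (reduce_and (?n A) (nconj (?n B) (?n C))) \<cdot> (\<one> (?n A) \<sqinter> cls (reduce_and (?n B) (?n C)))
        \<cdot> (?r A \<sqinter> (?r B \<sqinter> ?r C))"
      by (simp only: reduce_and_assoc(2)[OF *] comp_assoc)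
    also have "\<dots> = ?r (A \<and>\<^sub>f (B \<and>\<^sub>f C))"
      by (simp add: And.interchange[symmetric])
    finally show ?thesis
      using reduce_and_assoc(1)[OF *] by (simp add: preserves_reduce_def)
  qed
  show "preserves_reduce (SigmaAnd A B)" if "atomic (norm_form (A \<and>\<^sub>f B))"
  proof -
    have *: "nconj (?n B) (?n A) = nconj (?n A) (?n B)"
        "cls (reduce_and (?n B) (?n A)) \<cdot> sA (?n A) (?n B) = cls (reduce_and (?n A) (?n B))"
      using reduce_sigma(2)[of "?n A" "?n B"] that by simp_all
    have "cls (reduce_and (?n B) (?n A)) \<cdot> (?r B \<sqinter> ?r A) \<cdot> sA A B
        = (cls (reduce_and (?n B) (?n A)) \<cdot> sA (?n A) (?n B)) \<cdot> (?r A \<sqinter> ?r B)"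
      using And.s_nat[of "?r A" "?r B"] by (simp add: comp_assoc)
    then show ?thesis by (simp add: preserves_reduce_def * comp_assoc)
  qed
  show "preserves_reduce (RhoAndR A)" "preserves_reduce (LambdaAndR A)"
    using And.r_nat[of "?r A"] And.l_nat[of "?r A"] by (simp_all add: preserves_reduce_def)
qed

lemma preserves_reduce_constants: "preserves_reduce BetaR" "preserves_reduce TauR"
  by (simp_all add: preserves_reduce_def)

text \<open>The reductions form a natural transformation onto the category that consists of letters, constants,
  identities and \<open>\<kappa>\<close>. The condition is vacuous at arrows whose source or target does not reduce to a
  letter or constant, and \<open>atomic_between\<close> is what makes it closed under composition.\<close>

definition atomic_natural :: "'p arrow_term \<Rightarrow> bool" where
  "atomic_natural f \<longleftrightarrow> (atomic (norm_form (src f)) \<longrightarrow> atomic (norm_form (tgt f)) \<longrightarrow>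
    cls (reduce (tgt f)) \<cdot> cls f = cls (compare (norm_form (src f)) (norm_form (tgt f))) \<cdot> cls (reduce (src f)))"

lemma atomic_naturalI:
  assumes "atomic (norm_form (src f)) \<Longrightarrow> preserves_reduce f"
  shows "atomic_natural f"
  using assms by (auto simp: atomic_natural_def preserves_reduce_def)

lemma atomic_naturalI_inverse:
  assumes "atomic (norm_form (src f)) \<Longrightarrow> preserves_reduce f" "Arr.inverse (cls f) (cls g)"
  shows "atomic_natural g"
proof -
  have t: "src g = tgt f" "tgt g = src f"
    using assms(2) by (auto simp: Arr.inverse_def)
  show ?thesis
  proof (cases "atomic (norm_form (src f))")
    case True
    then show ?thesis
      using preserves_reduce_inverse[OF assms(1) assms(2)] by (intro atomic_naturalI)
  qed (simp add: atomic_natural_def t)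
qed

lemma atomic_natural_typed: "f \<turnstile> A \<rightarrow> B \<Longrightarrow> atomic_natural f"
proof (induction rule: has_type.induct)
  case (ty_alpha_or_L A B C)
  show ?case by (rule atomic_naturalI_inverse[of "AlphaOrR A B C"]) (auto intro: preserves_reduce_or simp del: norm_form.simps)
next
  case (ty_rho_or_L A)
  show ?case by (rule atomic_naturalI_inverse[OF preserves_reduce_or(3)]) auto
next
  case (ty_lambda_or_L A)
  show ?case by (rule atomic_naturalI_inverse[OF preserves_reduce_or(4)]) auto
next
  case (ty_alpha_and_L A B C)
  show ?case by (rule atomic_naturalI_inverse[of "AlphaAndR A B C"]) (auto intro: preserves_reduce_and simp del: norm_form.simps)
next
  case (ty_rho_and_L A)
  show ?case by (rule atomic_naturalI_inverse[OF preserves_reduce_and(3)]) auto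
next
  case (ty_lambda_and_L A)
  show ?case by (rule atomic_naturalI_inverse[OF preserves_reduce_and(4)]) auto
next
  case (ty_iota A B C D)
  let ?n = norm_form and ?r = "\<lambda>A. cls (reduce A)"
  show ?case
    unfolding atomic_natural_def
  proof (intro impI)
    assume "atomic (?n (src (Iota A B C D)))" "atomic (?n (tgt (Iota A B C D)))"
    then have *: "atomic (ndisj (nconj (?n A) (?n B)) (nconj (?n C) (?n D)))"
        "atomic (nconj (ndisj (?n A) (?n C)) (ndisj (?n B) (?n D)))" by simp_all
    have "?r ((A \<or>\<^sub>f C) \<and>\<^sub>f (B \<or>\<^sub>f D)) \<cdot> io A B C D
        = cls (reduce_and (ndisj (?n A) (?n C)) (ndisj (?n B) (?n D)))
          \<cdot> (cls (reduce_or (?n A) (?n C)) \<sqinter> cls (reduce_or (?n B) (?n D)))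
          \<cdot> ((?r A \<squnion> ?r C) \<sqinter> (?r B \<squnion> ?r D)) \<cdot> io A B C D"
      by (simp add: And.interchange comp_assoc)
    also have "\<dots> = (cls (reduce_and (ndisj (?n A) (?n C)) (ndisj (?n B) (?n D)))
          \<cdot> (cls (reduce_or (?n A) (?n C)) \<sqinter> cls (reduce_or (?n B) (?n D)))
          \<cdot> io (?n A) (?n B) (?n C) (?n D)) \<cdot> ((?r A \<sqinter> ?r B) \<squnion> (?r C \<sqinter> ?r D))"
      using iota_natural[of "?r A" "?r B" "?r C" "?r D"] by (simp add: comp_assoc)
    also have "\<dots> = cls (compare (?n ((A \<and>\<^sub>f B) \<or>\<^sub>f (C \<and>\<^sub>f D))) (?n ((A \<or>\<^sub>f C) \<and>\<^sub>f (B \<or>\<^sub>f D))))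
        \<cdot> ?r ((A \<and>\<^sub>f B) \<or>\<^sub>f (C \<and>\<^sub>f D))"
      by (simp only: reduce_iota[OF *]) (simp add: Or.interchange comp_assoc)
    finally show "?r (tgt (Iota A B C D)) \<cdot> io A B C D
      = cls (compare (?n (src (Iota A B C D))) (?n (tgt (Iota A B C D)))) \<cdot> ?r (src (Iota A B C D))"
      by simp
  qed
next
  case ty_beta_L
  show ?case by (rule atomic_naturalI_inverse[OF preserves_reduce_constants(1)]) auto
next
  case ty_tau_L
  show ?case by (rule atomic_naturalI_inverse[OF preserves_reduce_constants(2)]) auto
next
  case (ty_comp f A B g C)
  have t: "src f = A" "tgt f = B" "src g = B" "tgt g = C"
    using ty_comp.hyps has_type_src_tgt by blast+
  show ?case
    unfolding atomic_natural_def
  proof (intro impI)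
    assume "atomic (norm_form (src (g \<circ>\<^sub>a f)))" "atomic (norm_form (tgt (g \<circ>\<^sub>a f)))"
    then have AC: "atomic (norm_form A)" "atomic (norm_form C)" by (simp_all add: t)
    have B: "atomic (norm_form B)" using atomic_between[OF ty_comp.hyps AC] .
    have "cls (reduce C) \<cdot> cls g \<cdot> cls f
        = cls (compare (norm_form B) (norm_form C)) \<cdot> cls (reduce B) \<cdot> cls f"
      using ty_comp.IH(2) AC B by (simp add: atomic_natural_def t comp_assoc[symmetric])
    also have "\<dots> = cls (compare (norm_form B) (norm_form C)) \<cdot> cls (compare (norm_form A) (norm_form B)) \<cdot> cls (reduce A)"
      using ty_comp.IH(1) AC B by (simp add: atomic_natural_def t)
    also have "\<dots> = cls (compare (norm_form A) (norm_form C)) \<cdot> cls (reduce A)"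
      using atomic_arrow[OF ty_comp.hyps(1) AC(1) B] atomic_arrow[OF ty_comp.hyps(2) B AC(2)] by auto
    finally show "cls (reduce (tgt (g \<circ>\<^sub>a f))) \<cdot> cls (g \<circ>\<^sub>a f)
      = cls (compare (norm_form (src (g \<circ>\<^sub>a f))) (norm_form (tgt (g \<circ>\<^sub>a f)))) \<cdot> cls (reduce (src (g \<circ>\<^sub>a f)))"
      by (simp add: t)
  qed
next
  case (ty_disj f A B g C D)
  have t: "src f = A" "tgt f = B" "src g = C" "tgt g = D"
    using ty_disj.hyps has_type_src_tgt by blast+
  let ?n = norm_form and ?r = "\<lambda>A. cls (reduce A)"
  show ?case
    unfolding atomic_natural_def
  proof (intro impI)
    assume "atomic (?n (src (f \<or>\<^sub>a g)))" "atomic (?n (tgt (f \<or>\<^sub>a g)))"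
    then have *: "atomic (ndisj (?n A) (?n C))" "atomic (ndisj (?n B) (?n D))" by (simp_all add: t)
    have a: "atomic (?n A)" "atomic (?n B)" "atomic (?n C)" "atomic (?n D)"
      using * *[THEN atomic_ndisjD] by auto
    have "?r (B \<or>\<^sub>f D) \<cdot> (cls f \<squnion> cls g)
        = cls (reduce_or (?n B) (?n D)) \<cdot> (cls (compare (?n A) (?n B)) \<squnion> cls (compare (?n C) (?n D))) \<cdot> (?r A \<squnion> ?r C)"
      using ty_disj.IH a by (simp add: atomic_natural_def t comp_assoc Or.interchange[symmetric])
    also have "\<dots> = cls (compare (ndisj (?n A) (?n C)) (ndisj (?n B) (?n D))) \<cdot> ?r (A \<or>\<^sub>f C)"
      using reduce_or_compare[OF * atomic_arrow[OF ty_disj.hyps(1) a(1,2)] atomic_arrow[OF ty_disj.hyps(2) a(3,4)], THEN extend]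
      by (simp add: comp_assoc)
    finally show "?r (tgt (f \<or>\<^sub>a g)) \<cdot> cls (f \<or>\<^sub>a g)
      = cls (compare (?n (src (f \<or>\<^sub>a g))) (?n (tgt (f \<or>\<^sub>a g)))) \<cdot> ?r (src (f \<or>\<^sub>a g))"
      by (simp add: t)
  qed
next
  case (ty_conj f A B g C D)
  have t: "src f = A" "tgt f = B" "src g = C" "tgt g = D"
    using ty_conj.hyps has_type_src_tgt by blast+
  let ?n = norm_form and ?r = "\<lambda>A. cls (reduce A)"
  show ?case
    unfolding atomic_natural_def
  proof (intro impI)
    assume "atomic (?n (src (f \<and>\<^sub>a g)))" "atomic (?n (tgt (f \<and>\<^sub>a g)))"
    then have *: "atomic (nconj (?n A) (?n C))" "atomic (nconj (?n B) (?n D))" by (simp_all add: t)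
    have a: "atomic (?n A)" "atomic (?n B)" "atomic (?n C)" "atomic (?n D)"
      using * *[THEN atomic_nconjD] by auto
    have "?r (B \<and>\<^sub>f D) \<cdot> (cls f \<sqinter> cls g)
        = cls (reduce_and (?n B) (?n D)) \<cdot> (cls (compare (?n A) (?n B)) \<sqinter> cls (compare (?n C) (?n D))) \<cdot> (?r A \<sqinter> ?r C)"
      using ty_conj.IH a by (simp add: atomic_natural_def t comp_assoc And.interchange[symmetric])
    also have "\<dots> = cls (compare (nconj (?n A) (?n C)) (nconj (?n B) (?n D))) \<cdot> ?r (A \<and>\<^sub>f C)"
      using reduce_and_compare[OF * atomic_arrow[OF ty_conj.hyps(1) a(1,2)] atomic_arrow[OF ty_conj.hyps(2) a(3,4)], THEN extend]
      by (simp add: comp_assoc)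
    finally show "?r (tgt (f \<and>\<^sub>a g)) \<cdot> cls (f \<and>\<^sub>a g)
      = cls (compare (?n (src (f \<and>\<^sub>a g))) (?n (tgt (f \<and>\<^sub>a g)))) \<cdot> ?r (src (f \<and>\<^sub>a g))"
      by (simp add: t)
  qed
qed (auto intro!: atomic_naturalI preserves_reduce_or preserves_reduce_and preserves_reduce_constants
    simp: atomic_natural_def[of "Ident _"] atomic_natural_def[of Kappa] simp del: norm_form.simps(1,2))

lemma thin_atomic:
  assumes "atomic (norm_form A)" "atomic (norm_form B)"
  shows "thin A B"
  unfolding thin_def
proof (intro allI impI)
  fix f g assume f: "f \<turnstile> A \<rightarrow> B" and g: "g \<turnstile> A \<rightarrow> B"
  obtain e where e: "Arr.inverse (cls (reduce B)) (cls e)"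
    using ex_expand by (auto simp: expand_def)
  have "cls (reduce B) \<cdot> cls f = cls (reduce B) \<cdot> cls g"
    using atomic_natural_typed[OF f] atomic_natural_typed[OF g] assms has_type_src_tgt[OF f] has_type_src_tgt[OF g]
    by (simp add: atomic_natural_def)
  then have "cls f = cls g"
    using has_type_src_tgt[OF f] has_type_src_tgt[OF g]
    by - (rule Arr.inverse_cancel_left[OF e], auto)
  then show "f \<approx> g" using f by (rule cls_eqD)
qed

section \<open>Coherence\<close>

lemma pure_constant_free: "constant_free A \<Longrightarrow> pure A"
  by (simp add: pure_iff constant_free_norm_form)

text \<open>The restricted source is \<open>\<bottom>\<close>-pure because no \<open>\<bottom>\<close> is created by the restriction, and \<open>\<top>\<close>-pure
  because it has an arrow to a \<open>\<top>\<close>-pure formula; so uniqueness for targets with fewer letters applies.\<close>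

lemma thin_into_conj:
  fixes A B1 B2 :: "'p form"
  assumes smaller: "\<And>(X :: 'p form) C. card (letters C) < n \<Longrightarrow> pure X \<Longrightarrow> diversified X \<Longrightarrow> constant_free C \<Longrightarrow>
      diversified C \<Longrightarrow> thin X C"
    and A: "pure A" "diversified A" and B: "constant_free (B1 \<and>\<^sub>f B2)" "diversified (B1 \<and>\<^sub>f B2)"
    and n: "card (letters (B1 \<and>\<^sub>f B2)) \<le> n"
  shows "thin A (B1 \<and>\<^sub>f B2)"
proof (rule thin_conj)
  let ?S = "letters B1"
  have disj: "letters B1 \<inter> letters B2 = {}" and div: "diversified B1" "diversified B2"
    using diversified_components[of B1 B2] B(2) by auto
  show cf: "constant_free B1" "constant_free B2" using B(1) by simp_all
  show "letters B1 \<subseteq> ?S" "letters B2 \<subseteq> - ?S" using disj by auto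
  have fin: "finite (letters C)" for C :: "'p form" by (induction C) auto
  have "card (letters B1) > 0" "card (letters B2) > 0"
    using cf fin constant_free_letters by (auto simp: card_gt_0_iff)
  then have "card (letters B1) < n" "card (letters B2) < n"
    using n disj fin by (auto simp: card_Un_disjoint)
  moreover have "pure (restrict T A)" if "f \<turnstile> restrict T A \<rightarrow> C" "constant_free C" for T f C
    using top_pure_mono[OF that(1)] pure_constant_free[OF that(2)] bot_pure_restrict[of A T] A(1)
    by (simp add: pure_def)
  ultimately show "\<exists>f. f \<turnstile> restrict ?S A \<rightarrow> B1 \<Longrightarrow> thin (restrict ?S A) B1"
    "\<exists>f. f \<turnstile> restrict (- ?S) A \<rightarrow> B2 \<Longrightarrow> thin (restrict (- ?S) A) B2"
    using smaller diversified_restrict[OF A(2)] cf div by blast+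
qed

lemma thin_pure_diversified:
  fixes A B :: "'p form"
  assumes "pure A" "diversified A" "pure B" "diversified B"
  shows "thin A B"
  using assms
proof (induction "card (letters B)" arbitrary: A B rule: less_induct)
  case less
  let ?A = "norm_form A" and ?B = "norm_form B"
  have cf: "constant_free ?A" "constant_free ?B"
    using less.prems by (simp_all add: pure_iff)
  have div: "diversified ?A" "diversified ?B"
    using less.prems by (simp_all add: diversified_def)
  have smaller: "thin X C" if "card (letters C) < card (letters ?B)" "pure X" "diversified X" "constant_free C"
      "diversified C" for X C :: "'p form"
    using less.hyps[of C X] that pure_constant_free[of C] by simp
  show ?case
  proof (cases "\<exists>f. f \<turnstile> ?A \<rightarrow> ?B")
    case False
    then show ?thesis by - (rule thin_norm_form, simp add: thin_def)
  next
    case True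
    then obtain f where f: "f \<turnstile> ?A \<rightarrow> ?B" by blast
    have "thin ?A ?B"
    proof (cases ?B)
      case (Conj B1 B2)
      have "thin ?A (B1 \<and>\<^sub>f B2)"
      proof (rule thin_into_conj)
        show "thin X C" if "card (letters C) < card (letters ?B)" "pure X" "diversified X"
            "constant_free C" "diversified C" for X C :: "'p form"
          using that by (rule smaller)
        show "pure ?A" using cf(1) by (rule pure_constant_free)
      qed (use cf div Conj in \<open>simp_all only: order_refl\<close>)
      then show ?thesis by (simp only: Conj)
    next
      case B: (Letter p)
      have A: "?A = Letter p"
        by (rule single_letter[OF cf(1)]) (simp only: occurrences_eq[OF f] B)
      show ?thesis unfolding A B by (rule thin_atomic) (simp_all add: atomic_def)
    next
      case B: (Disj B1 B2)
      show ?thesis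
      proof (cases ?A)
        case A: (Letter p)
        have "?B = Letter p"
          by (rule single_letter[OF cf(2)]) (simp only: occurrences_eq[OF f, symmetric] A)
        with B show ?thesis by simp
      next
        case A: (Conj A1 A2)
        have "letters B1 \<inter> letters B2 = {}"
          using div(2) unfolding B by (intro diversified_components(1)) blast
        then show ?thesis
          using no_arrow_conj_disj cf f unfolding A B by blast
      next
        case A: (Disj A1 A2)
        have cf_dual: "constant_free (dual C) \<longleftrightarrow> constant_free C" for C :: "'p form"
          by (induction C) auto
        \<comment> \<open>dually, the source is decomposed; source and target have the same letters\<close>
        have "thin (dual ?B) (dual A1 \<and>\<^sub>f dual A2)"
        proof (rule thin_into_conj)
          show "thin X C" if "card (letters C) < card (letters ?B)" "pure X" "diversified X"
              "constant_free C" "diversified C" for X C :: "'p form"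
            using that by (rule smaller)
          show "pure (dual ?B)" using pure_constant_free[OF cf(2)] by (simp only: pure_dual)
          show "diversified (dual ?B)" using div(2) by (simp only: diversified_dual)
          show "constant_free (dual A1 \<and>\<^sub>f dual A2)" using cf(1) unfolding A by (simp add: cf_dual)
          show "diversified (dual A1 \<and>\<^sub>f dual A2)" using div(1) diversified_dual[of ?A] unfolding A by simp
          show "card (letters (dual A1 \<and>\<^sub>f dual A2)) \<le> card (letters ?B)"
            using letters_eq[OF f] unfolding A by simp
        qed
        then show ?thesis using A by - (rule thin_dual, simp only: dual.simps)
      qed (use cf in auto)
    qed (use cf in auto)
    then show ?thesis by (rule thin_norm_form)
  qed
qed

lemma atomic_letterless: "letters A = {} \<Longrightarrow> atomic (norm_form A)"
proof -
  assume "letters A = {}"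
  then have "norm_form A = \<bottom>\<^sub>f \<or> norm_form A = \<top>\<^sub>f"
    by (induction A) (auto simp: ndisj.simps nconj.simps)
  then show ?thesis by (auto simp: atomic_def)
qed

lemma thin_arrows: "thin A B \<Longrightarrow> \<exists>\<^sub>\<le>\<^sub>1 f. f \<in> arrows A B"
  unfolding thin_def arrows_def by (rule Uniq_I) (auto elim!: quotientE intro!: equiv_class_eq[OF equiv_arrow_eq])

theorem theorem3p1:
  fixes A B :: "'p form"
  assumes "infinite (UNIV :: 'p set)"
    and "(pure A \<and> diversified A \<and> pure B \<and> diversified B) \<or> (letters A = {} \<and> letters B = {})"
  shows "\<exists>\<^sub>\<le>\<^sub>1 f. f \<in> arrows A B"
  using assms(2) thin_pure_diversified[of A B] thin_atomic[OF atomic_letterless atomic_letterless, of A B]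
  by (intro thin_arrows) blast

end
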